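(* Let $a,b,c$ be pairwise coprime positive integers such that none of $a,b,c$ is contained in the (additive) monoid generated by the remaining two, and let $X=X(a,b,c)$ be the blow-up of $\mathbb{P}(a,b,c)$ at $[1,1,1]$. Then the following statements are equivalent. (i) The Cox ring of $X$ is generated by elements of Rees multiplicity at most two. (ii) After suitably reordering $a,b,c$, one has $2a = nb+mc$ with positive integers $n,m$ such that $b\ge 3m$ and $c\ge 3n$. Moreover, if one of these conditions holds, then $X$ is a Mori dream surface and (with $a,b,c$ ordered and $n,m$ as in (ii)) its Cox ring is given as a $\mathrm{Cl}(X)=\mathbb{Z}^2$-graded algebra by $$\mathcal{R}(X)=\mathbb{K}[x,y,z,s_1,\ldots,s_4,t]/(I_2:t^\infty),$$ $$Q=\begin{bmatrix} a & b & c & 2a & \tfrac{b(c+n)}{2} & \tfrac{c(b+m)}{2} & bc & 0\\ 0&0&0&-1&-1&-1&-2&1\end{bmatrix},$$ where the columns of $Q$ are the degrees of the generators $x,y,z,s_1,\ldots,s_4,t$, whose Rees multiplicities are $0,0,0,1,1,1,2,-1$, respectively, and the ideal $I_2\subseteq\mathbb{K}[x,y,z,s_1,\ldots,s_4,t]$ is generated by the polynomials $$x^2-y^nz^m-s_1t,\qquad xz^{\frac{b-m}{2}}-y^{\frac{c+n}{2}}-s_2t,\qquad xy^{\frac{c-n}{2}}-z^{\frac{b+m}{2}}-s_3t,$$ $$xy^{\frac{c-3n}{2}}z^{\frac{b-3m}{2}}s_1-y^{\frac{c-n}{2}}s_2-z^{\frac{b-m}{2}}s_3-s_4t,\qquad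 y^{\frac{c-3n}{2}}z^{\frac{b-3m}{2}}s_1^2-s_2s_3-xs_4,$$ $$y^{\frac{c-n}{2}}s_1-z^ms_2-xs_3,\qquad z^{\frac{b-m}{2}}s_1-xs_2-y^ns_3,$$ $$s_3^2+y^{\frac{c-3n}{2}}s_1s_2-z^ms_4,\qquad s_2^2+z^{\frac{b-3m}{2}}s_1s_3-y^ns_4.$$
   Context: $\mathbb{K}$ is an algebraically closed field of characteristic zero. $\mathbb{P}(a,b,c)$ is the weighted projective plane over $\mathbb{K}$ with homogeneous coordinate ring (= Cox ring) $S=\mathbb{K}[x,y,z]$, $\mathbb{Z}$-graded by $\deg x=a$, $\deg y=b$, $\deg z=c$. $\pi\colon X\to\mathbb{P}(a,b,c)$ is the blow-up at $[1,1,1]$. The divisor class group $\mathrm{Cl}(X)=\mathbb{Z}^2$ has basis the classes of $H$ (the pullback of a generator $A$ of $\mathrm{Cl}(\mathbb{P}(a,b,c))\cong\mathbb{Z}$ of degree one) and $E$ (the exceptional divisor); $(d,\mu)$ stands for $dH+\mu E$. The Cox ring is $\mathcal{R}(X)=\bigoplus_{D\in\mathrm{Cl}(X)}\Gamma(X,\mathcal{O}(D))$, and $X$ is called a Mori dream surface if $\mathcal{R}(X)$ is a finitely generated $\mathbb{K}$-algebra. Let $I\subseteq S$ be the weighted homogeneous ideal of the point $(1,1,1)$ (the ideal generated by all homogeneous polynomials of $S$ vanishing at $(1,1,1)$) and $J=\langle x,y,z\rangle$. The Cox ring of $X$ is identified with the saturated Rees algebra $\bigoplus_{(d,\mu)\in\mathbb{Z}^2}(I^{-\mu}:J^\infty)_d\,t^\mu$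 (with $I^{k}=S$ for $k\le 0$), where the $(d,\mu)$-component corresponds to $\mathcal{R}(X)_{dH+\mu E}$; $t$ is the canonical section of $E$. A homogeneous element of $\mathcal{R}(X)$ has Rees multiplicity $\mu$ if it lies in $(I^{\mu}:J^\infty)t^{-\mu}$, i.e. if its degree is $dH-\mu E$ for some $d$. $I_2:t^\infty$ denotes the saturation of $I_2$ with respect to $t$. *)

theory Defs
  imports
    "HOL-Library.Poly_Mapping"
    "HOL-Library.Product_Plus"
    "HOL-Computational_Algebra.Polynomial"
begin

section \<open>Polynomials in a set of variables, gradings, ideals\<close>

type_synonym ('v, 'k) mpoly = "('v \<Rightarrow>\<^sub>0 nat) \<Rightarrow>\<^sub>0 'k"

definition mvar :: "'v \<Rightarrow> ('v, 'k::comm_ring_1) mpoly" where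
  "mvar v = Poly_Mapping.single (Poly_Mapping.single v 1) 1"

definition mconst :: "'k \<Rightarrow> ('v, 'k::comm_ring_1) mpoly" where
  "mconst r = Poly_Mapping.single 0 r"

definition meval :: "('v \<Rightarrow> 'k) \<Rightarrow> ('v, 'k::comm_ring_1) mpoly \<Rightarrow> 'k" where
  "meval p f = (\<Sum>m\<in>Poly_Mapping.keys f. Poly_Mapping.lookup f m *
     (\<Prod>v\<in>Poly_Mapping.keys m. p v ^ Poly_Mapping.lookup m v))"

definition monom_degree :: "('v \<Rightarrow> int) \<Rightarrow> ('v \<Rightarrow>\<^sub>0 nat) \<Rightarrow> int" where
  "monom_degree w m = (\<Sum>v\<in>Poly_Mapping.keys m. int (Poly_Mapping.lookup m v) * w v)"

definition homogeneous :: "('v \<Rightarrow> int) \<Rightarrow> int \<Rightarrow> ('v, 'k::comm_ring_1) mpoly \<Rightarrow> bool" where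
  "homogeneous w d f \<longleftrightarrow> (\<forall>m\<in>Poly_Mapping.keys f. monom_degree w m = d)"

lemma module_times: "module ((*) :: 'a::comm_ring_1 \<Rightarrow> 'a \<Rightarrow> 'a)"
  by unfold_locales (simp_all add: algebra_simps)

definition ideal_gen :: "'a::comm_ring_1 set \<Rightarrow> 'a set" where
  "ideal_gen G = module.span (*) G"

fun ideal_power :: "'a::comm_ring_1 set \<Rightarrow> nat \<Rightarrow> 'a set" where
  "ideal_power A 0 = UNIV"
| "ideal_power A (Suc k) = ideal_gen {f * g | f g. f \<in> A \<and> g \<in> ideal_power A k}"

text \<open>\<open>A : B\<^sup>\<infinity>\<close> for ideals \<open>A\<close>, \<open>B\<close>, and \<open>A : t\<^sup>\<infinity>\<close> for an element \<open>t\<close>.\<close>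

definition saturation :: "'a::comm_ring_1 set \<Rightarrow> 'a set \<Rightarrow> 'a set" where
  "saturation A B = {f. \<exists>k. \<forall>g\<in>ideal_power B k. f * g \<in> A}"

definition saturation_elem :: "'a::comm_ring_1 set \<Rightarrow> 'a \<Rightarrow> 'a set" where
  "saturation_elem A t = {f. \<exists>k. f * t ^ k \<in> A}"

section \<open>The Cox ring of the blow-up as a saturated Rees algebra\<close>

datatype coord = CX | CY | CZ

fun weights :: "nat \<Rightarrow> nat \<Rightarrow> nat \<Rightarrow> coord \<Rightarrow> nat" where
  "weights a b c CX = a"
| "weights a b c CY = b"
| "weights a b c CZ = c"

text \<open>\<open>S = K[x,y,z]\<close>, graded by a weight function on the coordinates.\<close>

type_synonym 'k cpoly = "(coord, 'k) mpoly"

definition point_ideal :: "(coord \<Rightarrow> nat) \<Rightarrow> 'k::comm_ring_1 cpoly set" where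
  "point_ideal w = ideal_gen {f. (\<exists>d. homogeneous (\<lambda>v. int (w v)) d f) \<and> meval (\<lambda>_. 1) f = 0}"

definition irrelevant_ideal :: "'k::comm_ring_1 cpoly set" where
  "irrelevant_ideal = ideal_gen {mvar CX, mvar CY, mvar CZ}"

text \<open>The ring \<open>S[t, t\<^sup>-\<^sup>1]\<close> of Laurent polynomials is the type of finitely supported
  functions from \<open>int\<close> (the exponent of \<open>t\<close>) to \<open>S\<close>.\<close>

type_synonym 'k laurent = "int \<Rightarrow>\<^sub>0 'k cpoly"

definition lconst :: "'k \<Rightarrow> 'k::comm_ring_1 laurent" where
  "lconst r = Poly_Mapping.single 0 (mconst r)"

text \<open>The component of degree \<open>dH + \<mu>E\<close>, namely \<open>(I\<^sup>-\<^sup>\<mu> : J\<^sup>\<infinity>)\<^sub>d t\<^sup>\<mu>\<close>.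
  The truncation performed by \<open>nat\<close> realises the convention
  \<open>I\<^sup>k = S\<close> for \<open>k \<le> 0\<close>.\<close>

definition cox_component :: "(coord \<Rightarrow> nat) \<Rightarrow> int \<times> int \<Rightarrow> 'k::comm_ring_1 laurent set" where
  "cox_component w = (\<lambda>(d, \<mu>). {Poly_Mapping.single \<mu> f | f.
     f \<in> saturation (ideal_power (point_ideal w) (nat (- \<mu>))) irrelevant_ideal \<and>
     homogeneous (\<lambda>v. int (w v)) d f})"

text \<open>The direct sum of the components, taken inside \<open>S[t, t\<^sup>-\<^sup>1]\<close>.\<close>

definition cox_ring :: "(coord \<Rightarrow> nat) \<Rightarrow> 'k::comm_ring_1 laurent set" where
  "cox_ring w = {\<Sum>\<delta>\<in>D. F \<delta> | F D. finite D \<and> (\<forall>\<delta>\<in>D. F \<delta> \<in> cox_component w \<delta>)}"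

definition rees_multiplicity :: "(coord \<Rightarrow> nat) \<Rightarrow> int \<Rightarrow> 'k::comm_ring_1 laurent \<Rightarrow> bool" where
  "rees_multiplicity w \<mu> F \<longleftrightarrow> (\<exists>d. F \<in> cox_component w (d, - \<mu>))"

definition subalgebra :: "'k::comm_ring_1 laurent set \<Rightarrow> bool" where
  "subalgebra A \<longleftrightarrow> range lconst \<subseteq> A \<and> (\<forall>F\<in>A. \<forall>G\<in>A. F + G \<in> A \<and> F * G \<in> A)"

definition cox_ring_generated_up_to :: "'k::comm_ring_1 itself \<Rightarrow> (coord \<Rightarrow> nat) \<Rightarrow> int \<Rightarrow> bool" where
  "cox_ring_generated_up_to K w k \<longleftrightarrow>
     (\<exists>G :: 'k laurent set. (\<forall>F\<in>G. \<exists>\<mu>\<le>k. rees_multiplicity w \<mu> F) \<and>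
        subalgebra hull G = cox_ring w)"

definition mori_dream_surface :: "'k::comm_ring_1 itself \<Rightarrow> (coord \<Rightarrow> nat) \<Rightarrow> bool" where
  "mori_dream_surface K w \<longleftrightarrow>
     (\<exists>G :: 'k laurent set. finite G \<and> subalgebra hull G = cox_ring w)"

section \<open>The explicit presentation\<close>

definition monoid2 :: "nat \<Rightarrow> nat \<Rightarrow> nat set" where
  "monoid2 p q = {i * p + j * q | i j. True}"

definition ordered_condition :: "nat \<Rightarrow> nat \<Rightarrow> nat \<Rightarrow> nat \<Rightarrow> nat \<Rightarrow> bool" where
  "ordered_condition a b c n m \<longleftrightarrow>
     n > 0 \<and> m > 0 \<and> 2 * a = n * b + m * c \<and> b \<ge> 3 * m \<and> c \<ge> 3 * n"

text \<open>Under the hypotheses of the theorem all divisions by two in the exponents and degrees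
  below are exact, and the subtractions do not truncate.\<close>

lemma ordered_condition_parity:
  assumes "ordered_condition a b c n m" "coprime b c" "a \<notin> monoid2 b c"
  shows "even (b - m)" "even (b + m)" "even (b - 3 * m)"
        "even (c - n)" "even (c + n)" "even (c - 3 * n)"
proof -
  have eq: "2 * a = n * b + m * c" and le: "3 * m \<le> b" "3 * n \<le> c"
    using assms(1) by (auto simp: ordered_condition_def)
  have ev: "even (n * b + m * c)" by (metis eq dvd_triv_left)
  have nn: "\<not> (even n \<and> even m)"
  proof
    assume "even n \<and> even m"
    then obtain i j where "n = 2 * i" "m = 2 * j" by (auto elim!: evenE)
    then have "a = i * b + j * c" using eq by simp
    then show False using assms(3) by (auto simp: monoid2_def)
  qed
  have "\<not> (even b \<and> even c)"
    using assms(2) by (metis coprime_common_divisor odd_one)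
  then have "even (b + m) \<and> even (c + n)" using ev nn by auto
  then show "even (b - m)" "even (b + m)" "even (b - 3 * m)"
        "even (c - n)" "even (c + n)" "even (c - 3 * n)"
    using le by auto
qed

datatype gen = GX | GY | GZ | GS1 | GS2 | GS3 | GS4 | GT

text \<open>The degree matrix \<open>Q\<close>; the pair \<open>(d, \<mu>)\<close> stands for \<open>dH + \<mu>E\<close>.\<close>

fun gen_degree :: "nat \<Rightarrow> nat \<Rightarrow> nat \<Rightarrow> nat \<Rightarrow> nat \<Rightarrow> gen \<Rightarrow> int \<times> int" where
  "gen_degree a b c n m GX = (int a, 0)"
| "gen_degree a b c n m GY = (int b, 0)"
| "gen_degree a b c n m GZ = (int c, 0)"
| "gen_degree a b c n m GS1 = (int (2 * a), -1)"
| "gen_degree a b c n m GS2 = (int (b * (c + n) div 2), -1)"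
| "gen_degree a b c n m GS3 = (int (c * (b + m) div 2), -1)"
| "gen_degree a b c n m GS4 = (int (b * c), -2)"
| "gen_degree a b c n m GT = (0, 1)"

definition bihomogeneous ::
    "('v \<Rightarrow> int \<times> int) \<Rightarrow> int \<times> int \<Rightarrow> ('v, 'k::comm_ring_1) mpoly \<Rightarrow> bool" where
  "bihomogeneous q \<delta> f \<longleftrightarrow>
     homogeneous (\<lambda>v. fst (q v)) (fst \<delta>) f \<and> homogeneous (\<lambda>v. snd (q v)) (snd \<delta>) f"

definition ideal_I2 :: "nat \<Rightarrow> nat \<Rightarrow> nat \<Rightarrow> nat \<Rightarrow> (gen, 'k::comm_ring_1) mpoly set" where
  "ideal_I2 b c n m =
    (let x = mvar GX; y = mvar GY; z = mvar GZ;
         s1 = mvar GS1; s2 = mvar GS2; s3 = mvar GS3; s4 = mvar GS4; t = mvar GT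
     in ideal_gen {
       x ^ 2 - y ^ n * z ^ m - s1 * t,
       x * z ^ ((b - m) div 2) - y ^ ((c + n) div 2) - s2 * t,
       x * y ^ ((c - n) div 2) - z ^ ((b + m) div 2) - s3 * t,
       x * y ^ ((c - 3 * n) div 2) * z ^ ((b - 3 * m) div 2) * s1
         - y ^ ((c - n) div 2) * s2 - z ^ ((b - m) div 2) * s3 - s4 * t,
       y ^ ((c - 3 * n) div 2) * z ^ ((b - 3 * m) div 2) * s1 ^ 2 - s2 * s3 - x * s4,
       y ^ ((c - n) div 2) * s1 - z ^ m * s2 - x * s3,
       z ^ ((b - m) div 2) * s1 - x * s2 - y ^ n * s3,
       s3 ^ 2 + y ^ ((c - 3 * n) div 2) * s1 * s2 - z ^ m * s4,
       s2 ^ 2 + z ^ ((b - 3 * m) div 2) * s1 * s3 - y ^ n * s4})"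

text \<open>A surjective homomorphism of \<open>\<int>\<^sup>2\<close>-graded \<open>K\<close>-algebras from the polynomial ring with
  degrees \<open>q\<close> onto the Cox ring, with kernel \<open>A\<close>; that is, an isomorphism of graded algebras
  from the quotient by \<open>A\<close> onto the Cox ring.\<close>

definition graded_presentation ::
    "(coord \<Rightarrow> nat) \<Rightarrow> ('v \<Rightarrow> int \<times> int) \<Rightarrow> ('v, 'k::comm_ring_1) mpoly set \<Rightarrow>
     (('v, 'k) mpoly \<Rightarrow> 'k laurent) \<Rightarrow> bool" where
  "graded_presentation w q A \<phi> \<longleftrightarrow>
     (\<forall>r. \<phi> (mconst r) = lconst r) \<and>
     (\<forall>f g. \<phi> (f + g) = \<phi> f + \<phi> g \<and> \<phi> (f * g) = \<phi> f * \<phi> g) \<and>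
     (\<forall>\<delta> f. bihomogeneous q \<delta> f \<longrightarrow> \<phi> f \<in> cox_component w \<delta>) \<and>
     range \<phi> = cox_ring w \<and>
     {f. \<phi> f = 0} = A"

text \<open>A reordering of the weights is a permutation \<open>\<sigma>\<close> of the coordinates: the roles of
  \<open>(a, x)\<close>, \<open>(b, y)\<close>, \<open>(c, z)\<close> are played by the weights and coordinates
  \<open>\<sigma> CX\<close>, \<open>\<sigma> CY\<close>, \<open>\<sigma> CZ\<close>. The generators \<open>x\<close>, \<open>y\<close>, \<open>z\<close> map to the corresponding
  coordinates and \<open>t\<close> to the canonical section of \<open>E\<close>.\<close>

definition cox_ring_presented ::
    "'k::comm_ring_1 itself \<Rightarrow> (coord \<Rightarrow> nat) \<Rightarrow> (coord \<Rightarrow> coord) \<Rightarrow> nat \<Rightarrow> nat \<Rightarrow> bool" where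
  "cox_ring_presented K w \<sigma> n m \<longleftrightarrow>
     (\<exists>\<phi> :: (gen, 'k) mpoly \<Rightarrow> 'k laurent.
        graded_presentation w
          (gen_degree (w (\<sigma> CX)) (w (\<sigma> CY)) (w (\<sigma> CZ)) n m)
          (saturation_elem (ideal_I2 (w (\<sigma> CY)) (w (\<sigma> CZ)) n m) (mvar GT)) \<phi> \<and>
        \<phi> (mvar GX) = Poly_Mapping.single 0 (mvar (\<sigma> CX)) \<and>
        \<phi> (mvar GY) = Poly_Mapping.single 0 (mvar (\<sigma> CY)) \<and>
        \<phi> (mvar GZ) = Poly_Mapping.single 0 (mvar (\<sigma> CZ)) \<and>
        \<phi> (mvar GT) = Poly_Mapping.single 1 1)"

end

(*  For homogeneous f the curve (s^a, s^b, s^c) is replaced by jets x = 1 + uT, y = 1 + vT, z = 1 at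
    the point: elements of the k-th symbolic power I^k : J^oo have jets divisible by T^k.

    (ii) ==> (i) and the presentation.  The nine generators of I_2, read at t = 0 as rewrite rules,
    reduce every word of weight k in x, y, z, s_1, ..., s_4 to standard words modulo weight k + 1.
    In a fixed degree there is at most one standard word for each exponent of s_1, and along jets
    for which s_1, s_2, s_3, s_4 have leading coefficients L, 1, L - 1, L^2 - L + 1 these words have
    linearly independent leading forms.  Hence a homogeneous element of the k-th symbolic power is a
    combination of words of weight at least k.  The kernel is I_2 : t^oo because a power of t turns
    every polynomial, modulo I_2, into one in x, y, z, t.

    (i) ==> (ii).  By Herzog, the ideal of the curve is given by the minors of a 2 x 3 matrix of
    powers of the variables.  If no reordering of the matrix yields (ii), then, up to reordering, the
    supports modulo z of the first and second symbolic powers are contained in explicit monomial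
    ideals M1 and M2, whereas the third symbolic power contains a combination of seven monomials of
    one lattice class whose restriction to z = 0 is not supported in M1 M2.  It does not lie in the
    subalgebra generated by elements of Rees multiplicity at most two. *)

theory Submission
  imports Defs
begin

section \<open>Evaluating polynomials in commutative rings\<close>

text \<open>Monomials do not vanish at the point, so an element lies in a symbolic power as soon as
  one monomial multiple of it lies in the ordinary power. The elements of multiplicity two and three
  below are all recognised in this way, through a multiple that is visibly in an ordinary power.

  For a homogeneous element, vanishing to order k amounts to k(k+1)/2 linear conditions on its
  coefficients: the moments of degree less than k of its exponents are zero. One monomial never
  meets the condition for k = 1, three monomials with non-collinear exponents never meet the three
  conditions for k = 2, and seven monomials always admit a nonzero solution of the six conditions
  for k = 3. These counts lie behind \<open>M1\<close>, \<open>M2\<close> and the witnesses of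
  multiplicity three.

  Condition (ii) depends on the signs of the differences \<open>a1 - a2\<close>,
  \<open>b1 - b2\<close>, \<open>c1 - c2\<close> of Herzog's exponents. It holds when some zero is
  followed, in cyclic order, by a nonnegative and then a nonpositive difference. The orientation
  matters: a zero followed by a negative and then a positive difference is one of the bad
  patterns.\<close>

abbreviation keys :: "('a \<Rightarrow>\<^sub>0 'b::zero) \<Rightarrow> 'a set" where "keys \<equiv> Poly_Mapping.keys"
abbreviation lookup :: "('a \<Rightarrow>\<^sub>0 'b::zero) \<Rightarrow> 'a \<Rightarrow> 'b" where "lookup \<equiv> Poly_Mapping.lookup"
abbreviation single :: "'a \<Rightarrow> 'b \<Rightarrow> 'a \<Rightarrow>\<^sub>0 'b::zero" where "single \<equiv> Poly_Mapping.single"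

lemma poly_mapping_sum_single:
  fixes f :: "'a \<Rightarrow>\<^sub>0 'b::comm_monoid_add"
  shows "(\<Sum>m\<in>keys f. single m (lookup f m)) = f"
  by (rule poly_mapping_eqI)
     (auto simp: lookup_sum lookup_single when_def in_keys_iff)

lemma poly_mapping_induct_single [case_names zero add]:
  fixes f :: "'a \<Rightarrow>\<^sub>0 'b::comm_monoid_add"
  assumes "P 0" "\<And>m r f. P f \<Longrightarrow> P (single m r + f)"
  shows "P f"
proof -
  have "P (\<Sum>m\<in>A. single m (lookup f m))" if "finite A" for A
    using that by induction (auto intro: assms)
  from this[OF finite_keys[of f]] show ?thesis by (simp add: poly_mapping_sum_single)
qed

lemma mvar_power: "mvar v ^ k = single (single v k) 1"
  by (induction k) (auto simp: mvar_def mult_single single_add[symmetric])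

lemma single_conv_mconst: "single m r = mconst r * single m 1"
  by (simp add: mconst_def mult_single)

lemma mconst_add: "mconst (r + s) = mconst r + mconst s"
  and mconst_mult: "mconst (r * s) = mconst r * mconst s"
  and mconst_uminus: "mconst (- r) = - mconst r"
  and mconst_0 [simp]: "mconst 0 = 0"
  and mconst_1 [simp]: "mconst 1 = 1"
  by (simp_all add: mconst_def single_add single_uminus mult_single)

lemma mpoly_induct [case_names const var add mult]:
  fixes f :: "('v, 'k::comm_ring_1) mpoly"
  assumes const: "\<And>r. P (mconst r)" and var: "\<And>v. P (mvar v)"
    and add: "\<And>f g. P f \<Longrightarrow> P g \<Longrightarrow> P (f + g)" and mult: "\<And>f g. P f \<Longrightarrow> P g \<Longrightarrow> P (f * g)"
  shows "P f"
proof -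
  have one: "P 1" using const[of 1] by simp
  have pow: "P (mvar v ^ k)" for v k
    by (induction k) (auto intro: one var mult)
  have mon: "P (single m 1)" for m
  proof (induction m rule: poly_mapping_induct_single)
    case zero
    then show ?case using one by simp
  next
    case (add v k m)
    have "single (single v k + m) (1::'k) = mvar v ^ k * single m 1"
      by (simp add: mvar_power mult_single)
    then show ?case using mult[OF pow add] by simp
  qed
  show ?thesis
  proof (induction f rule: poly_mapping_induct_single)
    case zero
    then show ?case using const[of 0] by simp
  next
    case (add m r f)
    have "P (mconst r * single m 1)" by (intro mult const mon)
    then show ?case using add assms(3) by (metis single_conv_mconst)
  qed
qed

definition monom_eval :: "('v \<Rightarrow> 'b::comm_ring_1) \<Rightarrow> ('v \<Rightarrow>\<^sub>0 nat) \<Rightarrow> 'b" where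
  "monom_eval p m = (\<Prod>v\<in>keys m. p v ^ lookup m v)"

lemma monom_eval_superset:
  assumes "finite A" "keys m \<subseteq> A"
  shows "monom_eval p m = (\<Prod>v\<in>A. p v ^ lookup m v)"
  unfolding monom_eval_def using assms
  by (intro prod.mono_neutral_left) (auto simp: in_keys_iff)

lemma monom_eval_add: "monom_eval p (m + m') = monom_eval p m * monom_eval p m'"
proof -
  let ?A = "keys m \<union> keys m'"
  have "keys (m + m') \<subseteq> ?A" by (rule keys_add)
  then show ?thesis
    by (simp add: monom_eval_superset[of ?A] lookup_add power_add prod.distrib)
qed

lemma monom_eval_0 [simp]: "monom_eval p 0 = 1"
  by (simp add: monom_eval_def)

lemma monom_eval_single [simp]: "monom_eval p (single v k) = p v ^ k"
  by (simp add: monom_eval_def)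

text \<open>One evaluation map with three targets: the field itself for values at the point,
  \<open>'k poly poly\<close> for jets, and Laurent polynomials for the presentation.\<close>

locale coeff_hom =
  fixes h :: "'k::comm_ring_1 \<Rightarrow> 'b::comm_ring_1"
  assumes h_add: "h (r + s) = h r + h s" and h_mult: "h (r * s) = h r * h s" and h_1: "h 1 = 1"
begin

lemma h_0: "h 0 = 0"
  using h_add[of 0 0] by simp

definition ev :: "('v \<Rightarrow> 'b) \<Rightarrow> ('v, 'k) mpoly \<Rightarrow> 'b" where
  "ev p f = (\<Sum>m\<in>keys f. h (lookup f m) * monom_eval p m)"

lemma ev_superset:
  assumes "finite A" "keys f \<subseteq> A"
  shows "ev p f = (\<Sum>m\<in>A. h (lookup f m) * monom_eval p m)"
  unfolding ev_def using assms
  by (intro sum.mono_neutral_left) (auto simp: in_keys_iff h_0)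

lemma ev_add: "ev p (f + g) = ev p f + ev p g"
proof -
  let ?A = "keys f \<union> keys g"
  have "keys (f + g) \<subseteq> ?A" by (rule keys_add)
  then show ?thesis
    by (simp add: ev_superset[of ?A] lookup_add h_add sum.distrib distrib_right)
qed

lemma ev_single: "ev p (single m r) = h r * monom_eval p m"
  by (simp add: ev_def h_0)

lemma ev_0 [simp]: "ev p 0 = 0"
  by (simp add: ev_def)

lemma ev_1 [simp]: "ev p 1 = 1"
  by (simp add: ev_def h_1)

lemma ev_const [simp]: "ev p (mconst r) = h r"
  by (simp add: mconst_def ev_single)

lemma ev_var [simp]: "ev p (mvar v) = p v"
  by (simp add: mvar_def ev_single h_1)

lemma ev_mult: "ev p (f * g) = ev p f * ev p g"
proof (induction f rule: poly_mapping_induct_single)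
  case (add m r f)
  have "ev p (single m r * g) = ev p (single m r) * ev p g"
  proof (induction g rule: poly_mapping_induct_single)
    case (add m' r' g)
    then show ?case
      by (simp add: distrib_left ev_add mult_single ev_single h_mult monom_eval_add algebra_simps)
  qed auto
  with add show ?case by (simp add: distrib_right ev_add)
qed auto

lemma ev_uminus: "ev p (- f) = - ev p f"
proof -
  have "ev p f + ev p (- f) = 0" using ev_add[of p f "- f"] by simp
  then show ?thesis by (rule minus_unique[symmetric])
qed

lemma ev_diff: "ev p (f - g) = ev p f - ev p g"
  using ev_add[of p f "- g"] by (simp add: ev_uminus)

lemma ev_power: "ev p (f ^ k) = ev p f ^ k"
  by (induction k) (auto simp: ev_mult)

lemma ev_sum: "ev p (sum f A) = (\<Sum>i\<in>A. ev p (f i))"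
  by (induction A rule: infinite_finite_induct) (auto simp: ev_add)

lemmas ev_simps = ev_add ev_mult ev_uminus ev_diff ev_power

end

interpretation id_hom: coeff_hom "\<lambda>r. r"
  by unfold_locales auto

lemma meval_conv: "meval p f = id_hom.ev p f"
  by (simp add: meval_def id_hom.ev_def monom_eval_def)

lemma monom_degree_superset:
  assumes "finite A" "keys m \<subseteq> A"
  shows "monom_degree w m = (\<Sum>v\<in>A. int (lookup m v) * w v)"
  unfolding monom_degree_def using assms
  by (intro sum.mono_neutral_left) (auto simp: in_keys_iff)

lemma monom_degree_add: "monom_degree w (m + m') = monom_degree w m + monom_degree w m'"
proof -
  let ?A = "keys m \<union> keys m'"
  have "keys (m + m') \<subseteq> ?A" by (rule keys_add)
  then show ?thesis
    by (simp add: monom_degree_superset[of ?A] lookup_add sum.distrib distrib_right)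
qed

lemma monom_degree_0 [simp]: "monom_degree w 0 = 0"
  by (simp add: monom_degree_def)

lemma monom_degree_single [simp]: "monom_degree w (single v k) = int k * w v"
  by (simp add: monom_degree_def)

lemma homogeneous_0 [simp]: "homogeneous w d 0"
  by (simp add: homogeneous_def)

lemma homogeneous_add: "homogeneous w d f \<Longrightarrow> homogeneous w d g \<Longrightarrow> homogeneous w d (f + g)"
  unfolding homogeneous_def using keys_add[of f g] by blast

lemma homogeneous_uminus: "homogeneous w d f \<Longrightarrow> homogeneous w d (- f)"
  unfolding homogeneous_def by (simp add: in_keys_iff)

lemma homogeneous_diff: "homogeneous w d f \<Longrightarrow> homogeneous w d g \<Longrightarrow> homogeneous w d (f - g)"
  using homogeneous_add[of w d f "- g"] homogeneous_uminus[of w d g] by simp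

lemma homogeneous_mult:
  assumes "homogeneous w d f" "homogeneous w e g"
  shows "homogeneous w (d + e) (f * g)"
  unfolding homogeneous_def
proof
  fix m assume "m \<in> keys (f * g)"
  then obtain p q where "m = p + q" "p \<in> keys f" "q \<in> keys g" using keys_mult[of f g] by blast
  then show "monom_degree w m = d + e" using assms by (simp add: homogeneous_def monom_degree_add)
qed

lemma homogeneous_single: "monom_degree w m = d \<Longrightarrow> homogeneous w d (single m r)"
  by (auto simp: homogeneous_def)

lemma homogeneous_mconst: "homogeneous w 0 (mconst r)"
  by (auto simp: mconst_def intro: homogeneous_single)

lemma homogeneous_sum: "(\<And>i. i \<in> A \<Longrightarrow> homogeneous w d (f i)) \<Longrightarrow> homogeneous w d (sum f A)"
  by (induction A rule: infinite_finite_induct) (auto intro: homogeneous_add)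

section \<open>Ideals\<close>

definition is_ideal :: "'a::comm_ring_1 set \<Rightarrow> bool" where
  "is_ideal A \<longleftrightarrow> 0 \<in> A \<and> (\<forall>f\<in>A. \<forall>g\<in>A. f + g \<in> A) \<and> (\<forall>r. \<forall>f\<in>A. r * f \<in> A)"

lemma is_idealD:
  assumes "is_ideal A"
  shows "0 \<in> A" "f \<in> A \<Longrightarrow> g \<in> A \<Longrightarrow> f + g \<in> A" "f \<in> A \<Longrightarrow> r * f \<in> A" "f \<in> A \<Longrightarrow> f * r \<in> A"
    "f \<in> A \<Longrightarrow> - f \<in> A" "f \<in> A \<Longrightarrow> g \<in> A \<Longrightarrow> f - g \<in> A"
proof -
  have m: "\<And>r f. f \<in> A \<Longrightarrow> r * f \<in> A" and p: "\<And>f g. f \<in> A \<Longrightarrow> g \<in> A \<Longrightarrow> f + g \<in> A"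
    using assms by (auto simp: is_ideal_def)
  have n: "\<And>f. f \<in> A \<Longrightarrow> - f \<in> A" using m[of _ "-1"] by simp
  show "0 \<in> A" using assms by (simp add: is_ideal_def)
  show "f \<in> A \<Longrightarrow> g \<in> A \<Longrightarrow> f + g \<in> A" by (rule p)
  show "f \<in> A \<Longrightarrow> r * f \<in> A" by (rule m)
  show "f \<in> A \<Longrightarrow> f * r \<in> A" using m[of f r] by (simp add: mult.commute)
  show "f \<in> A \<Longrightarrow> - f \<in> A" by (rule n)
  show "f \<in> A \<Longrightarrow> g \<in> A \<Longrightarrow> f - g \<in> A"
    using p[of f "- g"] n[of g] by simp
qed

lemma is_ideal_sum: "is_ideal A \<Longrightarrow> (\<And>i. i \<in> B \<Longrightarrow> f i \<in> A) \<Longrightarrow> sum f B \<in> A"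
  by (induction B rule: infinite_finite_induct) (auto simp: is_idealD(1,2))

lemma is_ideal_subspace: "is_ideal A \<longleftrightarrow> module.subspace (*) A"
  by (simp add: is_ideal_def module.subspace_def[OF module_times])

lemma is_ideal_ideal_gen: "is_ideal (ideal_gen G)"
  unfolding is_ideal_subspace ideal_gen_def by (rule module.subspace_span[OF module_times])

lemma ideal_gen_base: "f \<in> G \<Longrightarrow> f \<in> ideal_gen G"
  unfolding ideal_gen_def by (rule module.span_base[OF module_times])

lemma ideal_gen_minimal: "G \<subseteq> A \<Longrightarrow> is_ideal A \<Longrightarrow> ideal_gen G \<subseteq> A"
  unfolding is_ideal_subspace ideal_gen_def by (rule module.span_minimal[OF module_times])

lemma is_ideal_ideal_power: "is_ideal (ideal_power A k)"
  by (cases k) (simp_all add: is_ideal_ideal_gen, simp add: is_ideal_def)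

lemma ideal_power_mult:
  "f \<in> ideal_power A k \<Longrightarrow> g \<in> ideal_power A l \<Longrightarrow> f * g \<in> ideal_power A (k + l)"
proof (induction k arbitrary: f g)
  case 0
  then show ?case by (simp add: is_idealD[OF is_ideal_ideal_power])
next
  case (Suc k)
  let ?T = "{f. f * g \<in> ideal_power A (Suc k + l)}"
  have "is_ideal ?T"
    using is_ideal_ideal_power[of A "Suc k + l"]
    by (auto simp: is_ideal_def distrib_right mult.assoc simp del: ideal_power.simps)
  moreover have "{f * g |f g. f \<in> A \<and> g \<in> ideal_power A k} \<subseteq> ?T"
  proof safe
    fix f1 g1 assume "f1 \<in> A" "g1 \<in> ideal_power A k"
    then have "f1 * (g1 * g) \<in> ideal_power A (Suc (k + l))"
      using Suc.IH[OF _ Suc.prems(2)] by (auto intro: ideal_gen_base)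
    then show "f1 * g1 * g \<in> ideal_power A (Suc k + l)" by (simp add: mult.assoc)
  qed
  ultimately have "ideal_power A (Suc k) \<subseteq> ?T" by (simp add: ideal_gen_minimal)
  with Suc.prems show ?case by blast
qed

lemma ideal_power_1: "f \<in> A \<Longrightarrow> f \<in> ideal_power A 1"
proof -
  assume "f \<in> A"
  then have "f \<in> {f * g |f g. f \<in> A \<and> g \<in> ideal_power A 0}" by (metis (mono_tags, lifting) CollectI UNIV_I ideal_power.simps(1) mult.right_neutral)
  then show ?thesis by (simp add: ideal_gen_base del: ideal_power.simps(1))
qed

lemma ideal_power_power: "f \<in> A \<Longrightarrow> f ^ k \<in> ideal_power A k"
proof (induction k)
  case (Suc k)
  then show ?case using ideal_power_mult[OF ideal_power_1[of f A] Suc.IH] by simp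
qed simp

lemma ideal_power_antimono:
  assumes "l \<le> k"
  shows "ideal_power A k \<subseteq> ideal_power A l"
proof (rule lift_Suc_antimono_le[OF _ assms])
  fix i
  have "{f * g |f g. f \<in> A \<and> g \<in> ideal_power A i} \<subseteq> ideal_power A i"
    using is_idealD(3)[OF is_ideal_ideal_power] by blast
  then show "ideal_power A (Suc i) \<subseteq> ideal_power A i"
    by (simp add: ideal_gen_minimal is_ideal_ideal_power)
qed

definition radical :: "'a::comm_ring_1 set \<Rightarrow> 'a set" where
  "radical A = {f. \<exists>k. f ^ k \<in> A}"

lemma radicalI: "f ^ k \<in> A \<Longrightarrow> f \<in> radical A"
  by (auto simp: radical_def)

lemma radical_power: "f ^ k \<in> radical A \<Longrightarrow> f \<in> radical A"
  by (auto simp: radical_def power_mult[symmetric])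

lemma is_ideal_radical:
  assumes "is_ideal A"
  shows "is_ideal (radical A)"
proof -
  note D = is_idealD[OF assms]
  have up: "f ^ k \<in> A" if "f ^ l \<in> A" "l \<le> k" for f k l
    using D(4)[OF that(1), of "f ^ (k - l)"] that(2) by (simp add: power_add[symmetric])
  have "0 \<in> radical A" using D(1) by (intro radicalI[of _ 1]) simp
  moreover have "f + g \<in> radical A" if fg: "f \<in> radical A" "g \<in> radical A" for f g
  proof -
    obtain k l where kl: "f ^ k \<in> A" "g ^ l \<in> A" using fg by (auto simp: radical_def)
    have "of_nat (k + l choose i) * f ^ i * g ^ (k + l - i) \<in> A" for i
    proof (cases "k \<le> i")
      case True
      then show ?thesis using up[OF kl(1)] D(3,4) by blast
    next
      case False
      then show ?thesis using up[OF kl(2), of "k + l - i"] D(3) by simp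
    qed
    then have "(f + g) ^ (k + l) \<in> A"
      unfolding binomial_ring by (intro is_ideal_sum[OF assms])
    then show ?thesis by (rule radicalI)
  qed
  moreover have "r * f \<in> radical A" if "f \<in> radical A" for r f
    using that D(3) by (auto simp: radical_def power_mult_distrib)
  ultimately show ?thesis by (auto simp: is_ideal_def)
qed

section \<open>Symbolic powers of the ideal of the point\<close>

text \<open>Modulo the radical, \<open>x ^ p\<close> and \<open>y ^ p\<close> are powers of
  \<open>z\<close>, so \<open>(x * y * z) ^ p\<close> becomes
  \<open>z ^ (p + q + r)\<close>.\<close>

lemma radical_mem_of_binomials:
  fixes x y z :: "'a::comm_ring_1"
  assumes R: "is_ideal A" "is_ideal (radical A)"
    and xyz: "x * y * z \<in> radical A" and "x ^ p - z ^ q \<in> radical A" "y ^ p - z ^ r \<in> radical A"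
    and p: "p > 0"
  shows "z \<in> radical A"
proof -
  note D = is_idealD[OF R(2)]
  have "(x * y * z) ^ p \<in> radical A"
    using D(4)[OF xyz, of "(x * y * z) ^ (p - 1)"] p by (simp flip: power_Suc)
  moreover have "z ^ p * y ^ p * (x ^ p - z ^ q) + z ^ p * z ^ q * (y ^ p - z ^ r) \<in> radical A"
    using assms D(2,3) by blast
  ultimately have "(x * y * z) ^ p - (z ^ p * y ^ p * (x ^ p - z ^ q) + z ^ p * z ^ q * (y ^ p - z ^ r)) \<in> radical A"
    by (rule D(6))
  also have "(x * y * z) ^ p - (z ^ p * y ^ p * (x ^ p - z ^ q) + z ^ p * z ^ q * (y ^ p - z ^ r)) = z ^ (p + q + r)"
    by (simp add: power_mult_distrib power_add algebra_simps)
  finally show ?thesis by (rule radical_power)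
qed

definition TT :: "'a::comm_ring_1 poly" where
  "TT = [:0, 1:]"

lemma TT_dvd_iff: "TT dvd p \<longleftrightarrow> poly p 0 = 0" for p :: "'a::idom poly"
  using poly_eq_0_iff_dvd[of p 0] by (simp add: TT_def)

lemma TT_neq_0 [simp]: "TT \<noteq> (0 :: 'a::idom poly)"
  by (simp add: TT_def)

lemma TT_power_dvd_cancel:
  fixes p q :: "'a::idom poly"
  assumes "TT ^ k dvd q * p" "poly q 0 \<noteq> 0"
  shows "TT ^ k dvd p"
  using assms(1)
proof (induction k arbitrary: p)
  case (Suc k)
  have "TT dvd q * p" using Suc.prems by (metis dvd_mult_left power_Suc)
  then have "TT dvd p" using assms(2) by (simp add: TT_dvd_iff)
  then obtain p' where p': "p = TT * p'" by (auto elim: dvdE)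
  have "TT * TT ^ k dvd TT * (q * p')"
    using Suc.prems by (simp only: power_Suc p' mult.left_commute)
  then have "TT ^ k dvd q * p'" by simp
  then show ?case unfolding p' power_Suc by (rule mult_dvd_mono[OF dvd_refl Suc.IH])
qed simp

text \<open>The coordinates enter through arbitrary distinct names \<open>vx\<close>,
  \<open>vy\<close>, \<open>vz\<close>, so that every reordering of the weights is an instance and
  no later argument has to permute them.\<close>

locale blowup =
  fixes w :: "coord \<Rightarrow> nat" and vx vy vz :: coord and a b c :: nat
  assumes distinct_vars: "vx \<noteq> vy" "vx \<noteq> vz" "vy \<noteq> vz"
    and weights: "w vx = a" "w vy = b" "w vz = c"
    and pos: "a > 0" "b > 0" "c > 0"
begin

lemma coord_cases: "v = vx \<or> v = vy \<or> v = vz"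
  using distinct_vars by (cases v; cases vx; cases vy; cases vz) auto

definition ex :: "nat \<Rightarrow> nat \<Rightarrow> nat \<Rightarrow> coord \<Rightarrow>\<^sub>0 nat" where
  "ex i j l = single vx i + single vy j + single vz l"

lemma lookup_ex [simp]:
  "lookup (ex i j l) vx = i" "lookup (ex i j l) vy = j" "lookup (ex i j l) vz = l"
  using distinct_vars by (auto simp: ex_def lookup_add lookup_single when_def)

lemma ex_lookup: "ex (lookup m vx) (lookup m vy) (lookup m vz) = m"
proof (rule poly_mapping_eqI)
  show "lookup (ex (lookup m vx) (lookup m vy) (lookup m vz)) v = lookup m v" for v
    using coord_cases[of v] by auto
qed

lemma ex_inject [simp]: "ex i j l = ex i' j' l' \<longleftrightarrow> i = i' \<and> j = j' \<and> l = l'"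
  by (metis lookup_ex)

lemma ex_cases [case_names ex]: obtains i j l where "m = ex i j l"
  using ex_lookup by metis

lemma ex_add: "ex i j l + ex i' j' l' = ex (i + i') (j + j') (l + l')"
proof (rule poly_mapping_eqI)
  show "lookup (ex i j l + ex i' j' l') v = lookup (ex (i + i') (j + j') (l + l')) v" for v
    using coord_cases[of v] by (auto simp: lookup_add)
qed

lemma ex_0 [simp]: "ex 0 0 0 = 0"
  by (simp add: ex_def)

lemma monom_eval_ex: "monom_eval p (ex i j l) = p vx ^ i * p vy ^ j * p vz ^ l"
  by (simp add: ex_def monom_eval_add)

abbreviation deg :: "(coord \<Rightarrow>\<^sub>0 nat) \<Rightarrow> int" where
  "deg \<equiv> monom_degree (\<lambda>v. int (w v))"

abbreviation hom :: "int \<Rightarrow> 'k::comm_ring_1 cpoly \<Rightarrow> bool" where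
  "hom \<equiv> homogeneous (\<lambda>v. int (w v))"

lemma deg_ex: "deg (ex i j l) = int (a * i + b * j + c * l)"
  by (simp add: ex_def monom_degree_add weights mult.commute)

definition mon :: "nat \<Rightarrow> nat \<Rightarrow> nat \<Rightarrow> 'k::comm_ring_1 cpoly" where
  "mon i j l = single (ex i j l) 1"

lemma mon_mult: "mon i j l * mon i' j' l' = mon (i + i') (j + j') (l + l')"
  by (simp add: mon_def mult_single ex_add)

lemma mon_mult_assoc: "mon i j l * (mon i' j' l' * f) = mon (i + i') (j + j') (l + l') * f"
  by (simp add: mon_mult flip: mult.assoc)

lemma mon_0 [simp]: "mon 0 0 0 = 1"
  by (simp add: mon_def)

lemma mon_power: "mon i j l ^ k = mon (k * i) (k * j) (k * l)"
  by (induction k) (auto simp: mon_mult)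

lemma mvar_conv_mon: "mvar vx = mon 1 0 0" "mvar vy = mon 0 1 0" "mvar vz = mon 0 0 1"
  by (simp_all add: mvar_def mon_def ex_def)

lemma single_ex: "single (ex i j l) r = mconst r * mon i j l"
  unfolding mon_def by (rule single_conv_mconst)

lemma keys_mon [simp]: "keys (mon i j l :: 'k::comm_ring_1 cpoly) = {ex i j l}"
  by (simp add: mon_def)

lemma hom_mon: "int (a * i + b * j + c * l) = d \<Longrightarrow> hom d (mon i j l)"
  unfolding mon_def by (rule homogeneous_single) (simp add: deg_ex)

lemma hom_mconst_mult: "hom d f \<Longrightarrow> hom d (mconst r * f)"
  using homogeneous_mult[OF homogeneous_mconst, of _ d f r] by simp

definition sym :: "nat \<Rightarrow> 'k::comm_ring_1 cpoly set" where
  "sym k = saturation (ideal_power (point_ideal w) k) irrelevant_ideal"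

lemma is_ideal_point_ideal: "is_ideal (point_ideal w)"
  by (simp add: point_ideal_def is_ideal_ideal_gen)

lemma meval_mon: "id_hom.ev (\<lambda>_. 1) (mon i j l) = 1"
  by (simp add: mon_def id_hom.ev_single monom_eval_ex)

lemma point_idealI: "hom d f \<Longrightarrow> id_hom.ev (\<lambda>_. 1) f = 0 \<Longrightarrow> f \<in> point_ideal w"
  unfolding point_ideal_def by (rule ideal_gen_base) (auto simp: meval_conv)

lemma binomial_in_point_ideal:
  assumes "a * i + b * j + c * l = a * i' + b * j' + c * l'"
  shows "mon i j l - mon i' j' l' \<in> point_ideal w"
proof (rule point_idealI)
  show "hom (int (a * i + b * j + c * l)) (mon i j l - mon i' j' l')"
    by (intro homogeneous_diff hom_mon) (simp_all only: assms)
qed (simp add: id_hom.ev_diff meval_mon)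

definition order_ge :: "nat \<Rightarrow> 'k::comm_ring_1 cpoly set" where
  "order_ge K = {f. \<forall>i j l. ex i j l \<in> keys f \<longrightarrow> i + j + l \<ge> K}"

lemma is_ideal_order_ge: "is_ideal (order_ge K :: 'k::comm_ring_1 cpoly set)"
proof -
  have "r * f \<in> order_ge K" if f: "f \<in> order_ge K" for r f :: "'k cpoly"
    unfolding order_ge_def
  proof safe
    fix i j l assume "ex i j l \<in> keys (r * f)"
    then obtain p q where pq: "ex i j l = p + q" "q \<in> keys f" using keys_mult[of r f] by blast
    obtain i1 j1 l1 i2 j2 l2 where "p = ex i1 j1 l1" and q: "q = ex i2 j2 l2"
      by (metis ex_cases)
    then show "i + j + l \<ge> K" using pq f by (force simp: order_ge_def ex_add)
  qed
  moreover have "f + g \<in> order_ge K" if "f \<in> order_ge K" "g \<in> order_ge K" for f g :: "'k cpoly"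
    using that keys_add[of f g] by (fastforce simp: order_ge_def)
  moreover have "0 \<in> (order_ge K :: 'k cpoly set)" by (simp add: order_ge_def)
  ultimately show ?thesis unfolding is_ideal_def by blast
qed

lemma irrelevant_power_subset: "ideal_power irrelevant_ideal K \<subseteq> order_ge K"
proof (induction K)
  case 0
  then show ?case by (simp add: order_ge_def)
next
  case (Suc K)
  have "{mvar CX, mvar CY, mvar CZ} \<subseteq> (order_ge 1 :: 'a cpoly set)"
  proof -
    have "mvar v \<in> (order_ge 1 :: 'a cpoly set)" for v
      using coord_cases[of v] by (auto simp: mvar_conv_mon order_ge_def)
    then show ?thesis by blast
  qed
  then have J: "(irrelevant_ideal :: 'a cpoly set) \<subseteq> order_ge 1"
    unfolding irrelevant_ideal_def by (rule ideal_gen_minimal) (rule is_ideal_order_ge)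
  have "f * g \<in> order_ge (Suc K)" if f: "f \<in> order_ge 1" and g: "g \<in> order_ge K" for f g :: "'a cpoly"
    unfolding order_ge_def
  proof safe
    fix i j l assume "ex i j l \<in> keys (f * g)"
    then obtain p q where pq: "ex i j l = p + q" "p \<in> keys f" "q \<in> keys g"
      using keys_mult[of f g] by blast
    obtain i1 j1 l1 i2 j2 l2 where p: "p = ex i1 j1 l1" and q: "q = ex i2 j2 l2"
      by (metis ex_cases)
    have "i1 + j1 + l1 \<ge> 1" "i2 + j2 + l2 \<ge> K" using f g pq unfolding p q order_ge_def by blast+
    then show "i + j + l \<ge> Suc K" using pq(1) by (simp add: p q ex_add)
  qed
  then have "{f * g |f g. f \<in> irrelevant_ideal \<and> g \<in> ideal_power irrelevant_ideal K} \<subseteq> (order_ge (Suc K) :: 'a cpoly set)"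
    using J Suc.IH by blast
  then show ?case by (simp add: ideal_gen_minimal is_ideal_order_ge)
qed

text \<open>The quotient ideal \<open>A\<close> of all \<open>g\<close> with \<open>g * f\<close> in
  the power contains the power itself and a monomial. Its radical therefore contains
  \<open>x * y * z\<close> and all binomials of the point ideal, hence \<open>x\<close>,
  \<open>y\<close> and \<open>z\<close>; so \<open>A\<close> contains a power of the irrelevant
  ideal. Membership in a symbolic power is thereby reduced to a single multiple.\<close>

lemma saturation_of_monomial:
  fixes f :: "'k::comm_ring_1 cpoly"
  assumes "mon i0 j0 l0 * f \<in> ideal_power (point_ideal w) k"
  shows "f \<in> sym k"
proof -
  let ?P = "ideal_power (point_ideal w) k :: 'k cpoly set"
  define A where "A = {g. g * f \<in> ?P}"
  have A: "is_ideal A"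
    using is_ideal_ideal_power[of "point_ideal w" k]
    by (auto simp: A_def is_ideal_def distrib_right mult.assoc)
  have R: "is_ideal (radical A)" by (rule is_ideal_radical[OF A])
  define x y z :: "'k cpoly" where "x = mon 1 0 0" and "y = mon 0 1 0" and "z = mon 0 0 1"
  have P_sub: "?P \<subseteq> A" by (auto simp: A_def is_idealD(4)[OF is_ideal_ideal_power])
  have bin: "p \<in> radical A" if "p \<in> point_ideal w" for p
    using P_sub ideal_power_power[OF that, of k] by (blast intro: radicalI)
  let ?N = "i0 + j0 + l0"
  have "(x * y * z) ^ ?N = mon (j0 + l0) (i0 + l0) (i0 + j0) * mon i0 j0 l0"
    by (simp add: x_def y_def z_def mon_mult mon_power ac_simps)
  also have "\<dots> \<in> A" using assms by (intro is_idealD(3)[OF A]) (simp add: A_def)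
  finally have xyz: "x * y * z \<in> radical A" by (rule radicalI)
  have "x ^ c - z ^ a \<in> radical A" "y ^ c - z ^ b \<in> radical A" "x ^ b - y ^ a \<in> radical A"
    "z ^ b - y ^ c \<in> radical A" "y ^ a - x ^ b \<in> radical A" "z ^ a - x ^ c \<in> radical A"
    by (auto intro!: bin binomial_in_point_ideal simp: x_def y_def z_def mon_power)
  moreover have "x * z * y \<in> radical A" "y * z * x \<in> radical A" using xyz by (simp_all add: ac_simps)
  ultimately have "z \<in> radical A" "y \<in> radical A" "x \<in> radical A"
    using radical_mem_of_binomials[OF A R] xyz pos by blast+
  then obtain p q r where pqr: "x ^ p \<in> A" "y ^ q \<in> A" "z ^ r \<in> A" by (auto simp: radical_def)
  have "g \<in> A" if g: "g \<in> order_ge (p + q + r)" for g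
  proof -
    have "single m (lookup g m) \<in> A" if m: "m \<in> keys g" for m
    proof (cases m rule: ex_cases)
      case (ex i j l)
      then have "i \<ge> p \<or> j \<ge> q \<or> l \<ge> r" using g m by (fastforce simp: order_ge_def)
      moreover have "mon i j l = mon (i - p) j l * x ^ p" if "i \<ge> p"
        using that by (simp add: x_def mon_mult mon_power)
      moreover have "mon i j l = mon i (j - q) l * y ^ q" if "j \<ge> q"
        using that by (simp add: y_def mon_mult mon_power)
      moreover have "mon i j l = mon i j (l - r) * z ^ r" if "l \<ge> r"
        using that by (simp add: z_def mon_mult mon_power)
      ultimately have "mon i j l \<in> A" using pqr is_idealD(3)[OF A] by metis
      then show ?thesis unfolding ex single_ex by (rule is_idealD(3)[OF A])
    qed
    then have "(\<Sum>m\<in>keys g. single m (lookup g m)) \<in> A" by (rule is_ideal_sum[OF A])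
    then show ?thesis by (simp add: poly_mapping_sum_single)
  qed
  then have "\<forall>g\<in>ideal_power irrelevant_ideal (p + q + r). f * g \<in> ?P"
    using irrelevant_power_subset by (fastforce simp: A_def mult.commute)
  then show ?thesis unfolding sym_def saturation_def by blast
qed

lemma sym_iff: "f \<in> sym k \<longleftrightarrow> (\<exists>N. mon N N N * f \<in> ideal_power (point_ideal w) k)"
proof
  assume "f \<in> sym k"
  then obtain N where N: "\<forall>g\<in>ideal_power irrelevant_ideal N. f * g \<in> ideal_power (point_ideal w) k"
    by (auto simp: sym_def saturation_def)
  have "mvar vx \<in> irrelevant_ideal" unfolding irrelevant_ideal_def
    by (rule ideal_gen_base) (cases vx, auto)
  then have "f * mvar vx ^ N \<in> ideal_power (point_ideal w) k"
    using N ideal_power_power by blast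
  then have "mon 0 N N * (f * mvar vx ^ N) \<in> ideal_power (point_ideal w) k"
    by (rule is_idealD(3)[OF is_ideal_ideal_power])
  moreover have "mon 0 N N * (f * mvar vx ^ N) = mon N N N * f"
    by (simp add: mvar_conv_mon mon_power mult.commute[of f] mon_mult_assoc)
  ultimately show "\<exists>N. mon N N N * f \<in> ideal_power (point_ideal w) k" by metis
qed (auto intro: saturation_of_monomial)

lemma power_subset_sym: "f \<in> ideal_power (point_ideal w) k \<Longrightarrow> f \<in> sym k"
  using saturation_of_monomial[of 0 0 0 f k] by simp

lemma point_ideal_subset_sym: "f \<in> point_ideal w \<Longrightarrow> f \<in> sym 1"
  using ideal_power_1 power_subset_sym by blast

lemma sym_0 [simp]: "f \<in> sym 0"
  using power_subset_sym[of f 0] by simp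

lemma sym_mult: "f \<in> sym k \<Longrightarrow> g \<in> sym l \<Longrightarrow> f * g \<in> sym (k + l)"
proof -
  assume "f \<in> sym k" "g \<in> sym l"
  then obtain M N where "mon M M M * f \<in> ideal_power (point_ideal w) k"
      "mon N N N * g \<in> ideal_power (point_ideal w) l"
    by (auto simp: sym_iff)
  from ideal_power_mult[OF this] have "mon (M + N) (M + N) (M + N) * (f * g) \<in> ideal_power (point_ideal w) (k + l)"
    by (simp add: ac_simps flip: mon_mult)
  then show ?thesis by (rule saturation_of_monomial)
qed

lemma is_ideal_sym: "is_ideal (sym k)"
proof -
  note P = is_ideal_ideal_power[of "point_ideal w" k]
  have "f + g \<in> sym k" if "f \<in> sym k" "g \<in> sym k" for f g
  proof -
    obtain M N where MN: "mon M M M * f \<in> ideal_power (point_ideal w) k"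
        "mon N N N * g \<in> ideal_power (point_ideal w) k"
      using \<open>f \<in> sym k\<close> \<open>g \<in> sym k\<close> by (auto simp: sym_iff)
    have "mon N N N * (mon M M M * f) + mon M M M * (mon N N N * g) \<in> ideal_power (point_ideal w) k"
      using is_idealD[OF P] MN by blast
    also have "mon N N N * (mon M M M * f) + mon M M M * (mon N N N * g) = mon (M + N) (M + N) (M + N) * (f + g)"
      by (simp add: algebra_simps flip: mon_mult)
    finally show ?thesis by (rule saturation_of_monomial)
  qed
  moreover have "r * f \<in> sym k" if "f \<in> sym k" for r f
    using sym_mult[OF sym_0 that] by simp
  moreover have "0 \<in> sym k" using is_idealD(1)[OF P] power_subset_sym by blast
  ultimately show ?thesis by (auto simp: is_ideal_def)
qed

lemma sym_antimono: "f \<in> sym k \<Longrightarrow> l \<le> k \<Longrightarrow> f \<in> sym l"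
  using ideal_power_antimono[of l k "point_ideal w"] by (auto simp: sym_iff)

end

subsection \<open>The order of vanishing at the point\<close>

interpretation poly2_hom: coeff_hom "\<lambda>r. [:[:r:]:]"
  by unfold_locales (auto simp: one_pCons)

context blowup
begin

text \<open>Setting the third coordinate to 1 picks a slice through the point transverse to the
  orbit of the weighted torus action, so two directions suffice. They are polynomials over the
  field: the inner variable moves the jet in a pencil, the outer variable \<open>TT\<close> measures
  the order.\<close>

definition jet :: "'k::comm_ring_1 poly \<Rightarrow> 'k poly \<Rightarrow> 'k cpoly \<Rightarrow> 'k poly poly" where
  "jet u v = poly2_hom.ev (\<lambda>X. if X = vx then [:1, u:] else if X = vy then [:1, v:] else 1)"

lemma jet_simps: "jet u v (f + g) = jet u v f + jet u v g" "jet u v (f * g) = jet u v f * jet u v g"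
  "jet u v (f - g) = jet u v f - jet u v g" "jet u v (f ^ k) = jet u v f ^ k"
  "jet u v 0 = 0" "jet u v 1 = 1" "jet u v (mconst r) = [:[:r:]:]"
  by (simp_all add: jet_def poly2_hom.ev_simps)

lemma jet_sum: "jet u v (sum f A) = (\<Sum>i\<in>A. jet u v (f i))"
  by (simp add: jet_def poly2_hom.ev_sum)

lemma jet_mon: "jet u v (mon i j l) = [:1, u:] ^ i * [:1, v:] ^ j"
  using distinct_vars by (simp add: jet_def mon_def poly2_hom.ev_single monom_eval_ex
      flip: one_pCons)

lemma poly_jet_0: "poly (jet u v f) 0 = [:id_hom.ev (\<lambda>_. 1) f:]"
  by (induction f rule: mpoly_induct) (auto simp: jet_def poly2_hom.ev_simps id_hom.ev_simps)

text \<open>Jets of elements of the point ideal are divisible by \<open>TT\<close>; jets of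
  monomials take the value 1 at \<open>TT = 0\<close>, so the monomial that comes from the
  saturation cancels.\<close>

lemma sym_jet:
  fixes f :: "'k::idom cpoly"
  assumes "f \<in> sym k"
  shows "TT ^ k dvd jet u v f"
proof -
  have ideal: "is_ideal {f :: 'k cpoly. q dvd jet u v f}" for q
    by (auto simp: is_ideal_def jet_simps)
  have I: "(point_ideal w :: 'k cpoly set) \<subseteq> {f. TT dvd jet u v f}"
    unfolding point_ideal_def
  proof (rule ideal_gen_minimal[OF _ ideal], safe)
    fix f :: "'k cpoly" assume "meval (\<lambda>_. 1) f = 0"
    then have "poly (jet u v f) 0 = 0" by (simp add: poly_jet_0 meval_conv)
    then show "TT dvd jet u v f" by (simp add: TT_dvd_iff)
  qed
  have Ik: "(ideal_power (point_ideal w) k :: 'k cpoly set) \<subseteq> {f. TT ^ k dvd jet u v f}" for k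
  proof (induction k)
    case (Suc k)
    have "{f * g |f g. f \<in> point_ideal w \<and> g \<in> ideal_power (point_ideal w) k} \<subseteq> {f :: 'k cpoly. TT ^ Suc k dvd jet u v f}"
      using I Suc.IH by (auto simp: jet_simps intro!: mult_dvd_mono)
    then show ?case using ideal_gen_minimal[OF _ ideal[of "TT ^ Suc k"]] by simp
  qed simp
  obtain N where "mon N N N * f \<in> ideal_power (point_ideal w) k" using assms by (auto simp: sym_iff)
  then have "TT ^ k dvd jet u v (mon N N N) * jet u v f" using Ik[of k] by (auto simp flip: jet_simps(2))
  then show ?thesis by (rule TT_power_dvd_cancel) (simp add: jet_mon)
qed

section \<open>The Cox ring\<close>

lemma cox_component_iff:
  "F \<in> cox_component w (d, \<mu>) \<longleftrightarrow> (\<exists>f. F = single \<mu> f \<and> f \<in> sym (nat (- \<mu>)) \<and> hom d f)"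
  by (auto simp: cox_component_def sym_def)

lemma cox_component_mult:
  assumes "F \<in> cox_component w (d, \<mu>)" "G \<in> cox_component w (e, \<nu>)"
  shows "F * G \<in> cox_component w (d + e, \<mu> + \<nu>)"
proof -
  obtain f g where fg: "F = single \<mu> f" "f \<in> sym (nat (- \<mu>))" "hom d f"
      "G = single \<nu> g" "g \<in> sym (nat (- \<nu>))" "hom e g"
    using assms by (auto simp: cox_component_iff)
  \<comment> \<open>Truncation by \<open>nat\<close> makes the exponents subadditive only, so the
    product may lie in a higher symbolic power than required.\<close>
  have "f * g \<in> sym (nat (- (\<mu> + \<nu>)))"
    by (rule sym_antimono[OF sym_mult[OF fg(2,5)]]) simp
  then show ?thesis using fg by (auto simp: cox_component_iff mult_single intro: homogeneous_mult)
qed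

lemma cox_component_add:
  assumes "F \<in> cox_component w \<delta>" "G \<in> cox_component w \<delta>"
  shows "F + G \<in> cox_component w \<delta>"
proof (cases \<delta>)
  case (Pair d \<mu>)
  then obtain f g where "F = single \<mu> f" "f \<in> sym (nat (- \<mu>))" "hom d f"
      "G = single \<mu> g" "g \<in> sym (nat (- \<mu>))" "hom d g"
    using assms by (auto simp: cox_component_iff)
  then show ?thesis unfolding Pair cox_component_iff
    by (intro exI[of _ "f + g"]) (auto simp: single_add homogeneous_add is_idealD(2)[OF is_ideal_sym])
qed

lemma zero_cox_component: "0 \<in> cox_component w \<delta>"
  by (cases \<delta>) (auto simp: cox_component_iff is_idealD(1)[OF is_ideal_sym] intro!: exI[of _ 0])

lemma cox_component_subset: "F \<in> cox_component w \<delta> \<Longrightarrow> F \<in> cox_ring w"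
  unfolding cox_ring_def by (auto intro!: exI[of _ "\<lambda>_. F"] exI[of _ "{\<delta>}"])

lemma cox_ring_add: "F \<in> cox_ring w \<Longrightarrow> G \<in> cox_ring w \<Longrightarrow> F + G \<in> cox_ring w"
proof -
  assume "F \<in> cox_ring w" "G \<in> cox_ring w"
  then obtain F' D G' E where F: "F = (\<Sum>\<delta>\<in>D. F' \<delta>)" "finite D" "\<forall>\<delta>\<in>D. F' \<delta> \<in> cox_component w \<delta>"
    and G: "G = (\<Sum>\<delta>\<in>E. G' \<delta>)" "finite E" "\<forall>\<delta>\<in>E. G' \<delta> \<in> cox_component w \<delta>"
    by (auto simp: cox_ring_def)
  define H where "H \<delta> = (if \<delta> \<in> D then F' \<delta> else 0) + (if \<delta> \<in> E then G' \<delta> else 0)" for \<delta>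
  have "F = (\<Sum>\<delta>\<in>D \<union> E. if \<delta> \<in> D then F' \<delta> else 0)" "G = (\<Sum>\<delta>\<in>D \<union> E. if \<delta> \<in> E then G' \<delta> else 0)"
    unfolding F(1) G(1) using F(2) G(2) by (intro sum.mono_neutral_cong_left; auto)+
  then have "F + G = (\<Sum>\<delta>\<in>D \<union> E. H \<delta>)" by (simp add: H_def sum.distrib)
  moreover have "H \<delta> \<in> cox_component w \<delta>" for \<delta>
    unfolding H_def using F(3) G(3) by (intro cox_component_add) (auto simp: zero_cox_component)
  ultimately show ?thesis using F(2) G(2) unfolding cox_ring_def by blast
qed

lemma zero_cox_ring: "0 \<in> cox_ring w"
  using cox_component_subset zero_cox_component by blast

lemma cox_ring_sum: "(\<And>i. i \<in> A \<Longrightarrow> F i \<in> cox_ring w) \<Longrightarrow> sum F A \<in> cox_ring w"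
  by (induction A rule: infinite_finite_induct) (auto simp: zero_cox_ring intro!: cox_ring_add)

lemma subalgebra_cox_ring: "subalgebra (cox_ring w :: 'k::comm_ring_1 laurent set)"
proof -
  have "F * G \<in> cox_ring w" if FG: "F \<in> cox_ring w" "G \<in> cox_ring w" for F G :: "'k laurent"
  proof -
    obtain F' D G' E where F: "F = (\<Sum>\<delta>\<in>D. F' \<delta>)" "finite D" "\<forall>\<delta>\<in>D. F' \<delta> \<in> cox_component w \<delta>"
      and G: "G = (\<Sum>\<delta>\<in>E. G' \<delta>)" "finite E" "\<forall>\<delta>\<in>E. G' \<delta> \<in> cox_component w \<delta>"
      using FG by (auto simp: cox_ring_def)
    have "F' \<delta> * G' \<epsilon> \<in> cox_ring w" if "\<delta> \<in> D" "\<epsilon> \<in> E" for \<delta> \<epsilon>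
      using that F(3) G(3)
      by (intro cox_component_subset[of _ "\<delta> + \<epsilon>"]; cases \<delta>; cases \<epsilon>)
         (auto intro: cox_component_mult)
    then show ?thesis unfolding F(1) G(1) sum_product by (intro cox_ring_sum)
  qed
  moreover have "lconst r \<in> cox_ring w" for r :: 'k
    by (rule cox_component_subset[of _ "(0, 0)"])
       (auto simp: cox_component_iff lconst_def intro!: homogeneous_mconst)
  ultimately show ?thesis by (auto simp: subalgebra_def cox_ring_add)
qed

end

section \<open>Linear spans and leading forms\<close>

lemma module_mconst: "module (\<lambda>r (f :: ('v, 'k::comm_ring_1) mpoly). mconst r * f)"
  by unfold_locales (simp_all add: mconst_add mconst_mult algebra_simps)

definition lin :: "('v, 'k::comm_ring_1) mpoly set \<Rightarrow> ('v, 'k) mpoly set" where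
  "lin = module.span (\<lambda>r f. mconst r * f)"

lemmas lin_base = module.span_base[OF module_mconst, folded lin_def]
  and lin_add = module.span_add[OF module_mconst, folded lin_def]
  and lin_diff = module.span_diff[OF module_mconst, folded lin_def]
  and lin_scale = module.span_scale[OF module_mconst, folded lin_def]
  and lin_sum = module.span_sum[OF module_mconst, folded lin_def]
  and lin_mono = module.span_mono[OF module_mconst, folded lin_def]
  and lin_insert = module.span_insert[OF module_mconst, folded lin_def]
  and lin_minimal = module.span_minimal[OF module_mconst, folded lin_def]
  and lin_subspaceI = module.subspaceI[OF module_mconst]

text \<open>\<open>h\<close> may be zero. Hence \<open>lead k h F\<close> is stable under
  differences: it says that \<open>F\<close> vanishes to order at least \<open>k\<close>, with
  coefficient \<open>h\<close> there.\<close>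

definition lead :: "nat \<Rightarrow> 'a::idom \<Rightarrow> 'a poly \<Rightarrow> bool" where
  "lead k h F \<longleftrightarrow> (\<exists>G. F = TT ^ k * G \<and> poly G 0 = h)"

lemma lead_mult: "lead k h F \<Longrightarrow> lead l h' F' \<Longrightarrow> lead (k + l) (h * h') (F * F')"
  unfolding lead_def by (force simp: power_add)

lemma lead_power: "lead k h F \<Longrightarrow> lead (j * k) (h ^ j) (F ^ j)"
proof (induction j)
  case 0
  then show ?case by (auto simp: lead_def)
next
  case (Suc j)
  then show ?case using lead_mult[of k h F "j * k"] by simp
qed

lemma lead_diff: "lead k h F \<Longrightarrow> lead k h' F' \<Longrightarrow> lead k (h - h') (F - F')"
  unfolding lead_def by (metis poly_diff right_diff_distrib)

lemma lead_0: "poly F 0 = h \<Longrightarrow> lead 0 h F"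
  by (auto simp: lead_def)

lemma lead_cancel:
  assumes "lead k h (Q * F)" "poly Q 0 = 1"
  shows "lead k h F"
proof -
  obtain G where G: "Q * F = TT ^ k * G" "poly G 0 = h" using assms by (auto simp: lead_def)
  have "TT ^ k dvd Q * F" unfolding G(1) by (rule dvd_triv_left)
  then have "TT ^ k dvd F" using assms(2) by (intro TT_power_dvd_cancel[of k Q F]) simp_all
  then obtain H where H: "F = TT ^ k * H" by (auto elim: dvdE)
  then have "TT ^ k * (Q * H) = TT ^ k * G" using G by (simp add: mult.left_commute)
  then have "Q * H = G" by simp
  then have "poly H 0 = h" using G(2) assms(2) by auto
  then show ?thesis using H by (auto simp: lead_def)
qed

lemma linear_power_expansion:
  "\<exists>R. [:1, v:] ^ j = 1 + TT * [:of_nat j * v:] + TT ^ 2 * R" for v :: "'a::idom"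
proof (induction j)
  case 0
  then show ?case by (auto intro: exI[of _ 0])
next
  case (Suc j)
  then obtain R where R: "[:1, v:] ^ j = 1 + TT * [:of_nat j * v:] + TT ^ 2 * R" by blast
  have v: "[:1, v:] = 1 + TT * [:v:]" by (simp add: TT_def one_pCons)
  have s: "[:of_nat (Suc j) * v:] = [:of_nat j * v:] + [:v:]" by (simp add: algebra_simps)
  have "[:1, v:] ^ Suc j = 1 + TT * [:of_nat (Suc j) * v:] + TT ^ 2 * ([:v:] * [:of_nat j * v:] + R * [:1, v:])"
    unfolding power_Suc R s by (simp only: v) (simp add: algebra_simps power2_eq_square del: mult_pCons_left mult_pCons_right add_pCons)
  then show ?case by blast
qed

lemma (in blowup) jet_mon_expansion:
  "\<exists>R. jet u v (mon i j l) = 1 + TT * [:of_nat i * u + of_nat j * v:] + TT ^ 2 * R" for u v :: "'k::idom poly"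
proof -
  obtain R S where R: "[:1, u:] ^ i = 1 + TT * [:of_nat i * u:] + TT ^ 2 * R"
    and S: "[:1, v:] ^ j = 1 + TT * [:of_nat j * v:] + TT ^ 2 * S"
    using linear_power_expansion by metis
  have s: "[:of_nat i * u + of_nat j * v:] = [:of_nat i * u:] + [:of_nat j * v:]" by simp
  have "jet u v (mon i j l) = 1 + TT * [:of_nat i * u + of_nat j * v:] + TT ^ 2 *
    ([:of_nat i * u:] * [:of_nat j * v:] + R * [:1, v:] ^ j + (1 + TT * [:of_nat i * u:]) * S)"
    unfolding jet_mon R S s
    by (simp add: algebra_simps power2_eq_square del: mult_pCons_left mult_pCons_right add_pCons)
  then show ?thesis by blast
qed

lemma (in blowup) lead_jet_binomial:
  "lead 1 (of_nat i * u + of_nat j * v - (of_nat i' * u + of_nat j' * v)) (jet u v (mon i j l - mon i' j' l'))"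
  for u v :: "'k::idom poly"
proof -
  obtain R S where R: "jet u v (mon i j l) = 1 + TT * [:of_nat i * u + of_nat j * v:] + TT ^ 2 * R"
    and S: "jet u v (mon i' j' l') = 1 + TT * [:of_nat i' * u + of_nat j' * v:] + TT ^ 2 * S"
    using jet_mon_expansion by metis
  have "jet u v (mon i j l - mon i' j' l') =
      TT ^ 1 * ([:of_nat i * u + of_nat j * v:] - [:of_nat i' * u + of_nat j' * v:] + TT * (R - S))"
    unfolding jet_simps R S
    by (simp add: algebra_simps power2_eq_square del: mult_pCons_left mult_pCons_right add_pCons diff_pCons)
  then show ?thesis unfolding lead_def
    by (intro exI[of _ "[:of_nat i * u + of_nat j * v:] - [:of_nat i' * u + of_nat j' * v:] + TT * (R - S)"])
       (simp add: TT_def)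
qed

section \<open>The symbolic powers under condition (ii)\<close>

text \<open>The exponents of the presentation are parametrised without divisions: \<open>p = (c - 3n) / 2\<close> and
  \<open>q = (b - 3m) / 2\<close>.\<close>

locale ordered_blowup = blowup +
  fixes n m p q :: nat
  assumes n: "n > 0" and m: "m > 0" and b_eq: "b = 3 * m + 2 * q" and c_eq: "c = 3 * n + 2 * p"
    and a_eq: "2 * a = n * b + m * c" and coprime_bc: "coprime b c"
begin

text \<open>\<open>p1\<close>, ..., \<open>p4\<close> are the values of \<open>s1\<close>, ...,
  \<open>s4\<close> in \<open>S\<close> that the first four generators of \<open>I_2\<close>
  prescribe at \<open>t = 1\<close>. The other five generators become the identities in
  \<open>relations\<close>.\<close>

definition p1 :: "'k::comm_ring_1 cpoly" where "p1 = mon 2 0 0 - mon 0 n m"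
definition p2 :: "'k::comm_ring_1 cpoly" where "p2 = mon 1 0 (m + q) - mon 0 (2 * n + p) 0"
definition p3 :: "'k::comm_ring_1 cpoly" where "p3 = mon 1 (n + p) 0 - mon 0 0 (2 * m + q)"
definition p4 :: "'k::comm_ring_1 cpoly" where
  "p4 = mon 1 p q * p1 - mon 0 (n + p) 0 * p2 - mon 0 0 (m + q) * p3"

lemma mon_split:
  "mon 1 p q = mon 1 0 0 * mon 0 p 0 * mon 0 0 q" "mon 0 p q = mon 0 p 0 * mon 0 0 q"
  "mon 2 0 0 = mon 1 0 0 ^ 2" "mon 0 n m = mon 0 n 0 * mon 0 0 m"
  "mon 1 0 (m + q) = mon 1 0 0 * mon 0 0 m * mon 0 0 q" "mon 1 (n + p) 0 = mon 1 0 0 * mon 0 n 0 * mon 0 p 0"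
  "mon 0 (n + p) 0 = mon 0 n 0 * mon 0 p 0" "mon 0 0 (m + q) = mon 0 0 m * mon 0 0 q"
  "mon 0 (2 * n + p) 0 = mon 0 n 0 ^ 2 * mon 0 p 0" "mon 0 0 (2 * m + q) = mon 0 0 m ^ 2 * mon 0 0 q"
  by (simp_all add: mon_mult mon_power)

lemma relations:
  "mon 1 0 0 * p4 = mon 0 p q * p1 ^ 2 - p2 * (p3 :: 'k::comm_ring_1 cpoly)"
  "mon 0 (n + p) 0 * p1 = mon 0 0 m * p2 + mon 1 0 0 * (p3 :: 'k cpoly)"
  "mon 0 0 (m + q) * p1 = mon 1 0 0 * p2 + mon 0 n 0 * (p3 :: 'k cpoly)"
  "mon 0 0 m * p4 = p3 ^ 2 + mon 0 p 0 * p1 * (p2 :: 'k cpoly)"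
  "mon 0 n 0 * p4 = p2 ^ 2 + mon 0 0 q * p1 * (p3 :: 'k cpoly)"
  unfolding p4_def p3_def p2_def p1_def mon_split by (simp_all add: algebra_simps power2_eq_square)

lemma degrees:
  "2 * a = b * n + c * m"
  "b * (2 * n + p) = a + (c * m + c * q)"
  "c * (2 * m + q) = a + (b * n + b * p)"
  "b * (2 * n + p) = 2 * (b * n) + b * p"
  "c * (2 * m + q) = 2 * (c * m) + c * q"
  "b * c = b * (2 * n + p) + b * n + b * p"
  "b * c = c * (2 * m + q) + c * m + c * q"
  "b * c + a = b * (2 * n + p) + c * (2 * m + q)"
  "b * c + a = b * p + c * q + 4 * a"
proof -
  have a: "a = 3 * m * n + n * q + m * p" using a_eq by (simp add: b_eq c_eq algebra_simps)
  show "2 * a = b * n + c * m" using a_eq by (simp add: algebra_simps)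
  show "b * (2 * n + p) = a + (c * m + c * q)"
  "c * (2 * m + q) = a + (b * n + b * p)"
  "b * (2 * n + p) = 2 * (b * n) + b * p"
  "c * (2 * m + q) = 2 * (c * m) + c * q"
  "b * c = b * (2 * n + p) + b * n + b * p"
  "b * c = c * (2 * m + q) + c * m + c * q"
  "b * c + a = b * (2 * n + p) + c * (2 * m + q)"
  "b * c + a = b * p + c * q + 4 * a"
    unfolding a b_eq c_eq by (simp_all add: algebra_simps)
qed

end

section \<open>Reduction of words in the generators to standard words\<close>

context ordered_blowup
begin

definition word :: "nat \<Rightarrow> nat \<Rightarrow> nat \<Rightarrow> nat \<Rightarrow> nat \<Rightarrow> nat \<Rightarrow> nat \<Rightarrow> 'k::comm_ring_1 cpoly" where
  "word i j l e1 e2 e3 e4 = mon i j l * p1 ^ e1 * p2 ^ e2 * p3 ^ e3 * p4 ^ e4"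

definition wdeg :: "nat \<Rightarrow> nat \<Rightarrow> nat \<Rightarrow> nat \<Rightarrow> nat \<Rightarrow> nat \<Rightarrow> nat \<Rightarrow> nat" where
  "wdeg i j l e1 e2 e3 e4 = a * i + b * j + c * l + 2 * a * e1 + b * (2 * n + p) * e2
     + c * (2 * m + q) * e3 + b * c * e4"

definition Words :: "nat \<Rightarrow> nat \<Rightarrow> 'k::comm_ring_1 cpoly set" where
  "Words k d = {word i j l e1 e2 e3 e4 | i j l e1 e2 e3 e4.
     k \<le> e1 + e2 + e3 + 2 * e4 \<and> wdeg i j l e1 e2 e3 e4 = d}"

text \<open>The words divisible by none of the left sides \<open>x^2\<close>,
  \<open>y^(2n+p)\<close>, \<open>x y^(n+p)\<close>, \<open>y^(n+p) s2\<close>,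
  \<open>s2 s3\<close>, \<open>x s3\<close>, \<open>x s2\<close>, \<open>s3^2\<close>,
  \<open>s2^2\<close> of the rewrite rules. None of these involves \<open>z\<close>,
  \<open>s1\<close> or \<open>s4\<close>, whose exponents stay free.\<close>

definition standard :: "nat \<Rightarrow> nat \<Rightarrow> nat \<Rightarrow> nat \<Rightarrow> bool" where
  "standard i j e2 e3 \<longleftrightarrow> (e2, e3, i) = (0, 0, 0) \<and> j < 2 * n + p \<or> (e2, e3, i) = (0, 0, 1) \<and> j < n + p
     \<or> (e2, e3, i) = (1, 0, 0) \<and> j < n + p \<or> (e2, e3, i) = (0, 1, 0) \<and> j < 2 * n + p"

text \<open>\<open>r\<close> is a lower bound for the exponent of \<open>p1\<close>; the elimination
  raises it one step at a time until no standard word is left.\<close>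

definition Standard :: "nat \<Rightarrow> nat \<Rightarrow> nat \<Rightarrow> 'k::comm_ring_1 cpoly set" where
  "Standard r k d = {word i j l e1 e2 e3 e4 | i j l e1 e2 e3 e4.
     k = e1 + e2 + e3 + 2 * e4 \<and> wdeg i j l e1 e2 e3 e4 = d \<and> standard i j e2 e3 \<and> r \<le> e1}"

lemma WordsI: "k \<le> e1 + e2 + e3 + 2 * e4 \<Longrightarrow> wdeg i j l e1 e2 e3 e4 = d \<Longrightarrow> word i j l e1 e2 e3 e4 \<in> Words k d"
  unfolding Words_def by blast

lemma word_mult: "word i j l e1 e2 e3 e4 * word i' j' l' f1 f2 f3 f4 =
    word (i + i') (j + j') (l + l') (e1 + f1) (e2 + f2) (e3 + f3) (e4 + f4)"
  by (simp add: word_def power_add ac_simps flip: mon_mult)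

lemma word_relations:
  fixes t :: "'k::comm_ring_1 itself"
  shows
    "word 2 0 0 0 0 0 0 = word 0 n m 0 0 0 0 + (word 0 0 0 1 0 0 0 :: 'k cpoly)"
    "word 0 (2 * n + p) 0 0 0 0 0 = word 1 0 (m + q) 0 0 0 0 - (word 0 0 0 0 1 0 0 :: 'k cpoly)"
    "word 1 (n + p) 0 0 0 0 0 = word 0 0 (2 * m + q) 0 0 0 0 + (word 0 0 0 0 0 1 0 :: 'k cpoly)"
    "word 0 (n + p) 0 0 1 0 0 = word 1 p q 1 0 0 0 - word 0 0 (m + q) 0 0 1 0 - (word 0 0 0 0 0 0 1 :: 'k cpoly)"
    "word 0 0 0 0 1 1 0 = word 0 p q 2 0 0 0 - (word 1 0 0 0 0 0 1 :: 'k cpoly)"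
    "word 1 0 0 0 0 1 0 = word 0 (n + p) 0 1 0 0 0 - (word 0 0 m 0 1 0 0 :: 'k cpoly)"
    "word 1 0 0 0 1 0 0 = word 0 0 (m + q) 1 0 0 0 - (word 0 n 0 0 0 1 0 :: 'k cpoly)"
    "word 0 0 0 0 0 2 0 = word 0 0 m 0 0 0 1 - (word 0 p 0 1 1 0 0 :: 'k cpoly)"
    "word 0 0 0 0 2 0 0 = word 0 n 0 0 0 0 1 - (word 0 0 q 1 0 1 0 :: 'k cpoly)"
  using relations[where 'k = 'k] by (simp_all add: word_def p1_def p2_def p3_def p4_def)

lemma word_rewrite:
  fixes t :: "'k::comm_ring_1 itself"
  shows
  "word (i + 2) j l e1 e2 e3 e4 = word i (j + n) (l + m) e1 e2 e3 e4 + (word i j l (e1 + 1) e2 e3 e4 :: 'k cpoly)"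
  "word i (j + (2 * n + p)) l e1 e2 e3 e4 = word (i + 1) j (l + (m + q)) e1 e2 e3 e4 - (word i j l e1 (e2 + 1) e3 e4 :: 'k cpoly)"
  "word (i + 1) (j + (n + p)) l e1 e2 e3 e4 = word i j (l + (2 * m + q)) e1 e2 e3 e4 + (word i j l e1 e2 (e3 + 1) e4 :: 'k cpoly)"
  "word i (j + (n + p)) l e1 (e2 + 1) e3 e4 = word (i + 1) (j + p) (l + q) (e1 + 1) e2 e3 e4
     - word i j (l + (m + q)) e1 e2 (e3 + 1) e4 - (word i j l e1 e2 e3 (e4 + 1) :: 'k cpoly)"
  "word i j l e1 (e2 + 1) (e3 + 1) e4 = word i (j + p) (l + q) (e1 + 2) e2 e3 e4 - (word (i + 1) j l e1 e2 e3 (e4 + 1) :: 'k cpoly)"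
  "word (i + 1) j l e1 e2 (e3 + 1) e4 = word i (j + (n + p)) l (e1 + 1) e2 e3 e4 - (word i j (l + m) e1 (e2 + 1) e3 e4 :: 'k cpoly)"
  "word (i + 1) j l e1 (e2 + 1) e3 e4 = word i j (l + (m + q)) (e1 + 1) e2 e3 e4 - (word i (j + n) l e1 e2 (e3 + 1) e4 :: 'k cpoly)"
  "word i j l e1 e2 (e3 + 2) e4 = word i j (l + m) e1 e2 e3 (e4 + 1) - (word i (j + p) l (e1 + 1) (e2 + 1) e3 e4 :: 'k cpoly)"
  "word i j l e1 (e2 + 2) e3 e4 = word i (j + n) l e1 e2 e3 (e4 + 1) - (word i j (l + q) (e1 + 1) e2 (e3 + 1) e4 :: 'k cpoly)"
  using word_relations[where 'k = 'k, THEN arg_cong, of "(*) (word i j l e1 e2 e3 e4)"]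
  by (simp_all only: word_mult right_diff_distrib distrib_left add_0_right)

definition deg_s2 :: nat where "deg_s2 = b * (2 * n + p)"
definition deg_s3 :: nat where "deg_s3 = c * (2 * m + q)"
definition deg_s4 :: nat where "deg_s4 = b * c"

lemma wdeg_conv: "wdeg i j l e1 e2 e3 e4 =
    a * i + b * j + c * l + 2 * a * e1 + deg_s2 * e2 + deg_s3 * e3 + deg_s4 * e4"
  by (simp add: wdeg_def deg_s2_def deg_s3_def deg_s4_def)

lemma wdeg_eqs:
  "wdeg i (j + n) (l + m) e1 e2 e3 e4 = wdeg (i + 2) j l e1 e2 e3 e4"
  "wdeg i j l (e1 + 1) e2 e3 e4 = wdeg (i + 2) j l e1 e2 e3 e4"
  "wdeg (i + 1) j (l + (m + q)) e1 e2 e3 e4 = wdeg i (j + (2 * n + p)) l e1 e2 e3 e4"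
  "wdeg i j l e1 (e2 + 1) e3 e4 = wdeg i (j + (2 * n + p)) l e1 e2 e3 e4"
  "wdeg i j (l + (2 * m + q)) e1 e2 e3 e4 = wdeg (i + 1) (j + (n + p)) l e1 e2 e3 e4"
  "wdeg i j l e1 e2 (e3 + 1) e4 = wdeg (i + 1) (j + (n + p)) l e1 e2 e3 e4"
  "wdeg (i + 1) (j + p) (l + q) (e1 + 1) e2 e3 e4 = wdeg i (j + (n + p)) l e1 (e2 + 1) e3 e4"
  "wdeg i j (l + (m + q)) e1 e2 (e3 + 1) e4 = wdeg i (j + (n + p)) l e1 (e2 + 1) e3 e4"
  "wdeg i j l e1 e2 e3 (e4 + 1) = wdeg i (j + (n + p)) l e1 (e2 + 1) e3 e4"
  "wdeg i (j + p) (l + q) (e1 + 2) e2 e3 e4 = wdeg i j l e1 (e2 + 1) (e3 + 1) e4"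
  "wdeg (i + 1) j l e1 e2 e3 (e4 + 1) = wdeg i j l e1 (e2 + 1) (e3 + 1) e4"
  "wdeg i (j + (n + p)) l (e1 + 1) e2 e3 e4 = wdeg (i + 1) j l e1 e2 (e3 + 1) e4"
  "wdeg i j (l + m) e1 (e2 + 1) e3 e4 = wdeg (i + 1) j l e1 e2 (e3 + 1) e4"
  "wdeg i j (l + (m + q)) (e1 + 1) e2 e3 e4 = wdeg (i + 1) j l e1 (e2 + 1) e3 e4"
  "wdeg i (j + n) l e1 e2 (e3 + 1) e4 = wdeg (i + 1) j l e1 (e2 + 1) e3 e4"
  "wdeg i j (l + m) e1 e2 e3 (e4 + 1) = wdeg i j l e1 e2 (e3 + 2) e4"
  "wdeg i (j + p) l (e1 + 1) (e2 + 1) e3 e4 = wdeg i j l e1 e2 (e3 + 2) e4"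
  "wdeg i (j + n) l e1 e2 e3 (e4 + 1) = wdeg i j l e1 (e2 + 2) e3 e4"
  "wdeg i j (l + q) (e1 + 1) e2 (e3 + 1) e4 = wdeg i j l e1 (e2 + 2) e3 e4"
  using degrees[folded deg_s2_def deg_s3_def deg_s4_def] unfolding wdeg_conv
  by (simp_all only: distrib_left mult_1_right mult_2_right mult_2)

text \<open>The nine relations, read as rewrite rules from left to right, lower the measure of the induction.\<close>

lemma word_reduce:
  "word i j l e1 e2 e3 e4 \<in> lin (Standard 0 (e1 + e2 + e3 + 2 * e4) (wdeg i j l e1 e2 e3 e4)
     \<union> Words (Suc (e1 + e2 + e3 + 2 * e4)) (wdeg i j l e1 e2 e3 e4))"
proof (induction "2 * j + (4 * n + 2 * p - 1) * i + (6 * n + 4 * p) * (e2 + e3)"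
    arbitrary: i j l e1 e2 e3 e4 rule: less_induct)
  case less
  define M where "M = (\<lambda>i j e2 e3. 2 * j + (4 * n + 2 * p - 1) * i + (6 * n + 4 * p) * (e2 + e3))"
  define R :: "nat \<Rightarrow> nat \<Rightarrow> 'a cpoly set" where "R = (\<lambda>k d. lin (Standard 0 k d \<union> Words (Suc k) d))"
  \<comment> \<open>The measure gives weight 2 to \<open>y\<close>, \<open>W\<close> to
    \<open>x\<close>, and a common weight to \<open>p2\<close> and \<open>p3\<close>. The rules
    turning \<open>y^(2n+p)\<close> into \<open>x\<close> and \<open>x s2\<close> into
    \<open>y^n s3\<close> require \<open>2 * n < W < 4 * n + 2 * p\<close>. With weight 1 for
    \<open>y\<close> the bounds would be \<open>n\<close> and \<open>2 * n + p\<close>, which leaves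
    no integer for \<open>n = 1\<close>, \<open>p = 0\<close>.\<close>
  define W where "W = 4 * n + 2 * p - 1"
  have W: "4 * n + 2 * p = Suc W" "W \<ge> 3 * n + 2 * p" using n by (simp_all add: W_def)
  have M: "M i j e2 e3 = 2 * j + W * i + (6 * n + 4 * p) * e2 + (6 * n + 4 * p) * e3" for i j e2 e3
    unfolding M_def using W(1) by (simp add: algebra_simps)
  let ?k = "e1 + e2 + e3 + 2 * e4" and ?d = "wdeg i j l e1 e2 e3 e4"
  have IH: "word i' j' l' f1 f2 f3 f4 \<in> R k d"
    if "k = f1 + f2 + f3 + 2 * f4" "d = wdeg i' j' l' f1 f2 f3 f4" "M i' j' f2 f3 < M i j e2 e3"
    for i' j' l' f1 f2 f3 f4 k d
    using less.hyps[of j' i' f2 f3 l' f1 f4] that unfolding R_def M_def by blast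
  have big: "word i' j' l' f1 f2 f3 f4 \<in> R k d"
    if "k < f1 + f2 + f3 + 2 * f4" "d = wdeg i' j' l' f1 f2 f3 f4" for i' j' l' f1 f2 f3 f4 k d
    unfolding R_def using that by (intro lin_base UnI2 WordsI) auto
  have R_add: "f + g \<in> R k d" and R_diff: "f - g \<in> R k d" if "f \<in> R k d" "g \<in> R k d" for f g k d
    using that unfolding R_def by (auto intro: lin_add lin_diff)
  have "word i j l e1 e2 e3 e4 \<in> R ?k ?d"
  proof (cases "standard i j e2 e3")
    case True
    then show ?thesis unfolding R_def Standard_def by (intro lin_base UnI1) blast
  next
    case False
    consider "e2 \<ge> 1" "e3 \<ge> 1" | "e3 \<ge> 2" | "e2 \<ge> 2" | "e2 = 1" "e3 = 0" "i \<ge> 1" | "e2 = 1" "e3 = 0" "j \<ge> n + p"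
      | "e2 = 0" "e3 = 1" "i \<ge> 1" | "e2 = 0" "e3 = 1" "j \<ge> 2 * n + p" | "e2 = 0" "e3 = 0" "i \<ge> 2"
      | "e2 = 0" "e3 = 0" "i = 1" "j \<ge> n + p" | "e2 = 0" "e3 = 0" "i = 0" "j \<ge> 2 * n + p"
      using False unfolding standard_def prod.inject by (smt (verit) One_nat_def Suc_1 less_one not_less not_less_eq_eq le_antisym zero_le)
    then show ?thesis
    proof cases
      case 1
      then obtain e2' e3' where e: "e2 = e2' + 1" "e3 = e3' + 1" by (metis add.commute le_Suc_ex)
      show ?thesis unfolding e word_rewrite
        by (intro R_diff IH wdeg_eqs(10,11)[symmetric]) (use W n in \<open>auto simp: M e algebra_simps\<close>)
    next
      case 2
      then obtain e3' where e: "e3 = e3' + 2" by (metis add.commute le_Suc_ex)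
      show ?thesis unfolding e word_rewrite
        by (intro R_diff IH wdeg_eqs(16,17)[symmetric]) (use W n in \<open>auto simp: M e algebra_simps\<close>)
    next
      case 3
      then obtain e2' where e: "e2 = e2' + 2" by (metis add.commute le_Suc_ex)
      show ?thesis unfolding e word_rewrite
        by (intro R_diff IH wdeg_eqs(18,19)[symmetric]) (use W n in \<open>auto simp: M e algebra_simps\<close>)
    next
      case 4
      then obtain i' e2' where e: "e2 = e2' + 1" "i = i' + 1" by (metis add.commute add_0 le_Suc_ex)
      show ?thesis unfolding e word_rewrite
        by (intro R_diff IH wdeg_eqs(14,15)[symmetric]) (use W n in \<open>auto simp: M e algebra_simps\<close>)
    next
      case 5
      then obtain j' e2' where e: "e2 = e2' + 1" "j = j' + (n + p)" by (metis add.commute add_0 le_Suc_ex)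
      show ?thesis unfolding e word_rewrite
        by (intro R_diff IH big wdeg_eqs(7,8,9)[symmetric]) (use W n in \<open>auto simp: M e algebra_simps\<close>)
    next
      case 6
      then obtain i' e3' where e: "e3 = e3' + 1" "i = i' + 1" by (metis add.commute add_0 le_Suc_ex)
      show ?thesis unfolding e word_rewrite
        by (intro R_diff IH wdeg_eqs(12,13)[symmetric]) (use W n in \<open>auto simp: M e algebra_simps\<close>)
    next
      case 7
      then obtain j' where e: "j = j' + (2 * n + p)" by (metis add.commute le_Suc_ex)
      show ?thesis unfolding e word_rewrite
        by (intro R_diff IH big wdeg_eqs(3,4)[symmetric]) (use W n in \<open>auto simp: M e algebra_simps\<close>)
    next
      case 8
      then obtain i' where e: "i = i' + 2" by (metis add.commute le_Suc_ex)
      show ?thesis unfolding e word_rewrite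
        by (intro R_add IH big wdeg_eqs(1,2)[symmetric]) (use W n in \<open>auto simp: M e algebra_simps\<close>)
    next
      case 9
      then obtain i' j' where e: "i = i' + 1" "j = j' + (n + p)" by (metis add.commute add_0 le_Suc_ex)
      show ?thesis unfolding e word_rewrite
        by (intro R_add IH big wdeg_eqs(5,6)[symmetric]) (use W n in \<open>auto simp: M e algebra_simps\<close>)
    next
      case 10
      then obtain j' where e: "j = j' + (2 * n + p)" by (metis add.commute le_Suc_ex)
      show ?thesis unfolding e word_rewrite
        by (intro R_diff IH big wdeg_eqs(3,4)[symmetric]) (use W n in \<open>auto simp: M e algebra_simps\<close>)
    qed
  qed
  then show ?case unfolding R_def .
qed

text \<open>For fixed \<open>e1\<close> the total weight fixes \<open>e2 + e3\<close> and
  \<open>e4\<close>. For either value of \<open>e2 + e3\<close> there are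
  \<open>(2 * n + p) + (n + p) = c\<close> standard choices of \<open>i\<close>, \<open>j\<close>,
  \<open>e2\<close>, \<open>e3\<close>, numbered by \<open>J\<close> from 0 to \<open>c - 1\<close>.
  Since \<open>a\<close> is congruent to \<open>b * (2 * n + p)\<close> modulo \<open>c\<close>, the
  degree is \<open>b * J\<close> plus a constant modulo \<open>c\<close>, and \<open>b\<close> is
  invertible there; so the degree determines \<open>J\<close>, and then the exponent of
  \<open>z\<close>.\<close>

lemma standard_unique:
  assumes st: "standard i j e2 e3" "standard i' j' e2' e3'"
    and wt: "e1 + e2 + e3 + 2 * e4 = e1 + e2' + e3' + 2 * e4'"
    and dg: "wdeg i j l e1 e2 e3 e4 = wdeg i' j' l' e1 e2' e3' e4'"
  shows "i = i' \<and> j = j' \<and> l = l' \<and> e2 = e2' \<and> e3 = e3' \<and> e4 = e4'"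
proof -
  define J where "J i j e2 = (if i + e2 = (0::nat) then int j else int (j + (2 * n + p)))" for i j e2
  define L where "L i l e3 = int l - int (i * (m + q)) + int ((2 * m + q) * e3)" for i l e3
  have e: "e2 + e3 \<le> 1" "e2' + e3' \<le> 1" using st by (auto simp: standard_def)
  then have e4: "e4 = e4'" and e23: "e2 + e3 = e2' + e3'" using wt by arith+
  have w: "int (wdeg i j l e1 e2 e3 e4) = int b * J i j e2 + int c * L i l e3 + int (2 * a * e1 + b * c * e4)"
    if "standard i j e2 e3" for i j l e2 e3
  proof -
    have "int a = int b * int (2 * n + p) - int c * int (m + q)"
      using degrees(2) by (simp add: distrib_left flip: of_nat_mult of_nat_add)
    then show ?thesis using that unfolding standard_def
      by (elim disjE conjE) (auto simp: wdeg_def J_def L_def algebra_simps)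
  qed
  have "int b * J i j e2 + int c * L i l e3 = int b * J i' j' e2' + int c * L i' l' e3'"
    using w[OF st(1), of l] w[OF st(2), of l'] dg e4 by simp
  then have eq: "int b * (J i j e2 - J i' j' e2') = int c * (L i' l' e3' - L i l e3)"
    by (simp add: algebra_simps)
  then have "int c dvd int b * (J i j e2 - J i' j' e2')" by simp
  then have dvd: "int c dvd J i j e2 - J i' j' e2'"
    using coprime_bc by (simp add: coprime_dvd_mult_right_iff coprime_commute)
  have bnd: "0 \<le> J i j e2 \<and> J i j e2 < int c" if "standard i j e2 e3" for i j e2 e3
    using that by (auto simp: standard_def J_def c_eq)
  have JJ: "J i j e2 = J i' j' e2'"
  proof (rule ccontr)
    assume "J i j e2 \<noteq> J i' j' e2'"
    then have "int c \<le> \<bar>J i j e2 - J i' j' e2'\<bar>" using dvd by (intro zdvd_imp_le) (auto simp: zdvd_imp_le)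
    then show False using bnd[OF st(1)] bnd[OF st(2)] by linarith
  qed
  then have ij: "i = i' \<and> j = j' \<and> e2 = e2' \<and> e3 = e3'"
    using st e23 by (auto simp: standard_def J_def)
  moreover have "L i l e3 = L i' l' e3'" using eq JJ pos by simp
  ultimately have "l = l'" by (simp add: L_def)
  then show ?thesis using ij e4 by simp
qed

text \<open>The directions solve \<open>u - (2 * n + p) * v = 1\<close> and
  \<open>2 * u - n * v = L\<close> for the inner variable \<open>L = [:0, 1:]\<close>, so that
  \<open>p2\<close> and \<open>p1\<close> get the leading coefficients 1 and \<open>L\<close>. The
  determinant of this system is \<open>c\<close>, whence the division.\<close>

definition jet_v :: "'k::field_char_0 poly" where "jet_v = smult (1 / of_nat c) [:- 2, 1:]"
definition jet_u :: "'k::field_char_0 poly" where "jet_u = 1 + of_nat (2 * n + p) * jet_v"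

lemma jet_uv: "2 * jet_u - of_nat n * jet_v = ([:0, 1:] :: 'k::field_char_0 poly)"
proof -
  have "(of_nat c :: 'k poly) = of_nat (3 * n + 2 * p)" by (rule arg_cong[OF c_eq])
  then have "2 * jet_u - of_nat n * jet_v = 2 + of_nat c * (jet_v :: 'k poly)"
    by (simp add: jet_u_def algebra_simps)
  also have "of_nat c * jet_v = ([:- 2, 1:] :: 'k poly)"
    using pos(3) by (simp add: jet_v_def of_nat_poly)
  finally show ?thesis by (simp add: numeral_poly)
qed

text \<open>The first two values hold by the choice of the jet. The third is their difference, since
  the exponent difference of the binomial \<open>p3\<close> is that of \<open>p1\<close> minus that
  of \<open>p2\<close> in \<open>x\<close> and \<open>y\<close>. The fourth,
  \<open>L^2 - (L - 1)\<close>, comes from \<open>relations(1)\<close>, because the coordinates have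
  jets with constant term 1.\<close>

lemma lead_p:
  "lead 1 [:0, 1:] (jet jet_u jet_v (p1 :: 'k::field_char_0 cpoly))"
  "lead 1 1 (jet jet_u jet_v (p2 :: 'k cpoly))"
  "lead 1 [:- 1, 1:] (jet jet_u jet_v (p3 :: 'k cpoly))"
  "lead 2 [:1, - 1, 1:] (jet jet_u jet_v (p4 :: 'k cpoly))"
proof -
  let ?u = "jet_u :: 'k poly" and ?v = "jet_v :: 'k poly"
  show 1: "lead 1 [:0, 1:] (jet ?u ?v p1)"
    using lead_jet_binomial[of 2 ?u 0 ?v 0 n 0 m] jet_uv[where 'k = 'k] by (simp add: p1_def)
  show 2: "lead 1 1 (jet ?u ?v p2)"
    using lead_jet_binomial[of 1 ?u 0 ?v 0 "2 * n + p" "m + q" 0] by (simp add: p2_def jet_u_def)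
  have "?u + of_nat (n + p) * ?v = (2 * ?u - of_nat n * ?v) - 1"
    by (simp add: jet_u_def algebra_simps)
  also have "\<dots> = [:- 1, 1:]" by (simp add: jet_uv one_pCons)
  finally show 3: "lead 1 [:- 1, 1:] (jet ?u ?v p3)"
    using lead_jet_binomial[of 1 ?u "n + p" ?v 0 0 0 "2 * m + q"] by (simp add: p3_def)
  have "lead (0 + 2 * 1) (1 * [:0, 1:] ^ 2) (jet ?u ?v (mon 0 p q) * jet ?u ?v p1 ^ 2)"
    by (intro lead_mult lead_power 1 lead_0) (simp add: jet_mon)
  moreover have "lead (1 + 1) (1 * [:- 1, 1:]) (jet ?u ?v p2 * jet ?u ?v p3)"
    by (rule lead_mult[OF 2 3])
  ultimately have "lead 2 ([:0, 1:] ^ 2 - [:- 1, 1:]) (jet ?u ?v (mon 0 p q) * jet ?u ?v p1 ^ 2 - jet ?u ?v p2 * jet ?u ?v p3)"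
    by (intro lead_diff) (simp_all add: numeral_2_eq_2)
  also have "jet ?u ?v (mon 0 p q) * jet ?u ?v p1 ^ 2 - jet ?u ?v p2 * jet ?u ?v p3 = jet ?u ?v (mon 1 0 0) * jet ?u ?v p4"
    using arg_cong[OF relations(1), of "jet ?u ?v"] by (simp add: jet_simps)
  also have "[:0, 1:] ^ 2 - [:- 1, 1:] = ([:1, - 1, 1:] :: 'k poly)" by (simp add: power2_eq_square)
  finally show "lead 2 [:1, - 1, 1:] (jet ?u ?v p4)" by (rule lead_cancel) (simp add: jet_mon)
qed

lemma lead_word:
  "lead (e1 + e2 + e3 + 2 * e4) ([:0, 1:] ^ e1 * ([:- 1, 1:] ^ e3 * [:1, - 1, 1:] ^ e4))
     (jet jet_u jet_v (word i j l e1 e2 e3 e4 :: 'k::field_char_0 cpoly))"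
proof -
  have "lead (0 + e1 * 1 + e2 * 1 + e3 * 1 + e4 * 2) (1 * [:0, 1:] ^ e1 * 1 ^ e2 * [:- 1, 1:] ^ e3 * [:1, - 1, 1:] ^ e4)
     (jet jet_u jet_v (mon i j l) * jet jet_u jet_v (p1 :: 'k cpoly) ^ e1 * jet jet_u jet_v p2 ^ e2
       * jet jet_u jet_v p3 ^ e3 * jet jet_u jet_v p4 ^ e4)"
    by (intro lead_mult lead_power lead_p lead_0) (simp add: jet_mon)
  then show ?thesis by (simp add: word_def jet_simps mult.assoc mult.commute[of e4])
qed

text \<open>Standard words of the same weight and degree are told apart by the power of the leading
  form of p1 dividing their leading forms, which makes these forms linearly independent.\<close>

lemma standard_elimination:
  fixes f :: "'k::field_char_0 cpoly"
  assumes f: "f \<in> lin (Standard r k d \<union> Words (Suc k) d)" and dvd: "TT ^ Suc k dvd jet jet_u jet_v f"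
  shows "f \<in> lin (Standard (Suc r) k d \<union> Words (Suc k) d)"
proof -
  define B :: "'k cpoly set" where "B = Standard (Suc r) k d \<union> Words (Suc k) d"
  \<comment> \<open>The coefficient of \<open>TT ^ k\<close> is to be divisible by
    \<open>L ^ Suc r\<close>. This holds for standard words with larger exponent of
    \<open>p1\<close>, and for words of higher weight, where that coefficient is 0.\<close>
  define D where "D = {f :: 'k cpoly. \<exists>G. jet jet_u jet_v f = TT ^ k * G \<and> [:0, 1:] ^ Suc r dvd poly G 0}"
  have "B \<subseteq> D"
  proof
    fix f assume "f \<in> B"
    then consider i j l e1 e2 e3 e4 where "f = word i j l e1 e2 e3 e4" "k = e1 + e2 + e3 + 2 * e4" "Suc r \<le> e1"
      | i j l e1 e2 e3 e4 where "f = word i j l e1 e2 e3 e4" "Suc k \<le> e1 + e2 + e3 + 2 * e4"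
      unfolding B_def Standard_def Words_def by blast
    then show "f \<in> D"
    proof cases
      case 1
      then obtain G where "jet jet_u jet_v f = TT ^ k * G"
          "poly G 0 = [:0, 1:] ^ e1 * ([:- 1, 1:] ^ e3 * [:1, - 1, 1:] ^ e4)"
        using lead_word[of e1 e2 e3 e4 i j l, where 'k = 'k] by (auto simp: lead_def)
      moreover have "[:0, 1:] ^ Suc r dvd ([:0, 1:] ^ e1 :: 'k poly)"
        using 1(3) by (rule le_imp_power_dvd)
      ultimately show ?thesis unfolding D_def by (metis (mono_tags, lifting) CollectI dvd_mult2)
    next
      case 2
      then obtain G where "jet jet_u jet_v f = TT ^ (e1 + e2 + e3 + 2 * e4) * G"
        using lead_word[of e1 e2 e3 e4 i j l, where 'k = 'k] by (auto simp: lead_def)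
      moreover obtain t where "e1 + e2 + e3 + 2 * e4 = Suc k + t" using 2(2) le_Suc_ex by blast
      ultimately have "jet jet_u jet_v f = TT ^ (Suc k + t) * G" by simp
      then have "jet jet_u jet_v f = TT ^ k * (TT * TT ^ t * G)" by (simp add: power_add ac_simps)
      moreover have "poly (TT * TT ^ t * G) 0 = 0" by (simp add: TT_def)
      ultimately show ?thesis unfolding D_def by (metis (mono_tags, lifting) CollectI dvd_0_right)
    qed
  qed
  moreover have "module.subspace (\<lambda>r f. mconst r * f) D"
  proof (rule lin_subspaceI)
    show "0 \<in> D" by (auto simp: D_def jet_simps intro: exI[of _ 0])
  next
    fix f g assume "f \<in> D" "g \<in> D"
    then obtain F G where "jet jet_u jet_v f = TT ^ k * F" "[:0, 1:] ^ Suc r dvd poly F 0"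
       "jet jet_u jet_v g = TT ^ k * G" "[:0, 1:] ^ Suc r dvd poly G 0" unfolding D_def by blast
    then show "f + g \<in> D" unfolding D_def
      by (auto simp: jet_simps distrib_left simp del: power_Suc intro!: exI[of _ "F + G"] dvd_add)
  next
    fix s f assume "f \<in> D"
    then obtain F where "jet jet_u jet_v f = TT ^ k * F" "[:0, 1:] ^ Suc r dvd poly F 0" unfolding D_def by blast
    then show "mconst s * f \<in> D" unfolding D_def
      by (auto simp: jet_simps simp del: power_Suc mult_pCons_left intro!: exI[of _ "[:[:s:]:] * F"] dvd_mult)
  qed
  ultimately have sub: "lin B \<subseteq> D" by (rule lin_minimal)
  show ?thesis
  proof (cases "\<exists>i j l e2 e3 e4. k = r + e2 + e3 + 2 * e4 \<and> wdeg i j l r e2 e3 e4 = d \<and> standard i j e2 e3")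
    case False
    then have "Standard r k d \<subseteq> (Standard (Suc r) k d :: 'k cpoly set)"
      unfolding Standard_def by (smt (verit) Collect_mono_iff not_less_eq_eq le_antisym)
    then show ?thesis using f lin_mono[of "Standard r k d \<union> Words (Suc k) d" "Standard (Suc r) k d \<union> Words (Suc k) d"] by blast
  next
    case True
    then obtain i j l e2 e3 e4 where st: "k = r + e2 + e3 + 2 * e4" "wdeg i j l r e2 e3 e4 = d" "standard i j e2 e3"
      by blast
    define W :: "'k cpoly" where "W = word i j l r e2 e3 e4"
    have "Standard r k d \<union> Words (Suc k) d \<subseteq> insert W B"
    proof
      fix g :: "'k cpoly" assume "g \<in> Standard r k d \<union> Words (Suc k) d"
      then consider "g \<in> Words (Suc k) d" | i' j' l' e1' e2' e3' e4' where "g = word i' j' l' e1' e2' e3' e4'"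
          "k = e1' + e2' + e3' + 2 * e4'" "wdeg i' j' l' e1' e2' e3' e4' = d" "standard i' j' e2' e3'" "r \<le> e1'"
        unfolding Standard_def by blast
      then show "g \<in> insert W B"
      proof cases
        case 1
        then show ?thesis by (simp add: B_def)
      next
        case 2
        show ?thesis
        proof (cases "e1' = r")
          case True
          then have "g = W" using standard_unique[OF st(3) 2(4), of r e4 e4' l l'] 2 st by (simp add: W_def)
          then show ?thesis by simp
        next
          case False
          then have "g \<in> Standard (Suc r) k d" using 2 unfolding Standard_def by force
          then show ?thesis by (simp add: B_def)
        qed
      qed
    qed
    then have "f \<in> lin (insert W B)" using f lin_mono by blast
    then obtain s where s: "f - mconst s * W \<in> lin B" unfolding lin_insert by blast
    then obtain G where G: "jet jet_u jet_v (f - mconst s * W) = TT ^ k * G" "[:0, 1:] ^ Suc r dvd poly G 0"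
      using sub unfolding D_def by blast
    then obtain g where g: "poly G 0 = [:0, 1:] ^ Suc r * g" by (auto elim: dvdE)
    obtain H where H: "jet jet_u jet_v W = TT ^ k * H"
        "poly H 0 = [:0, 1:] ^ r * ([:- 1, 1:] ^ e3 * [:1, - 1, 1:] ^ e4)"
      using lead_word[of r e2 e3 e4 i j l, where 'k = 'k] unfolding W_def lead_def st(1) by blast
    obtain F where F: "jet jet_u jet_v f = TT ^ Suc k * F" using dvd by (auto elim: dvdE)
    have "TT ^ k * (TT * F - [:[:s:]:] * H) = TT ^ k * G"
      using G(1) F H(1) by (simp add: jet_simps algebra_simps del: mult_pCons_left)
    then have "TT * F - [:[:s:]:] * H = G" by (simp del: mult_pCons_left)
    then have "poly G 0 = - [:s:] * poly H 0" by (auto simp: TT_def)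
    then have "[:0, 1:] ^ r * ([:0, 1:] * g) = [:0, 1:] ^ r * (- [:s:] * ([:- 1, 1:] ^ e3 * [:1, - 1, 1:] ^ e4))"
      unfolding g H(2) by (simp only: power_Suc2 mult.assoc mult.left_commute)
    then have "[:0, 1:] * g = - [:s:] * ([:- 1, 1:] ^ e3 * [:1, - 1, 1:] ^ e4)"
      by (subst (asm) mult_left_cancel) simp_all
    \<comment> \<open>At \<open>L = 0\<close> the left side vanishes, while \<open>L - 1\<close> and
      \<open>L^2 - L + 1\<close> take the values -1 and 1.\<close>
    from arg_cong[OF this, of "\<lambda>P. poly P 0"] have "s = 0" by simp
    then show ?thesis using s by (simp add: B_def)
  qed
qed

text \<open>Induction on \<open>k\<close>. An element of the next symbolic power is already a
  combination of words of weight at least \<open>k\<close>; after reduction its standard part of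
  weight \<open>k\<close> is removed one exponent of \<open>p1\<close> at a time, because its jet is
  divisible by \<open>TT ^ Suc k\<close>.\<close>

lemma sym_subset_lin_Words:
  fixes f :: "'k::field_char_0 cpoly"
  assumes "f \<in> sym k" "hom (int d) f"
  shows "f \<in> lin (Words k d)"
  using assms
proof (induction k)
  case 0
  have "single x (lookup f x) \<in> lin (Words 0 d)" if x: "x \<in> keys f" for x
  proof (cases x rule: ex_cases)
    case (ex i j l)
    have "deg x = int d" using 0(2) x by (simp add: homogeneous_def)
    then have "a * i + b * j + c * l = d" unfolding ex deg_ex by (simp only: of_nat_eq_iff)
    then have "word i j l 0 0 0 0 \<in> Words 0 d" by (intro WordsI) (simp_all add: wdeg_def)
    then show ?thesis unfolding ex single_ex by (intro lin_scale lin_base) (simp add: word_def)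
  qed
  then have "(\<Sum>x\<in>keys f. single x (lookup f x)) \<in> lin (Words 0 d)" by (rule lin_sum)
  then show ?case by (simp add: poly_mapping_sum_single)
next
  case (Suc k)
  have dvd: "TT ^ Suc k dvd jet jet_u jet_v f" by (rule sym_jet[OF Suc.prems(1)])
  have "f \<in> lin (Words k d)" using Suc.IH Suc.prems sym_antimono[of f "Suc k" k] by simp
  moreover have "(Words k d :: 'k cpoly set) \<subseteq> lin (Standard 0 k d \<union> Words (Suc k) d)"
  proof
    fix g :: "'k cpoly" assume "g \<in> Words k d"
    then obtain i j l e1 e2 e3 e4 where g: "g = word i j l e1 e2 e3 e4" "k \<le> e1 + e2 + e3 + 2 * e4"
        "wdeg i j l e1 e2 e3 e4 = d" unfolding Words_def by blast
    show "g \<in> lin (Standard 0 k d \<union> Words (Suc k) d)"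
    proof (cases "k = e1 + e2 + e3 + 2 * e4")
      case True
      then show ?thesis using word_reduce[of i j l e1 e2 e3 e4, where 'a = 'k] g by simp
    next
      case False
      then show ?thesis using g by (intro lin_base UnI2) (simp add: WordsI)
    qed
  qed
  then have "lin (Words k d :: 'k cpoly set) \<subseteq> lin (Standard 0 k d \<union> Words (Suc k) d)"
    by (rule lin_minimal) (simp add: lin_def module.subspace_span[OF module_mconst])
  ultimately have "f \<in> lin (Standard 0 k d \<union> Words (Suc k) d)" by blast
  then have "f \<in> lin (Standard r k d \<union> Words (Suc k) d)" for r
    by (induction r) (auto intro: standard_elimination dvd)
  \<comment> \<open>The exponent of \<open>p1\<close> is at most the weight, so after
    \<open>Suc k\<close> eliminations only words of weight above \<open>k\<close> remain.\<close>
  moreover have "Standard (Suc k) k d = ({} :: 'k cpoly set)" unfolding Standard_def by auto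
  ultimately show ?case by (metis Un_empty_left)
qed

end

section \<open>The presentation of the Cox ring\<close>

interpretation lconst_hom: coeff_hom lconst
  by unfold_locales (simp_all add: lconst_def mconst_add mconst_mult single_add mult_single)

lemma single_power: "single k f ^ j = single (int j * k) (f ^ j)" for k :: int
  by (induction j) (simp_all add: mult_single algebra_simps)

lemma UNIV_gen: "UNIV = {GX, GY, GZ, GS1, GS2, GS3, GS4, GT}"
  using gen.exhaust by auto

lemma finite_UNIV_gen: "finite (UNIV :: gen set)"
  by (simp add: UNIV_gen)

context ordered_blowup
begin

fun gen_image :: "gen \<Rightarrow> 'k::comm_ring_1 laurent" where
  "gen_image GX = single 0 (mon 1 0 0)"
| "gen_image GY = single 0 (mon 0 1 0)"
| "gen_image GZ = single 0 (mon 0 0 1)"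
| "gen_image GS1 = single (- 1) p1"
| "gen_image GS2 = single (- 1) p2"
| "gen_image GS3 = single (- 1) p3"
| "gen_image GS4 = single (- 2) p4"
| "gen_image GT = single 1 1"

definition \<phi> :: "(gen, 'k::comm_ring_1) mpoly \<Rightarrow> 'k laurent" where
  "\<phi> = lconst_hom.ev gen_image"

definition monom_word :: "(gen \<Rightarrow>\<^sub>0 nat) \<Rightarrow> 'k::comm_ring_1 cpoly" where
  "monom_word x = word (lookup x GX) (lookup x GY) (lookup x GZ) (lookup x GS1) (lookup x GS2) (lookup x GS3) (lookup x GS4)"

definition monom_weight :: "(gen \<Rightarrow>\<^sub>0 nat) \<Rightarrow> nat" where
  "monom_weight x = lookup x GS1 + lookup x GS2 + lookup x GS3 + 2 * lookup x GS4"

lemma monom_eval_gen_image: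
  "monom_eval gen_image x = single (int (lookup x GT) - int (monom_weight x)) (monom_word x)"
proof -
  have "monom_eval gen_image x = (\<Prod>v\<in>UNIV. (gen_image v :: 'a laurent) ^ lookup x v)"
    by (rule monom_eval_superset[OF finite_UNIV_gen]) simp
  then show ?thesis
    by (simp add: UNIV_gen single_power mult_single monom_weight_def monom_word_def word_def mon_power mon_mult
      mon_mult_assoc mult.assoc, intro arg_cong2[of _ _ _ _ single]) simp_all
qed

lemma \<phi>_sum: "\<phi> f = (\<Sum>x\<in>keys f. single (int (lookup x GT) - int (monom_weight x)) (mconst (lookup f x) * monom_word x))"
  by (simp add: \<phi>_def lconst_hom.ev_def monom_eval_gen_image lconst_def mult_single)

lemmas \<phi>_simps = lconst_hom.ev_simps[where p = gen_image, folded \<phi>_def]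
  lconst_hom.ev_var[where p = gen_image, folded \<phi>_def] lconst_hom.ev_const[where p = gen_image, folded \<phi>_def]

lemma p_in_sym:
  "(p1 :: 'k::comm_ring_1 cpoly) \<in> sym 1" "(p2 :: 'k cpoly) \<in> sym 1" "(p3 :: 'k cpoly) \<in> sym 1"
  "(p4 :: 'k cpoly) \<in> sym 2"
proof -
  have I: "(p1 :: 'k cpoly) \<in> point_ideal w" "(p2 :: 'k cpoly) \<in> point_ideal w" "(p3 :: 'k cpoly) \<in> point_ideal w"
    unfolding p1_def p2_def p3_def
    by (intro binomial_in_point_ideal; use degrees in \<open>simp add: algebra_simps\<close>)+
  then show "(p1 :: 'k cpoly) \<in> sym 1" "(p2 :: 'k cpoly) \<in> sym 1" "(p3 :: 'k cpoly) \<in> sym 1"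
    by (blast intro: point_ideal_subset_sym)+
  note D = is_idealD[OF is_ideal_ideal_power]
  have P: "f * g \<in> ideal_power (point_ideal w) 2" if "f \<in> point_ideal w" "g \<in> point_ideal w" for f g :: "'k cpoly"
    using ideal_power_mult[OF ideal_power_1[OF that(1)] ideal_power_1[OF that(2)]] by (simp only: one_add_one)
  \<comment> \<open>By \<open>relations(5)\<close> the multiple \<open>y ^ n * p4\<close> is visibly
    in the square of the point ideal; the factor \<open>y ^ n\<close> is then removed.\<close>
  have "p2 ^ 2 + mon 0 0 q * p1 * (p3 :: 'k cpoly) \<in> ideal_power (point_ideal w) 2"
    unfolding power2_eq_square mult.assoc by (intro D(2,3) P I)
  then show "(p4 :: 'k cpoly) \<in> sym 2"
    unfolding relations(5)[symmetric] by (rule saturation_of_monomial)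
qed

lemma power_in_sym: "f \<in> sym k \<Longrightarrow> f ^ j \<in> sym (j * k)"
  by (induction j) (auto intro: sym_mult)

lemma word_in_sym: "word i j l e1 e2 e3 e4 \<in> sym (e1 + e2 + e3 + 2 * e4)"
proof -
  have "mon i j l * p1 ^ e1 * p2 ^ e2 * p3 ^ e3 * p4 ^ e4 \<in> sym (0 + e1 * 1 + e2 * 1 + e3 * 1 + e4 * 2)"
    by (intro sym_mult power_in_sym p_in_sym sym_0)
  then show ?thesis by (simp add: word_def mult.commute)
qed

lemma homogeneous_power: "homogeneous v d f \<Longrightarrow> homogeneous v (int j * d) (f ^ j)"
proof (induction j)
  case 0
  then show ?case using homogeneous_mconst[of v 1] by simp
next
  case (Suc j)
  then show ?case using homogeneous_mult[of v d f "int j * d" "f ^ j"] by (simp add: algebra_simps)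
qed

lemma p_hom: "hom (int (2 * a)) p1" "hom (int (b * (2 * n + p))) p2" "hom (int (c * (2 * m + q))) p3"
  "hom (int (b * c)) p4"
proof -
  have D: "2 * a = b * n + c * m" "a + (c * m + c * q) = b * (2 * n + p)" "a + (b * n + b * p) = c * (2 * m + q)"
    "b * n + b * p + b * (2 * n + p) = b * c" "c * m + c * q + c * (2 * m + q) = b * c"
    "a + b * p + c * q + 2 * a = b * c"
    using degrees by linarith+
  show h: "hom (int (2 * a)) p1" "hom (int (b * (2 * n + p))) p2" "hom (int (c * (2 * m + q))) p3"
    unfolding p1_def p2_def p3_def
    by (intro homogeneous_diff hom_mon arg_cong[of _ _ int]; use D in \<open>simp add: distrib_left\<close>)+
  have e: "int (b * c) = int (a + b * p + c * q) + int (2 * a)" "int (b * c) = int (b * n + b * p) + int (b * (2 * n + p))"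
    "int (b * c) = int (c * m + c * q) + int (c * (2 * m + q))" using D(4-6) by linarith+
  show "hom (int (b * c)) p4" unfolding p4_def
    by (intro homogeneous_diff; subst e(1) e(2) e(3); intro homogeneous_mult h hom_mon; simp add: distrib_left)
qed

lemma word_hom: "hom (int (wdeg i j l e1 e2 e3 e4)) (word i j l e1 e2 e3 e4)"
proof -
  have "hom (int (a * i + b * j + c * l) + int e1 * int (2 * a) + int e2 * int (b * (2 * n + p))
      + int e3 * int (c * (2 * m + q)) + int e4 * int (b * c))
     (mon i j l * p1 ^ e1 * p2 ^ e2 * p3 ^ e3 * p4 ^ e4)"
    by (intro homogeneous_mult homogeneous_power p_hom hom_mon refl)
  also have "int (a * i + b * j + c * l) + int e1 * int (2 * a) + int e2 * int (b * (2 * n + p))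
      + int e3 * int (c * (2 * m + q)) + int e4 * int (b * c) = int (wdeg i j l e1 e2 e3 e4)"
    by (simp add: wdeg_def algebra_simps)
  finally show ?thesis by (simp add: word_def)
qed

lemma gen_degree_eqs:
  "b * (c + n) div 2 = b * (2 * n + p)" "c * (b + m) div 2 = c * (2 * m + q)"
proof -
  have "c + n = 2 * (2 * n + p)" "b + m = 2 * (2 * m + q)" using c_eq b_eq by simp_all
  then have "b * (c + n) = 2 * (b * (2 * n + p))" "c * (b + m) = 2 * (c * (2 * m + q))"
    by (simp_all add: mult.left_commute)
  then show "b * (c + n) div 2 = b * (2 * n + p)" "c * (b + m) div 2 = c * (2 * m + q)"
    by (metis nonzero_mult_div_cancel_left zero_neq_numeral)+
qed

lemma monom_gen_degree:
  "monom_degree (\<lambda>v. fst (gen_degree a b c n m v)) x =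
     int (wdeg (lookup x GX) (lookup x GY) (lookup x GZ) (lookup x GS1) (lookup x GS2) (lookup x GS3) (lookup x GS4))"
  "monom_degree (\<lambda>v. snd (gen_degree a b c n m v)) x = int (lookup x GT) - int (monom_weight x)"
  by (simp_all add: monom_degree_superset[OF finite_UNIV_gen subset_UNIV] UNIV_gen gen_degree_eqs)
     (simp_all add: wdeg_def monom_weight_def algebra_simps)

lemma cox_component_sum: "(\<And>i. i \<in> A \<Longrightarrow> F i \<in> cox_component w \<delta>) \<Longrightarrow> sum F A \<in> cox_component w \<delta>"
  by (induction A rule: infinite_finite_induct) (auto intro: cox_component_add zero_cox_component)

lemma \<phi>_bihomogeneous:
  assumes "bihomogeneous (gen_degree a b c n m) \<delta> f"
  shows "\<phi> f \<in> cox_component w \<delta>"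
proof -
  obtain d \<mu> where \<delta>: "\<delta> = (d, \<mu>)" by force
  have "single (int (lookup x GT) - int (monom_weight x)) (mconst (lookup f x) * monom_word x) \<in> cox_component w \<delta>"
    if x: "x \<in> keys f" for x
  proof -
    have d: "d = int (wdeg (lookup x GX) (lookup x GY) (lookup x GZ) (lookup x GS1) (lookup x GS2) (lookup x GS3) (lookup x GS4))"
      and mu: "\<mu> = int (lookup x GT) - int (monom_weight x)"
      using assms x by (simp_all add: bihomogeneous_def homogeneous_def \<delta> monom_gen_degree)
    have "monom_word x \<in> sym (monom_weight x)"
      unfolding monom_word_def monom_weight_def by (rule word_in_sym)
    then have "monom_word x \<in> sym (nat (- \<mu>))" by (rule sym_antimono) (simp add: mu)
    then have "mconst (lookup f x) * monom_word x \<in> sym (nat (- \<mu>))" by (rule is_idealD(3)[OF is_ideal_sym])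
    moreover have "hom d (mconst (lookup f x) * monom_word x)"
      unfolding d monom_word_def by (intro hom_mconst_mult word_hom)
    ultimately show ?thesis unfolding \<delta> cox_component_iff mu by blast
  qed
  then show ?thesis unfolding \<phi>_sum
    by (rule cox_component_sum)
qed

lemma range_\<phi>_add: "F \<in> range \<phi> \<Longrightarrow> G \<in> range \<phi> \<Longrightarrow> F + G \<in> range \<phi>"
  by (auto simp flip: \<phi>_simps(1))

lemma range_\<phi>_sum: "(\<And>i. i \<in> A \<Longrightarrow> F i \<in> range \<phi>) \<Longrightarrow> sum F A \<in> range \<phi>"
proof (induction A rule: infinite_finite_induct)
  case (insert i A)
  then show ?case by (auto intro!: range_\<phi>_add)
qed (auto intro!: image_eqI[of _ _ 0] simp: \<phi>_def)

lemma range_\<phi>: "range \<phi> = (cox_ring w :: 'k::field_char_0 laurent set)"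
proof (intro subset_antisym subsetI)
  fix F :: "'k laurent" assume "F \<in> range \<phi>"
  then obtain f where "F = \<phi> f" by blast
  moreover have "\<phi> (single x r) \<in> cox_ring w" for x and r :: 'k
    by (rule cox_component_subset[OF \<phi>_bihomogeneous[where \<delta> = "(monom_degree (\<lambda>v. fst (gen_degree a b c n m v)) x, monom_degree (\<lambda>v. snd (gen_degree a b c n m v)) x)"]])
       (simp add: bihomogeneous_def homogeneous_single)
  then have "(\<Sum>x\<in>keys f. \<phi> (single x (lookup f x))) \<in> cox_ring w" by (intro cox_ring_sum)
  then have "\<phi> f \<in> cox_ring w"
    unfolding \<phi>_def lconst_hom.ev_sum[symmetric] by (simp add: poly_mapping_sum_single)
  ultimately show "F \<in> cox_ring w" by simp
next
  have word: "single \<mu> (word i j l e1 e2 e3 e4 :: 'k cpoly) \<in> range \<phi>" if "nat (- \<mu>) \<le> e1 + e2 + e3 + 2 * e4"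
    for \<mu> i j l e1 e2 e3 e4
  proof -
    \<comment> \<open>A word may have more weight than the multiplicity asks for; a power of the
      canonical section makes up the difference.\<close>
    define t where "t = nat (\<mu> + int (e1 + e2 + e3 + 2 * e4))"
    have t: "int t = \<mu> + int (e1 + e2 + e3 + 2 * e4)" using that unfolding t_def by linarith
    have "single \<mu> (word i j l e1 e2 e3 e4) =
       (\<phi> (mvar GX ^ i * mvar GY ^ j * mvar GZ ^ l * mvar GS1 ^ e1 * mvar GS2 ^ e2 * mvar GS3 ^ e3 * mvar GS4 ^ e4 * mvar GT ^ t) :: 'k laurent)"
      by (simp add: \<phi>_simps single_power mult_single word_def mon_power mon_mult t)
    then show ?thesis by (metis rangeI)
  qed
  fix F :: "'k laurent" assume "F \<in> cox_ring w"
  then obtain F' D where F: "F = sum F' D" "\<forall>\<delta>\<in>D. F' \<delta> \<in> cox_component w \<delta>"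
    unfolding cox_ring_def by blast
  have "F' \<delta> \<in> range \<phi>" if \<delta>: "\<delta> \<in> D" for \<delta>
  proof -
    obtain d \<mu> where "\<delta> = (d, \<mu>)" by force
    then obtain f where f: "F' \<delta> = single \<mu> f" "f \<in> sym (nat (- \<mu>))" "hom d f"
      using F(2) \<delta> cox_component_iff by blast
    show ?thesis
    proof (cases "d \<ge> 0")
      case False
      \<comment> \<open>\<open>Words\<close> is indexed by natural degrees; in negative degree there
        is no monomial.\<close>
      have "keys f = {}"
      proof (rule ccontr)
        assume "keys f \<noteq> {}"
        then obtain x where x: "x \<in> keys f" by blast
        have "deg x \<ge> 0" by (cases x rule: ex_cases) (simp only: deg_ex of_nat_0_le_iff)
        then show False using f(3) x False by (simp add: homogeneous_def)
      qed
      then show ?thesis using f(1) by (auto intro!: image_eqI[of _ _ 0] simp: \<phi>_def)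
    next
      case True
      then have "f \<in> lin (Words (nat (- \<mu>)) (nat d))" using sym_subset_lin_Words[OF f(2), of "nat d"] f(3) by simp
      moreover have "lin (Words (nat (- \<mu>)) (nat d)) \<subseteq> {f. single \<mu> f \<in> (range \<phi> :: 'k laurent set)}"
      proof (rule lin_minimal)
        show "Words (nat (- \<mu>)) (nat d) \<subseteq> {f. single \<mu> f \<in> (range \<phi> :: 'k laurent set)}"
          unfolding Words_def using word by blast
        show "module.subspace (\<lambda>r f. mconst r * f) {f. single \<mu> f \<in> (range \<phi> :: 'k laurent set)}"
        proof (rule lin_subspaceI; clarsimp)
          show "0 \<in> range \<phi>" by (auto intro!: image_eqI[of _ _ 0] simp: \<phi>_def)
          show "single \<mu> (f + g) \<in> range \<phi>" if "single \<mu> f = \<phi> F" "single \<mu> g = \<phi> G" for f g :: "'k cpoly" and F G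
            using range_\<phi>_add[of "\<phi> F" "\<phi> G"] by (simp add: single_add that)
          show "single \<mu> (mconst r * f) \<in> range \<phi>" if "single \<mu> f = \<phi> F" for f :: "'k cpoly" and r F
          proof -
            have "single \<mu> (mconst r * f) = \<phi> (mconst r * F)"
              by (simp add: \<phi>_simps that[symmetric] lconst_def mult_single)
            then show ?thesis by blast
          qed
        qed
      qed
      ultimately show ?thesis using f(1) by auto
    qed
  qed
  then show "F \<in> range \<phi>" unfolding F(1) by (rule range_\<phi>_sum)
qed

section \<open>The kernel of the presentation\<close>

definition I2 :: "(gen, 'k::comm_ring_1) mpoly set" where
  "I2 = ideal_I2 b c n m"

lemma is_ideal_I2: "is_ideal I2"
  by (simp add: I2_def ideal_I2_def Let_def is_ideal_ideal_gen)

lemma I2_generators: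
  fixes x y z s1 s2 s3 s4 t :: "(gen, 'k::comm_ring_1) mpoly"
  defines "x \<equiv> mvar GX" and "y \<equiv> mvar GY" and "z \<equiv> mvar GZ" and "s1 \<equiv> mvar GS1" and "s2 \<equiv> mvar GS2"
    and "s3 \<equiv> mvar GS3" and "s4 \<equiv> mvar GS4" and "t \<equiv> mvar GT"
  shows "I2 = ideal_gen {
       x ^ 2 - y ^ n * z ^ m - s1 * t,
       x * z ^ (m + q) - y ^ (2 * n + p) - s2 * t,
       x * y ^ (n + p) - z ^ (2 * m + q) - s3 * t,
       x * y ^ p * z ^ q * s1 - y ^ (n + p) * s2 - z ^ (m + q) * s3 - s4 * t,
       y ^ p * z ^ q * s1 ^ 2 - s2 * s3 - x * s4,
       y ^ (n + p) * s1 - z ^ m * s2 - x * s3,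
       z ^ (m + q) * s1 - x * s2 - y ^ n * s3,
       s3 ^ 2 + y ^ p * s1 * s2 - z ^ m * s4,
       s2 ^ 2 + z ^ q * s1 * s3 - y ^ n * s4}"
proof -
  have "(b - m) div 2 = m + q" "(c + n) div 2 = 2 * n + p" "(c - n) div 2 = n + p" "(b + m) div 2 = 2 * m + q"
    "(c - 3 * n) div 2 = p" "(b - 3 * m) div 2 = q"
    by (simp_all add: b_eq c_eq)
  note E = this
  show ?thesis unfolding I2_def ideal_I2_def Let_def assms E by (rule refl)
qed

lemma \<phi>_I2: "f \<in> I2 \<Longrightarrow> \<phi> f = (0 :: 'k::comm_ring_1 laurent)"
proof -
  have ker: "is_ideal {f. \<phi> f = (0 :: 'k laurent)}"
    by (auto simp: is_ideal_def \<phi>_simps) (simp add: \<phi>_def)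
  let ?x = "mon 1 0 0 :: 'k cpoly"
  have mons: "mon 1 p q = ?x * mon 0 p 0 * mon 0 0 q" "mon 0 p q = mon 0 p 0 * (mon 0 0 q :: 'k cpoly)"
    "mon 2 0 0 = ?x ^ 2" "mon 0 n m = mon 0 n 0 * (mon 0 0 m :: 'k cpoly)"
    "mon 1 0 (m + q) = ?x * mon 0 0 (m + q)" "mon 1 (n + p) 0 = ?x * mon 0 (n + p) 0"
    by (simp_all add: mon_mult mon_power)
  have p: "?x ^ 2 - mon 0 n 0 * mon 0 0 m - p1 = 0" "?x * mon 0 0 (m + q) - mon 0 (2 * n + p) 0 - p2 = 0"
    "?x * mon 0 (n + p) 0 - mon 0 0 (2 * m + q) - p3 = 0"
    "?x * mon 0 p 0 * mon 0 0 q * p1 - mon 0 (n + p) 0 * p2 - mon 0 0 (m + q) * p3 - p4 = 0"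
    by (simp_all only: p1_def p2_def p3_def p4_def mons diff_self)
  have r: "mon 0 p 0 * mon 0 0 q * p1 ^ 2 - p2 * p3 - ?x * p4 = 0"
    "mon 0 (n + p) 0 * p1 - mon 0 0 m * p2 - ?x * p3 = 0"
    "mon 0 0 (m + q) * p1 - ?x * p2 - mon 0 n 0 * p3 = 0"
    "p3 ^ 2 + mon 0 p 0 * p1 * p2 - mon 0 0 m * p4 = (0 :: 'k cpoly)"
    "p2 ^ 2 + mon 0 0 q * p1 * p3 - mon 0 n 0 * p4 = (0 :: 'k cpoly)"
    unfolding relations mons by simp_all
  have E: "\<phi> (mvar GX ^ 2 - mvar GY ^ n * mvar GZ ^ m - mvar GS1 * mvar GT) =
      single 0 (?x ^ 2 - mon 0 n 0 * mon 0 0 m - p1)"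
    "\<phi> (mvar GX * mvar GZ ^ (m + q) - mvar GY ^ (2 * n + p) - mvar GS2 * mvar GT) =
      single 0 (?x * mon 0 0 (m + q) - mon 0 (2 * n + p) 0 - p2)"
    "\<phi> (mvar GX * mvar GY ^ (n + p) - mvar GZ ^ (2 * m + q) - mvar GS3 * mvar GT) =
      single 0 (?x * mon 0 (n + p) 0 - mon 0 0 (2 * m + q) - p3)"
    "\<phi> (mvar GX * mvar GY ^ p * mvar GZ ^ q * mvar GS1 - mvar GY ^ (n + p) * mvar GS2
       - mvar GZ ^ (m + q) * mvar GS3 - mvar GS4 * mvar GT) =
      single (- 1) (?x * mon 0 p 0 * mon 0 0 q * p1 - mon 0 (n + p) 0 * p2 - mon 0 0 (m + q) * p3 - p4)"
    "\<phi> (mvar GY ^ p * mvar GZ ^ q * mvar GS1 ^ 2 - mvar GS2 * mvar GS3 - mvar GX * mvar GS4) =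
      single (- 2) (mon 0 p 0 * mon 0 0 q * p1 ^ 2 - p2 * p3 - ?x * p4)"
    "\<phi> (mvar GY ^ (n + p) * mvar GS1 - mvar GZ ^ m * mvar GS2 - mvar GX * mvar GS3) =
      single (- 1) (mon 0 (n + p) 0 * p1 - mon 0 0 m * p2 - ?x * p3)"
    "\<phi> (mvar GZ ^ (m + q) * mvar GS1 - mvar GX * mvar GS2 - mvar GY ^ n * mvar GS3) =
      single (- 1) (mon 0 0 (m + q) * p1 - ?x * p2 - mon 0 n 0 * p3)"
    "\<phi> (mvar GS3 ^ 2 + mvar GY ^ p * mvar GS1 * mvar GS2 - mvar GZ ^ m * mvar GS4) =
      single (- 2) (p3 ^ 2 + mon 0 p 0 * p1 * p2 - mon 0 0 m * (p4 :: 'k cpoly))"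
    "\<phi> (mvar GS2 ^ 2 + mvar GZ ^ q * mvar GS1 * mvar GS3 - mvar GY ^ n * mvar GS4) =
      single (- 2) (p2 ^ 2 + mon 0 0 q * p1 * p3 - mon 0 n 0 * (p4 :: 'k cpoly))"
    by (simp_all add: \<phi>_simps single_diff single_add single_power mult_single mon_power mon_mult)
  have "I2 \<subseteq> {f. \<phi> f = (0 :: 'k laurent)}"
    unfolding I2_generators
    by (rule ideal_gen_minimal[OF _ ker])
       (simp only: insert_subset empty_subsetI mem_Collect_eq E p r single_zero simp_thms)
  then show "f \<in> I2 \<Longrightarrow> \<phi> f = (0 :: 'k laurent)" by blast
qed

definition Base :: "(gen, 'k::comm_ring_1) mpoly set" where
  "Base = {g. \<forall>x\<in>keys g. \<forall>v\<in>{GS1, GS2, GS3, GS4}. lookup x v = 0}"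

lemma Base_add: "f \<in> Base \<Longrightarrow> g \<in> Base \<Longrightarrow> f + g \<in> Base"
  using keys_add[of f g] unfolding Base_def by (auto dest!: subsetD)

lemma Base_mult: "f \<in> Base \<Longrightarrow> g \<in> Base \<Longrightarrow> f * g \<in> Base"
  using keys_mult[of f g] unfolding Base_def by (fastforce simp: lookup_add)

lemma Base_uminus: "f \<in> Base \<Longrightarrow> - f \<in> Base"
  unfolding Base_def by (simp add: in_keys_iff)

lemma Base_diff: "f \<in> Base \<Longrightarrow> g \<in> Base \<Longrightarrow> f - g \<in> Base"
  using Base_add[of f "- g"] Base_uminus[of g] by simp

lemma Base_mconst: "mconst r \<in> Base"
  by (simp add: Base_def mconst_def)

lemma Base_mvar: "v \<notin> {GS1, GS2, GS3, GS4} \<Longrightarrow> mvar v \<in> Base"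
  by (auto simp: Base_def mvar_def lookup_single when_def)

lemma Base_power: "f \<in> Base \<Longrightarrow> f ^ k \<in> Base"
  by (induction k) (auto intro: Base_mult simp: Base_mconst[of 1, simplified])

text \<open>On polynomials in \<open>x\<close>, \<open>y\<close>, \<open>z\<close>, \<open>t\<close>
  the map is the inclusion into Laurent polynomials: the power of \<open>t\<close> and the monomial
  in \<open>S\<close> recover the exponent vector.\<close>

lemma Base_\<phi>_inject:
  assumes g: "g \<in> Base" and 0: "\<phi> g = (0 :: 'k::comm_ring_1 laurent)"
  shows "g = 0"
proof (rule ccontr)
  assume "g \<noteq> 0"
  then obtain x where x: "x \<in> keys g" by (metis all_not_in_conv keys_eq_empty)
  define t :: "(gen \<Rightarrow>\<^sub>0 nat) \<Rightarrow> int" where "t y = int (lookup y GT)" for y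
  define e where "e y = ex (lookup y GX) (lookup y GY) (lookup y GZ)" for y :: "gen \<Rightarrow>\<^sub>0 nat"
  have "single (int (lookup y GT) - int (monom_weight y)) (mconst (lookup g y) * monom_word y) =
      single (t y) (single (e y) (lookup g y))" if "y \<in> keys g" for y
    using g that by (auto simp: Base_def monom_weight_def monom_word_def word_def t_def e_def single_ex)
  then have "\<phi> g = (\<Sum>y\<in>keys g. single (t y) (single (e y) (lookup g y)))"
    unfolding \<phi>_sum by (rule sum.cong[OF refl])
  then have "lookup (lookup (\<phi> g) (t x)) (e x) =
      (\<Sum>y\<in>keys g. lookup (lookup (single (t y) (single (e y) (lookup g y))) (t x)) (e x))"
    by (simp add: lookup_sum)
  also have "\<dots> = (\<Sum>y\<in>keys g. if y = x then lookup g y else 0)"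
  proof (intro sum.cong refl)
    fix y assume y: "y \<in> keys g"
    have "y = x" if "t y = t x" "e y = e x"
    proof (rule poly_mapping_eqI)
      show "lookup y v = lookup x v" for v
        using that g x y by (cases v) (auto simp: t_def e_def Base_def)
    qed
    then show "lookup (lookup (single (t y) (single (e y) (lookup g y))) (t x)) (e x) = (if y = x then lookup g y else 0)"
      by (auto simp: lookup_single when_def)
  qed
  also have "\<dots> = lookup g x" using x by simp
  finally show False using 0 x by (simp add: in_keys_iff)
qed

text \<open>The polynomials with this property form a ring containing \<open>Base\<close>, so it
  suffices to treat \<open>s1\<close>, ..., \<open>s4\<close>. The first four generators of
  \<open>I2\<close> express \<open>s1 * t\<close>, ..., \<open>s4 * t\<close> by polynomials already
  treated.\<close>

lemma Base_reduction: "\<exists>N. \<exists>g\<in>Base. mvar GT ^ N * f - g \<in> (I2 :: (gen, 'k::comm_ring_1) mpoly set)"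
proof -
  define P where "P f \<longleftrightarrow> (\<exists>N. \<exists>g\<in>Base. mvar GT ^ N * f - g \<in> (I2 :: (gen, 'k) mpoly set))" for f
  note D = is_idealD[OF is_ideal_I2[where 'a = 'k]]
  let ?t = "mvar GT :: (gen, 'k) mpoly"
  have T: "?t ^ N \<in> Base" for N by (intro Base_power Base_mvar) simp
  have base: "P f" if "f \<in> Base" for f
    unfolding P_def using that D(1) by (intro exI[of _ 0] bexI[of _ f]) simp_all
  have add: "P (f + g)" and mult: "P (f * g)" if "P f" "P g" for f g
  proof -
    obtain M N f' g' where f: "f' \<in> Base" "?t ^ M * f - f' \<in> I2" and g: "g' \<in> Base" "?t ^ N * g - g' \<in> I2"
      using \<open>P f\<close> \<open>P g\<close> unfolding P_def by blast
    have "?t ^ N * (?t ^ M * f - f') + ?t ^ M * (?t ^ N * g - g') \<in> I2" using D(2,3) f g by blast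
    then have "?t ^ (M + N) * (f + g) - (?t ^ N * f' + ?t ^ M * g') \<in> I2" by (simp add: power_add algebra_simps)
    then show "P (f + g)" unfolding P_def using f(1) g(1) T Base_add Base_mult by blast
    have "(?t ^ M * f) * (?t ^ N * g - g') + g' * (?t ^ M * f - f') \<in> I2" using D(2,3) f g by blast
    then have "?t ^ (M + N) * (f * g) - f' * g' \<in> I2" by (simp add: power_add algebra_simps)
    then show "P (f * g)" unfolding P_def using f(1) g(1) Base_mult by blast
  qed
  have step: "P f" if "P h" "h - f * ?t \<in> I2" for f h
  proof -
    obtain N h' where h: "h' \<in> Base" "?t ^ N * h - h' \<in> I2" using \<open>P h\<close> unfolding P_def by blast
    have "(?t ^ N * h - h') - ?t ^ N * (h - f * ?t) \<in> I2" using D(3,6) h that by blast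
    then have "?t ^ (Suc N) * f - h' \<in> I2" by (simp add: algebra_simps)
    then show ?thesis unfolding P_def using h(1) by blast
  qed
  have xyz: "mvar GX ^ i \<in> Base" "mvar GY ^ i \<in> Base" "mvar GZ ^ i \<in> Base" "mvar GX \<in> Base" for i
    by (intro Base_power Base_mvar; simp)+
  have s1: "P (mvar GS1)"
    by (rule step[of "mvar GX ^ 2 - mvar GY ^ n * mvar GZ ^ m"])
       (auto intro!: base Base_diff Base_mult xyz ideal_gen_base simp: I2_generators)
  have s2: "P (mvar GS2)"
    by (rule step[of "mvar GX * mvar GZ ^ (m + q) - mvar GY ^ (2 * n + p)"])
       (auto intro!: base Base_diff Base_mult xyz ideal_gen_base simp: I2_generators)
  have s3: "P (mvar GS3)"
    by (rule step[of "mvar GX * mvar GY ^ (n + p) - mvar GZ ^ (2 * m + q)"])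
       (auto intro!: base Base_diff Base_mult xyz ideal_gen_base simp: I2_generators)
  have neg: "P (- f)" if "P f" for f
    using mult[OF base[OF Base_mconst[of "-1"]] that] by (simp add: mconst_uminus)
  have "P (mvar GX * mvar GY ^ p * mvar GZ ^ q * mvar GS1 + - (mvar GY ^ (n + p) * mvar GS2) + - (mvar GZ ^ (m + q) * mvar GS3))"
    by (intro add mult neg s1 s2 s3 base xyz)
  then have s4: "P (mvar GS4)"
    by (rule step) (auto intro!: ideal_gen_base simp: I2_generators)
  have "P (mvar v)" for v
    by (cases v) (auto intro: s1 s2 s3 s4 base Base_mvar)
  then show ?thesis
    by (induction f rule: mpoly_induct) (auto intro: add mult base Base_mconst simp flip: P_def)
qed

lemma kernel_\<phi>: "{f. \<phi> f = (0 :: 'k::comm_ring_1 laurent)} = saturation_elem I2 (mvar GT)"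
proof (intro subset_antisym subsetI)
  fix f :: "(gen, 'k) mpoly" assume "f \<in> {f. \<phi> f = 0}"
  then have f: "\<phi> f = 0" by simp
  obtain N g where g: "g \<in> Base" "mvar GT ^ N * f - g \<in> I2" using Base_reduction by blast
  have "\<phi> (mvar GT ^ N * f - g) = 0" by (rule \<phi>_I2[OF g(2)])
  then have "\<phi> g = 0" using f by (simp add: \<phi>_simps)
  then have "g = 0" by (rule Base_\<phi>_inject[OF g(1)])
  then show "f \<in> saturation_elem I2 (mvar GT)"
    using g(2) by (auto simp: saturation_elem_def mult.commute)
next
  fix f :: "(gen, 'k) mpoly" assume "f \<in> saturation_elem I2 (mvar GT)"
  then obtain k where "f * mvar GT ^ k \<in> I2" by (auto simp: saturation_elem_def)
  from \<phi>_I2[OF this] have "\<phi> f * single (int k) 1 = 0"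
    by (simp add: \<phi>_simps single_power)
  \<comment> \<open>The variable \<open>t\<close> is mapped to a unit of the Laurent ring.\<close>
  then have "\<phi> f * single (int k) 1 * single (- int k) 1 = 0" by simp
  then show "f \<in> {f. \<phi> f = 0}" by (simp add: mult.assoc mult_single)
qed

lemma graded_presentation_\<phi>:
  "graded_presentation w (gen_degree a b c n m) (saturation_elem (ideal_I2 b c n m) (mvar GT))
     (\<phi> :: (gen, 'k::field_char_0) mpoly \<Rightarrow> 'k laurent)"
  unfolding graded_presentation_def I2_def[symmetric]
  using \<phi>_bihomogeneous range_\<phi> kernel_\<phi> by (auto simp: \<phi>_simps)

lemma hull_gen_image: "subalgebra hull (range gen_image) = (cox_ring w :: 'k::field_char_0 laurent set)"
proof (rule subset_antisym)
  have "gen_image v \<in> (cox_ring w :: 'k laurent set)" for v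
    using range_\<phi>[where 'k = 'k] by (metis \<phi>_simps(6) rangeI)
  then show "subalgebra hull (range gen_image) \<subseteq> (cox_ring w :: 'k laurent set)"
    by (intro hull_minimal subalgebra_cox_ring) blast
  have "\<phi> f \<in> A" if A: "subalgebra A" "range gen_image \<subseteq> A" for A :: "'k laurent set" and f
    by (induction f rule: mpoly_induct) (use A in \<open>auto simp: subalgebra_def \<phi>_simps\<close>)
  then show "(cox_ring w :: 'k laurent set) \<subseteq> subalgebra hull (range gen_image)"
    unfolding range_\<phi>[symmetric] hull_def by blast
qed

lemma gen_image_multiplicity: "\<exists>\<mu>\<le>2. rees_multiplicity w \<mu> (gen_image v :: 'k::field_char_0 laurent)"
proof -
  define \<delta> where "\<delta> = gen_degree a b c n m v"
  have "bihomogeneous (gen_degree a b c n m) \<delta> (mvar v :: (gen, 'k) mpoly)"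
    by (simp add: bihomogeneous_def homogeneous_single mvar_def \<delta>_def)
  then have "gen_image v \<in> (cox_component w \<delta> :: 'k laurent set)"
    using \<phi>_bihomogeneous by (metis \<phi>_simps(6))
  moreover have "- snd \<delta> \<le> 2" unfolding \<delta>_def by (cases v) auto
  ultimately show ?thesis unfolding rees_multiplicity_def
    by (intro exI[of _ "- snd \<delta>"] conjI exI[of _ "fst \<delta>"]) simp_all
qed

lemma presented_conclusions:
  "cox_ring_generated_up_to (K :: 'k::field_char_0 itself) w 2" "mori_dream_surface K w"
  "\<exists>\<phi> :: (gen, 'k) mpoly \<Rightarrow> 'k laurent.
     graded_presentation w (gen_degree a b c n m) (saturation_elem (ideal_I2 b c n m) (mvar GT)) \<phi> \<and>
     \<phi> (mvar GX) = single 0 (mvar vx) \<and> \<phi> (mvar GY) = single 0 (mvar vy) \<and>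
     \<phi> (mvar GZ) = single 0 (mvar vz) \<and> \<phi> (mvar GT) = single 1 1" (is ?pres)
proof -
  show "cox_ring_generated_up_to K w 2"
    unfolding cox_ring_generated_up_to_def
    by (intro exI[of _ "range gen_image"] conjI hull_gen_image ballI) (clarify, rule gen_image_multiplicity)
  have "finite (range gen_image :: 'k laurent set)" by (simp add: finite_UNIV_gen)
  then show "mori_dream_surface K w"
    unfolding mori_dream_surface_def using hull_gen_image by blast
  show ?pres
    using graded_presentation_\<phi> by (intro exI[of _ \<phi>]) (simp add: \<phi>_simps mvar_conv_mon)
qed

end

section \<open>Herzog's numbers of a numerical semigroup with three generators\<close>

text \<open>Minimality only: that \<open>a * A\<close> itself lies in the monoid is part of the
  equations in \<open>herzog\<close>.\<close>

definition minimal_multiple :: "nat \<Rightarrow> nat \<Rightarrow> nat \<Rightarrow> nat \<Rightarrow> bool" where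
  "minimal_multiple a b c A \<longleftrightarrow> (\<forall>i. 0 < i \<longrightarrow> i < A \<longrightarrow> a * i \<notin> monoid2 b c)"

text \<open>The monomial curve ideal is generated by the minors of the matrix with rows
  \<open>(x\<^bsup>a1\<^esup>, y\<^bsup>b1\<^esup>, z\<^bsup>c1\<^esup>)\<close> and \<open>(y\<^bsup>b2\<^esup>, z\<^bsup>c2\<^esup>, x\<^bsup>a2\<^esup>)\<close>.\<close>

definition herzog :: "nat \<Rightarrow> nat \<Rightarrow> nat \<Rightarrow> nat \<Rightarrow> nat \<Rightarrow> nat \<Rightarrow> nat \<Rightarrow> nat \<Rightarrow> nat \<Rightarrow> bool" where
  "herzog a b c a1 a2 b1 b2 c1 c2 \<longleftrightarrow> a > 0 \<and> b > 0 \<and> c > 0 \<and>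
     a1 > 0 \<and> a2 > 0 \<and> b1 > 0 \<and> b2 > 0 \<and> c1 > 0 \<and> c2 > 0 \<and>
     a * (a1 + a2) = b * b2 + c * c1 \<and> b * (b1 + b2) = a * a1 + c * c2 \<and> c * (c1 + c2) = a * a2 + b * b1 \<and>
     minimal_multiple a b c (a1 + a2) \<and> minimal_multiple b a c (b1 + b2) \<and> minimal_multiple c a b (c1 + c2)"

lemma monoid2I: "x = b * j + c * l \<Longrightarrow> x \<in> monoid2 b c"
proof -
  assume "x = b * j + c * l"
  then have "x = j * b + l * c" by (simp add: mult.commute)
  then show ?thesis unfolding monoid2_def by blast
qed

lemma monoid2E: "x \<in> monoid2 b c \<Longrightarrow> (\<And>j l. x = b * j + c * l \<Longrightarrow> P) \<Longrightarrow> P"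
  by (auto simp: monoid2_def mult.commute)

lemma monoid2_commute: "monoid2 b c = monoid2 c b"
  unfolding monoid2_def by (metis add.commute)

lemma minimal_multipleD: "minimal_multiple a b c A \<Longrightarrow> a * i = b * j + c * l \<Longrightarrow> 0 < i \<Longrightarrow> i < A \<Longrightarrow> False"
  by (auto simp: minimal_multiple_def intro: monoid2I)

lemma minimal_multiple_commute: "minimal_multiple a b c A = minimal_multiple a c b A"
  by (simp add: minimal_multiple_def monoid2_commute)

lemma herzog_rotate: "herzog a b c a1 a2 b1 b2 c1 c2 \<Longrightarrow> herzog b c a b1 b2 c1 c2 a1 a2"
  by (auto simp: herzog_def minimal_multiple_commute add.commute)

text \<open>Transposing \<open>b\<close> and \<open>c\<close> exchanges the rows of the matrix and
  with them the indices 1 and 2; so the signs of \<open>a1 - a2\<close>, \<open>b1 - b2\<close>,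
  \<open>c1 - c2\<close> are reversed. Together with rotation this reaches all six
  orderings.\<close>

lemma herzog_reflect: "herzog a b c a1 a2 b1 b2 c1 c2 \<Longrightarrow> herzog a c b a2 a1 c2 c1 b2 b1"
  by (auto simp: herzog_def minimal_multiple_commute add.commute)

text \<open>Let \<open>r\<close> be \<open>c\<close> divided by \<open>a\<close> modulo
  \<open>b\<close>. Then \<open>a * r\<close> and \<open>c\<close> differ by a multiple of
  \<open>b\<close>, and \<open>a * r < c\<close> is impossible, since it would put \<open>c\<close>
  into \<open>monoid2 a b\<close>.\<close>

lemma small_multiple:
  assumes ab: "coprime a b" and pos: "a > 0" "b > 0" "c > 0" and c: "c \<notin> monoid2 a b"
  shows "\<exists>r. 0 < r \<and> r < b \<and> a * r \<in> monoid2 b c"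
proof -
  obtain x y where xy: "a * x = b * y + 1" using bezout_nat[of a b] ab pos(1) by auto
  define r q where "r = (x * c) mod b" and "q = (x * c) div b"
  have xc: "x * c = b * q + r" by (simp add: r_def q_def)
  have "a * (x * c) = (b * y + 1) * c" by (simp add: xy flip: mult.assoc)
  then have e: "a * r + b * (a * q) = c + b * (y * c)" unfolding xc by (simp add: algebra_simps)
  have "a * q \<le> y * c"
  proof (rule ccontr)
    assume "\<not> a * q \<le> y * c"
    then obtain t where "a * q = y * c + t" by (metis le_add_diff_inverse nat_le_linear)
    then have "c = a * r + b * t" using e by (simp add: algebra_simps)
    then show False using c monoid2I by blast
  qed
  then obtain t where "y * c = a * q + t" using le_Suc_ex by blast
  then have ar: "a * r = b * t + c * 1" using e by (simp add: algebra_simps)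
  then have "r > 0" using pos by (cases r) auto
  moreover have "r < b" using pos by (simp add: r_def)
  ultimately show ?thesis using ar monoid2I by blast
qed

text \<open>The least multiplier \<open>A\<close> is smaller than \<open>b\<close> and
  \<open>c\<close> by \<open>small_multiple\<close>. If one of the exponents on the right were zero,
  coprimality would make \<open>A\<close> divisible by \<open>b\<close> or by
  \<open>c\<close>.\<close>

lemma minimal_multiple_exists:
  assumes "coprime a b" "coprime a c" "a > 0" "b > 0" "c > 0" "c \<notin> monoid2 a b" "b \<notin> monoid2 a c"
  shows "\<exists>A \<beta> \<gamma>. A > 0 \<and> \<beta> > 0 \<and> \<gamma> > 0 \<and> a * A = b * \<beta> + c * \<gamma> \<and> minimal_multiple a b c A"
proof -
  define A where "A = (LEAST r. 0 < r \<and> a * r \<in> monoid2 b c)"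
  obtain r s where r: "0 < r" "r < b" "a * r \<in> monoid2 b c" and s: "0 < s" "s < c" "a * s \<in> monoid2 b c"
    using small_multiple[of a b c] small_multiple[of a c b] assms by (metis monoid2_commute)
  have A: "0 < A \<and> a * A \<in> monoid2 b c" unfolding A_def by (rule LeastI[of _ r]) (use r in simp)
  have "A \<le> r" "A \<le> s" unfolding A_def by (rule Least_le; use r s in simp)+
  then have lt: "A < b" "A < c" using r s by auto
  obtain \<beta> \<gamma> where e: "a * A = b * \<beta> + c * \<gamma>" using A by (auto elim: monoid2E)
  have "\<gamma> > 0"
  proof (rule ccontr)
    assume "\<not> \<gamma> > 0"
    then have "b dvd a * A" using e by simp
    then have "b dvd A" using assms(1) by (simp add: coprime_dvd_mult_right_iff coprime_commute)
    then show False using lt A by (auto dest: dvd_imp_le)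
  qed
  moreover have "\<beta> > 0"
  proof (rule ccontr)
    assume "\<not> \<beta> > 0"
    then have "c dvd a * A" using e by simp
    then have "c dvd A" using assms(2) by (simp add: coprime_dvd_mult_right_iff coprime_commute)
    then show False using lt A by (auto dest: dvd_imp_le)
  qed
  moreover have "minimal_multiple a b c A"
    unfolding minimal_multiple_def A_def using not_less_Least by blast
  ultimately show ?thesis using A e by blast
qed

text \<open>If \<open>\<beta>\<close> were at least \<open>B\<close>, substituting the second
  relation into the first and cancelling \<open>a * \<alpha>\<close> would give a smaller multiple
  of \<open>a\<close> in the monoid.\<close>

lemma minimal_exponent_less:
  assumes "a * A = b * \<beta> + c * \<gamma>" "b * B = a * \<alpha> + c * \<delta>" "\<alpha> > 0" "\<gamma> > 0" "c > 0" "minimal_multiple a b c A"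
  shows "\<beta> < B"
proof (rule ccontr)
  assume "\<not> \<beta> < B"
  then obtain t where t: "\<beta> = B + t" by (metis le_add_diff_inverse not_less)
  have e: "a * A = a * \<alpha> + (b * t + c * (\<gamma> + \<delta>))" using assms(1,2) by (simp add: t algebra_simps)
  then have "a * \<alpha> < a * A" using assms(4,5) by simp
  then have "\<alpha> < A" by simp
  then obtain s where s: "A = \<alpha> + s" "s > 0" using less_imp_add_positive by blast
  then have e': "a * s = b * t + c * (\<gamma> + \<delta>)" using e by (simp add: algebra_simps)
  show False using minimal_multipleD[OF assms(6) e'] s assms(3) by simp
qed

lemma minimal_zero:
  assumes "minimal_multiple a b c A" "int a * X = int b * Y + int c * Z" "Y \<ge> 0" "Z \<ge> 0" "X < int A" "a > 0"
  shows "X = 0"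
proof (rule ccontr)
  assume "X \<noteq> 0"
  have "int a * X \<ge> 0" using assms(2-4) by simp
  then have X: "X > 0" using \<open>X \<noteq> 0\<close> assms(6) by (simp add: zero_le_mult_iff)
  have "int (a * nat X) = int (b * nat Y + c * nat Z)" using assms(2-4) X by simp
  then have e: "a * nat X = b * nat Y + c * nat Z" by (simp only: of_nat_eq_iff)
  show False using minimal_multipleD[OF assms(1) e] X assms(5) by linarith
qed

text \<open>The sum of the three minimal relations reads \<open>a * X + b * Y + c * Z = 0\<close>,
  where \<open>X\<close>, \<open>Y\<close>, \<open>Z\<close> are smaller in absolute value than
  \<open>A\<close>, \<open>B\<close>, \<open>C\<close>. If two of them have weakly the same sign,
  minimality makes the third one zero; among three numbers this always happens, and in the end all
  vanish. That is the splitting of \<open>A\<close>, \<open>B\<close>, \<open>C\<close> into two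
  exponents each.\<close>

lemma herzog_exists:
  assumes pos: "a > 0" "b > 0" "c > 0"
    and cop: "coprime a b" "coprime a c" "coprime b c"
    and notin: "a \<notin> monoid2 b c" "b \<notin> monoid2 a c" "c \<notin> monoid2 a b"
  shows "\<exists>a1 a2 b1 b2 c1 c2. herzog a b c a1 a2 b1 b2 c1 c2"
proof -
  obtain A \<beta>1 \<gamma>1 where A: "A > 0" "\<beta>1 > 0" "\<gamma>1 > 0" "a * A = b * \<beta>1 + c * \<gamma>1" "minimal_multiple a b c A"
    using minimal_multiple_exists[of a b c] assms by blast
  obtain B \<alpha>2 \<gamma>2 where B: "B > 0" "\<alpha>2 > 0" "\<gamma>2 > 0" "b * B = a * \<alpha>2 + c * \<gamma>2" "minimal_multiple b a c B"
    using minimal_multiple_exists[of b a c] assms by (metis coprime_commute monoid2_commute)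
  obtain C \<alpha>3 \<beta>3 where C: "C > 0" "\<alpha>3 > 0" "\<beta>3 > 0" "c * C = a * \<alpha>3 + b * \<beta>3" "minimal_multiple c a b C"
    using minimal_multiple_exists[of c a b] assms by (metis coprime_commute monoid2_commute)
  have A': "a * A = c * \<gamma>1 + b * \<beta>1" "minimal_multiple a c b A" using A by (simp_all add: minimal_multiple_commute)
  have B': "b * B = c * \<gamma>2 + a * \<alpha>2" "minimal_multiple b c a B" using B by (simp_all add: minimal_multiple_commute)
  have C': "c * C = b * \<beta>3 + a * \<alpha>3" "minimal_multiple c b a C" using C by (simp_all add: minimal_multiple_commute)
  have lt: "\<beta>1 < B" "\<gamma>1 < C" "\<alpha>2 < A" "\<gamma>2 < C" "\<alpha>3 < A" "\<beta>3 < B"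
    using minimal_exponent_less[OF A(4) B(4)] minimal_exponent_less[OF A'(1) C(4)]
      minimal_exponent_less[OF B(4) A(4)] minimal_exponent_less[OF B'(1) C'(1)]
      minimal_exponent_less[OF C(4) A'(1)] minimal_exponent_less[OF C'(1) B'(1)] A B C A' B' C' pos by blast+
  define X Y Z where "X = int A - int \<alpha>2 - int \<alpha>3" and "Y = int B - int \<beta>1 - int \<beta>3" and "Z = int C - int \<gamma>1 - int \<gamma>2"
  have "int a * int A = int b * int \<beta>1 + int c * int \<gamma>1" "int b * int B = int a * int \<alpha>2 + int c * int \<gamma>2"
    "int c * int C = int a * int \<alpha>3 + int b * int \<beta>3"
    using A(4) B(4) C(4) by (metis of_nat_add of_nat_mult)+
  then have S: "int a * X + int b * Y + int c * Z = 0" by (simp add: X_def Y_def Z_def algebra_simps)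
  have bnd: "X < int A" "- X < int A" "Y < int B" "- Y < int B" "Z < int C" "- Z < int C"
    using lt A B C by (simp_all add: X_def Y_def Z_def)
  have x: "X = 0" if "Y \<ge> 0 \<and> Z \<ge> 0 \<or> Y \<le> 0 \<and> Z \<le> 0"
    using that minimal_zero[OF A(5), of X "- Y" "- Z"] minimal_zero[OF A(5), of "- X" Y Z] S bnd pos
    by (auto simp: algebra_simps)
  have y: "Y = 0" if "X \<ge> 0 \<and> Z \<ge> 0 \<or> X \<le> 0 \<and> Z \<le> 0"
    using that minimal_zero[OF B(5), of Y "- X" "- Z"] minimal_zero[OF B(5), of "- Y" X Z] S bnd pos
    by (auto simp: algebra_simps)
  have z: "Z = 0" if "X \<ge> 0 \<and> Y \<ge> 0 \<or> X \<le> 0 \<and> Y \<le> 0"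
    using that minimal_zero[OF C(5), of Z "- X" "- Y"] minimal_zero[OF C(5), of "- Z" X Y] S bnd pos
    by (auto simp: algebra_simps)
  have "X = 0 \<and> Y = 0 \<and> Z = 0" using x y z by linarith
  then have "A = \<alpha>2 + \<alpha>3" "B = \<beta>3 + \<beta>1" "C = \<gamma>1 + \<gamma>2" by (simp_all add: X_def Y_def Z_def)
  then have "herzog a b c \<alpha>2 \<alpha>3 \<beta>3 \<beta>1 \<gamma>1 \<gamma>2" using A B C pos by (simp add: herzog_def)
  then show ?thesis by blast
qed

definition stair :: "nat \<Rightarrow> nat \<Rightarrow> nat \<Rightarrow> nat \<Rightarrow> nat \<Rightarrow> nat \<Rightarrow> bool" where
  "stair a1 a2 b1 b2 i j \<longleftrightarrow> i < a1 + a2 \<and> j < b1 + b2 \<and> \<not> (a2 \<le> i \<and> b1 \<le> j)"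

text \<open>After cancelling powers of \<open>z\<close>, two distinct monomials of equal degree
  contradict a minimal relation, according to the signs of the differences. If both exponents drop,
  the power of \<open>z\<close> is at least \<open>c1 + c2\<close> and can be traded for
  \<open>x ^ a2 * y ^ b1\<close>; since one of the two differences is below \<open>a2\<close> or
  \<open>b1\<close>, a too small multiple of \<open>b\<close> or \<open>a\<close> appears.\<close>

lemma stair_unique:
  assumes h: "herzog a b c a1 a2 b1 b2 c1 c2" and st: "stair a1 a2 b1 b2 i j" "stair a1 a2 b1 b2 i' j'"
    and e: "a * i + b * j + c * l = a * i' + b * j' + c * l'"
  shows "i = i' \<and> j = j' \<and> l = l'"
proof -
  have main: "i = i' \<and> j = j' \<and> t = 0"
    if st: "stair a1 a2 b1 b2 i j" "stair a1 a2 b1 b2 i' j'" and e: "a * i + b * j = a * i' + b * j' + c * t"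
    for i j i' j' t
  proof -
    have pos: "a > 0" "b > 0" "c > 0" and cC: "c * (c1 + c2) = a * a2 + b * b1"
      and mA: "minimal_multiple a b c (a1 + a2)" and mB: "minimal_multiple b a c (b1 + b2)"
      and mC: "minimal_multiple c a b (c1 + c2)"
      using h by (simp_all add: herzog_def)
    consider "i \<le> i'" "j \<le> j'" | "i > i'" "j \<le> j'" | "i \<le> i'" "j > j'" | "i > i'" "j > j'" by linarith
    then show ?thesis
    proof cases
      case 1
      then obtain s u where s: "i' = i + s" "j' = j + u" by (metis le_add_diff_inverse)
      then have "a * s + b * u + c * t = 0" using e by (simp add: algebra_simps)
      then show ?thesis using s pos by simp
    next
      case 2
      then obtain s u where s: "i = i' + s" "s > 0" "j' = j + u" by (metis le_add_diff_inverse less_imp_add_positive)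
      then have e1: "a * s = b * u + c * t" using e by (simp add: algebra_simps)
      have "s < a1 + a2" using st s by (simp add: stair_def)
      then show ?thesis using minimal_multipleD[OF mA e1] s by blast
    next
      case 3
      then obtain s u where s: "j = j' + s" "s > 0" "i' = i + u" by (metis le_add_diff_inverse less_imp_add_positive)
      then have e1: "b * s = a * u + c * t" using e by (simp add: algebra_simps)
      have "s < b1 + b2" using st s by (simp add: stair_def)
      then show ?thesis using minimal_multipleD[OF mB e1] s by blast
    next
      case 4
      then obtain s u where s: "i = i' + s" "s > 0" "j = j' + u" "u > 0" by (metis less_imp_add_positive)
      then have ct: "c * t = a * s + b * u" using e by (simp add: algebra_simps)
      then have "t > 0" using s pos by (cases t) auto
      then have "t \<ge> c1 + c2" using minimal_multipleD[OF mC ct] by (meson not_less)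
      then obtain r where r: "t = (c1 + c2) + r" using le_Suc_ex by blast
      have e2: "a * s + b * u = a * a2 + b * b1 + c * r" using ct cC by (simp add: r distrib_left)
      have "s < a1 + a2" "u < b1 + b2" "s < a2 \<or> u < b1" using st s by (auto simp: stair_def)
      then consider "s < a2" | "u < b1" "\<not> s < a2" by blast
      then have False
      proof cases
        case 1
        then obtain q where q: "a2 = s + q" "q > 0" using less_imp_add_positive by blast
        then have e3: "b * u = a * q + b * b1 + c * r" using e2 by (simp add: algebra_simps)
        then have "b * b1 < b * u" using q pos by simp
        then obtain v where v: "u = b1 + v" "v > 0" using less_imp_add_positive by auto
        then have e4: "b * v = a * q + c * r" using e3 by (simp add: algebra_simps)
        show False using minimal_multipleD[OF mB e4] v \<open>u < b1 + b2\<close> by simp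
      next
        case 2
        then obtain q where q: "b1 = u + q" "q > 0" using less_imp_add_positive by blast
        then have e3: "a * s = a * a2 + b * q + c * r" using e2 by (simp add: algebra_simps)
        then have "a * a2 < a * s" using q pos by simp
        then obtain v where v: "s = a2 + v" "v > 0" using less_imp_add_positive by auto
        then have e4: "a * v = b * q + c * r" using e3 by (simp add: algebra_simps)
        show False using minimal_multipleD[OF mA e4] v \<open>s < a1 + a2\<close> by simp
      qed
      then show ?thesis ..
    qed
  qed
  show ?thesis
  proof (cases "l \<le> l'")
    case True
    then obtain t where t: "l' = l + t" using le_Suc_ex by blast
    then have "a * i + b * j = a * i' + b * j' + c * t" using e by (simp add: algebra_simps)
    from main[OF st this] show ?thesis using t by simp
  next
    case False
    then obtain t where t: "l = l' + t" by (metis le_add_diff_inverse nat_le_linear)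
    then have "a * i' + b * j' = a * i + b * j + c * t" using e by (simp add: algebra_simps)
    from main[OF st(2,1) this] show ?thesis using t by auto
  qed
qed

text \<open>The right side counts the pairs of the staircase \<open>stair\<close>, an L-shape with
  \<open>(a1 + a2) * (b1 + b2) - a1 * b2\<close> cells. By \<open>stair_unique\<close> their degrees
  are distinct modulo \<open>c\<close>, so the count is at most \<open>c\<close>; eliminating
  between the relations shows that \<open>c\<close> divides it.\<close>

lemma herzog_third:
  assumes h: "herzog a b c a1 a2 b1 b2 c1 c2" and cop: "coprime a c"
  shows "c = a1 * b1 + a2 * b1 + a2 * b2"
proof -
  define c' where "c' = a1 * b1 + a2 * b1 + a2 * b2"
  have pos: "c > 0" "a2 > 0" "b1 > 0" and eqs: "a * (a1 + a2) = b * b2 + c * c1" "b * (b1 + b2) = a * a1 + c * c2"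
    using h by (simp_all add: herzog_def)
  have "a * c' + a * a1 * b2 = a * (a1 + a2) * (b1 + b2)" by (simp add: c'_def algebra_simps)
  also have "\<dots> = b2 * (b * (b1 + b2)) + c * c1 * (b1 + b2)" unfolding eqs(1) by (simp add: algebra_simps)
  also have "\<dots> = a * a1 * b2 + c * (c2 * b2 + c1 * (b1 + b2))" unfolding eqs(2) by (simp add: algebra_simps)
  finally have "a * c' = c * (c2 * b2 + c1 * (b1 + b2))" by simp
  then have "c dvd a * c'" by simp
  then have "c dvd c'" using cop by (simp add: coprime_dvd_mult_right_iff coprime_commute)
  then have le: "c \<le> c'" using pos by (intro dvd_imp_le) (auto simp: c'_def)
  define S where "S = {..<a1 + a2} \<times> {..<b1 + b2} - {a2..<a1 + a2} \<times> {b1..<b1 + b2}"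
  have S: "stair a1 a2 b1 b2 i j" if "(i, j) \<in> S" for i j using that by (auto simp: S_def stair_def)
  have "card S = (a1 + a2) * (b1 + b2) - a1 * b2"
    unfolding S_def by (subst card_Diff_subset) (auto simp: card_cartesian_product)
  also have "\<dots> = c'" by (simp add: c'_def algebra_simps)
  finally have card: "card S = c'" .
  have "inj_on (\<lambda>(i, j). (a * i + b * j) mod c) S"
  proof (rule inj_onI; clarify)
    fix i j i' j' assume ij: "(i, j) \<in> S" "(i', j') \<in> S" and m: "(a * i + b * j) mod c = (a * i' + b * j') mod c"
    let ?x = "a * i + b * j" and ?y = "a * i' + b * j'"
    have "?x + c * (?y div c) = ?y + c * (?x div c)"
      using m by (metis add.commute add.left_commute mult_div_mod_eq)
    then show "i = i' \<and> j = j'" using stair_unique[OF h S S] ij by blast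
  qed
  moreover have "(\<lambda>(i, j). (a * i + b * j) mod c) ` S \<subseteq> {..<c}" using pos by auto
  ultimately have "card S \<le> card {..<c}" by (intro card_inj_on_le) auto
  then show ?thesis using le card by (simp add: c'_def)
qed

text \<open>By \<open>herzog_third\<close> in two orderings, \<open>a1 = a2\<close> divides both
  \<open>b\<close> and \<open>c\<close> and hence equals 1. Then \<open>c = 2 * b1 + b2\<close> and
  \<open>b = c1 + 2 * c2\<close>, so the inequalities \<open>b2 \<le> b1\<close> and
  \<open>c1 \<le> c2\<close> turn into \<open>c \<ge> 3 * b2\<close> and
  \<open>b \<ge> 3 * c1\<close>.\<close>

lemma herzog_ordered:
  assumes h: "herzog a b c a1 a2 b1 b2 c1 c2" and cop: "coprime a b" "coprime a c" "coprime b c"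
    and eq: "a1 = a2" and le: "b2 \<le> b1" "c1 \<le> c2"
  shows "ordered_condition a b c b2 c1"
proof -
  have c: "c = a1 * (2 * b1 + b2)" using herzog_third[OF h] cop eq by (simp add: algebra_simps)
  have "coprime c b" "coprime c a" using cop by (simp_all add: coprime_commute)
  then have b: "b = a1 * (c1 + 2 * c2)"
    using herzog_third[OF herzog_rotate[OF herzog_rotate[OF h]]] eq by (simp add: algebra_simps)
  have "a1 dvd b" "a1 dvd c" unfolding b c by simp_all
  then have "a1 = 1" using cop(3) by (metis coprime_common_divisor_nat)
  then show ?thesis using h eq b c le by (auto simp: ordered_condition_def herzog_def mult.commute)
qed

section \<open>Leading monomials modulo the third coordinate\<close>

context blowup
begin

definition comb :: "(int \<times> nat \<times> nat \<times> nat) list \<Rightarrow> 'k::comm_ring_1 cpoly" where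
  "comb L = (\<Sum>(r, i, j, l)\<leftarrow>L. of_int r * mon i j l)"

lemma comb_simps: "comb [] = 0" "comb ((r, i, j, l) # L) = of_int r * mon i j l + comb L"
  by (simp_all add: comb_def)

lemma of_int_mon: "of_int r * mon i j l = single (ex i j l) (of_int r)"
  by (metis mconst_def single_ex single_of_int)

lemma lookup_comb: "lookup (comb L) (ex i0 j0 l0) = (\<Sum>(r, i, j, l)\<leftarrow>L. if (i, j, l) = (i0, j0, l0) then of_int r else 0)"
  by (induction L) (auto simp: comb_simps lookup_add of_int_mon lookup_single when_def)

lemma keys_comb: "x \<in> keys (comb L :: 'k::comm_ring_1 cpoly) \<Longrightarrow> \<exists>r i j l. (r, i, j, l) \<in> set L \<and> x = ex i j l"
proof (induction L)
  case (Cons q L)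
  obtain r i j l where q: "q = (r, i, j, l)" by (cases q)
  have "x \<in> {ex i j l} \<union> keys (comb L :: 'k cpoly)"
    using Cons.prems keys_add[of "single (ex i j l) (of_int r)" "comb L :: 'k cpoly"]
    by (auto simp: q comb_simps of_int_mon split: if_splits)
  then show ?case using Cons.IH q by auto
qed (simp add: comb_simps)

lemma hom_comb:
  assumes "\<And>r i j l. (r, i, j, l) \<in> set L \<Longrightarrow> a * i + b * j + c * l = d"
  shows "hom (int d) (comb L)"
  unfolding homogeneous_def
proof
  fix x assume "x \<in> keys (comb L)"
  then obtain r i j l where "(r, i, j, l) \<in> set L" "x = ex i j l" using keys_comb by blast
  then show "deg x = int d" using assms by (simp only: deg_ex)
qed

lemma jet_expand: "jet u v f = (\<Sum>x\<in>keys f. [:[:lookup f x:]:] * jet u v (mon (lookup x vx) (lookup x vy) (lookup x vz)))"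
proof -
  have "jet u v f = (\<Sum>x\<in>keys f. jet u v (single x (lookup f x)))"
    by (metis jet_sum poly_mapping_sum_single)
  also have "\<dots> = (\<Sum>x\<in>keys f. [:[:lookup f x:]:] * jet u v (mon (lookup x vx) (lookup x vy) (lookup x vz)))"
  proof (rule sum.cong[OF refl])
    fix x
    have "single x (lookup f x) = mconst (lookup f x) * mon (lookup x vx) (lookup x vy) (lookup x vz)"
      using single_ex[of "lookup x vx" "lookup x vy" "lookup x vz"] by (simp add: ex_lookup)
    then show "jet u v (single x (lookup f x)) = [:[:lookup f x:]:] * jet u v (mon (lookup x vx) (lookup x vy) (lookup x vz))"
      by (simp add: jet_simps)
  qed
  finally show ?thesis .
qed

lemma sym_1_coeff_sum:
  fixes f :: "'k::idom cpoly"
  assumes "f \<in> sym (Suc k)"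
  shows "(\<Sum>x\<in>keys f. lookup f x) = 0"
proof -
  have "TT dvd jet 0 0 f" using sym_jet[OF assms, of 0 0] by (auto elim: dvd_mult_left)
  then have "poly (jet 0 0 f) 0 = 0" by (simp add: TT_dvd_iff)
  then have "poly (\<Sum>x\<in>keys f. [:[:lookup f x:]:] * jet 0 0 (mon (lookup x vx) (lookup x vy) (lookup x vz))) 0 = 0"
    by (subst (asm) jet_expand)
  then have "(\<Sum>x\<in>keys f. [:lookup f x:]) = 0" by (simp add: poly_sum jet_mon)
  then have "coeff (\<Sum>x\<in>keys f. [:lookup f x:]) 0 = 0" by simp
  then show ?thesis by (simp add: coeff_sum)
qed

lemma coeff_jet_mon: "coeff (jet u v (mon i j l)) 1 = of_nat i * u + of_nat j * v" for u v :: "'k::idom poly"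
  using jet_mon_expansion[of u v i j l] by (auto simp: TT_def power2_eq_square)

lemma sym_2_coeff_sum:
  fixes f :: "'k::idom cpoly"
  assumes "f \<in> sym 2"
  shows "(\<Sum>x\<in>keys f. lookup f x * of_nat (lookup x vx)) = 0" "(\<Sum>x\<in>keys f. lookup f x * of_nat (lookup x vy)) = 0"
proof -
  have E: "(\<Sum>x\<in>keys f. [:lookup f x:] * (of_nat (lookup x vx) * u + of_nat (lookup x vy) * v)) = 0" for u v
  proof -
    obtain G where "jet u v f = TT ^ 2 * G" using sym_jet[OF assms, of u v] by (auto elim: dvdE)
    then have "coeff (jet u v f) 1 = 0" by (simp add: TT_def power2_eq_square)
    then have "coeff (\<Sum>x\<in>keys f. [:[:lookup f x:]:] * jet u v (mon (lookup x vx) (lookup x vy) (lookup x vz))) 1 = 0"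
      by (subst (asm) jet_expand)
    then show ?thesis by (simp add: coeff_sum coeff_jet_mon del: One_nat_def)
  qed
  have "coeff (\<Sum>x\<in>keys f. [:lookup f x:] * (of_nat (lookup x vx) * 1 + of_nat (lookup x vy) * 0)) 0 = 0"
    "coeff (\<Sum>x\<in>keys f. [:lookup f x:] * (of_nat (lookup x vx) * 0 + of_nat (lookup x vy) * 1)) 0 = 0"
    by (simp_all only: E coeff_0)
  then show "(\<Sum>x\<in>keys f. lookup f x * of_nat (lookup x vx)) = 0" "(\<Sum>x\<in>keys f. lookup f x * of_nat (lookup x vy)) = 0"
    by (simp_all add: coeff_sum of_nat_poly mult.commute)
qed

text \<open>The coefficients are orthogonal to 1 and to both exponents, hence to every affine
  function of the exponents. Each vertex of a nondegenerate triangle is isolated by an affine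
  function that vanishes at the other two.\<close>

lemma sym_2_triangle:
  fixes f :: "'k::field_char_0 cpoly"
  assumes f: "f \<in> sym 2" and keys: "keys f \<subseteq> {ex i0 j0 l0, ex i1 j1 l1, ex i2 j2 l2}"
    and det: "(int i1 - int i0) * (int j2 - int j0) \<noteq> (int i2 - int i0) * (int j1 - int j0)"
  shows "f = 0"
proof -
  have S: "(\<Sum>x\<in>keys f. lookup f x * of_int (r + s * int (lookup x vx) + t * int (lookup x vy))) = 0" for r s t
  proof -
    have "(\<Sum>x\<in>keys f. lookup f x * of_int (r + s * int (lookup x vx) + t * int (lookup x vy))) =
      of_int r * (\<Sum>x\<in>keys f. lookup f x) + of_int s * (\<Sum>x\<in>keys f. lookup f x * of_nat (lookup x vx))
      + of_int t * (\<Sum>x\<in>keys f. lookup f x * of_nat (lookup x vy))"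
      by (simp add: sum_distrib_left sum.distrib algebra_simps)
    then show ?thesis using sym_1_coeff_sum[of f 1] sym_2_coeff_sum[OF f] f by (simp add: numeral_2_eq_2)
  qed
  have vanish: "x \<notin> keys f" if x: "x = ex i0 j0 l0" and sub: "keys f \<subseteq> {ex i0 j0 l0, ex i1 j1 l1, ex i2 j2 l2}"
    and det: "(int i1 - int i0) * (int j2 - int j0) \<noteq> (int i2 - int i0) * (int j1 - int j0)"
    for x i0 j0 l0 i1 j1 l1 i2 j2 l2
  proof
    assume xk: "x \<in> keys f"
    define s t r where "s = int j2 - int j1" and "t = int i1 - int i2" and "r = - (s * int i1 + t * int j1)"
    let ?g = "\<lambda>y. r + s * int (lookup y vx) + t * int (lookup y vy)"
    have "(\<Sum>y\<in>keys f. lookup f y * of_int (?g y)) = (\<Sum>y\<in>{x}. lookup f y * of_int (?g y))"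
    proof (rule sum.mono_neutral_right)
      show "\<forall>y\<in>keys f - {x}. lookup f y * of_int (?g y) = 0"
      proof
        fix y assume "y \<in> keys f - {x}"
        then have "y = ex i1 j1 l1 \<or> y = ex i2 j2 l2" using sub x by blast
        then have "?g y = 0" by (auto simp: r_def s_def t_def algebra_simps)
        then show "lookup f y * of_int (?g y) = 0" by simp
      qed
    qed (use xk in auto)
    then have "lookup f x * of_int (?g x) = 0" using S by simp
    then have "?g x = 0" using xk by (simp add: in_keys_iff del: of_int_add of_int_mult)
    then show False using det by (simp add: x r_def s_def t_def algebra_simps)
  qed
  have d1: "(int i2 - int i1) * (int j0 - int j1) \<noteq> (int i0 - int i1) * (int j2 - int j1)"
    and d2: "(int i0 - int i2) * (int j1 - int j2) \<noteq> (int i1 - int i2) * (int j0 - int j2)"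
    using det by (simp_all add: algebra_simps)
  have "ex i0 j0 l0 \<notin> keys f" by (rule vanish[OF refl keys det])
  moreover have "ex i1 j1 l1 \<notin> keys f" by (rule vanish[OF refl _ d1]) (use keys in blast)
  moreover have "ex i2 j2 l2 \<notin> keys f" by (rule vanish[OF refl _ d2]) (use keys in blast)
  ultimately have "keys f = {}" using keys by blast
  then show ?thesis by (metis keys_eq_empty)
qed

text \<open>In other terms, \<open>x^i y^j\<close> is the restriction to \<open>z = 0\<close> of a
  homogeneous element of the k-th symbolic power.\<close>

definition lead_monomial :: "'k::field_char_0 itself \<Rightarrow> nat \<Rightarrow> nat \<Rightarrow> nat \<Rightarrow> bool" where
  "lead_monomial K k i j \<longleftrightarrow> (\<exists>h :: 'k cpoly. mon i j 0 - h \<in> sym k \<and> hom (int (a * i + b * j)) h \<and>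
     (\<forall>x\<in>keys h. 0 < lookup x vz))"

lemma lead_monomialI:
  assumes "mon i j 0 - comb L \<in> (sym k :: 'k::field_char_0 cpoly set)"
    and "\<And>r i' j' l'. (r, i', j', l') \<in> set L \<Longrightarrow> l' > 0 \<and> a * i' + b * j' + c * l' = a * i + b * j"
  shows "lead_monomial (K :: 'k itself) k i j"
  unfolding lead_monomial_def
proof (intro exI conjI ballI)
  show "mon i j 0 - comb L \<in> (sym k :: 'k cpoly set)" by fact
  show "hom (int (a * i + b * j)) (comb L :: 'k cpoly)" by (rule hom_comb) (use assms(2) in blast)
  show "0 < lookup x vz" if "x \<in> keys (comb L :: 'k cpoly)" for x
    using keys_comb[OF that] assms(2) by auto
qed

lemma lead_monomial_mult:
  fixes K :: "'k::field_char_0 itself"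
  assumes "lead_monomial K k i j" "lead_monomial K k' i' j'"
  shows "lead_monomial K (k + k') (i + i') (j + j')"
proof -
  obtain g h :: "'k cpoly" where g: "mon i j 0 - g \<in> sym k" "hom (int (a * i + b * j)) g" "\<forall>x\<in>keys g. 0 < lookup x vz"
    and h: "mon i' j' 0 - h \<in> sym k'" "hom (int (a * i' + b * j')) h" "\<forall>x\<in>keys h. 0 < lookup x vz"
    using assms unfolding lead_monomial_def by blast
  define f where "f = mon i j 0 * h + (mon i' j' 0 * g - g * h)"
  have "mon (i + i') (j + j') 0 - f = (mon i j 0 - g) * (mon i' j' 0 - h)"
    by (simp add: f_def algebra_simps mon_mult)
  then have "mon (i + i') (j + j') 0 - f \<in> sym (k + k')" using sym_mult[OF g(1) h(1)] by simp
  have "hom (int (a * i + b * j + c * 0) + int (a * i' + b * j')) (mon i j 0 * h)"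
    "hom (int (a * i' + b * j' + c * 0) + int (a * i + b * j)) (mon i' j' 0 * g)"
    "hom (int (a * i + b * j) + int (a * i' + b * j')) (g * h)"
    by (intro homogeneous_mult hom_mon refl g h)+
  then have "hom (int (a * i + b * j) + int (a * i' + b * j')) f"
    unfolding f_def by (intro homogeneous_add homogeneous_diff) (simp_all add: add.commute)
  moreover note \<open>mon (i + i') (j + j') 0 - f \<in> sym (k + k')\<close>
  moreover have "0 < lookup x vz" if x: "x \<in> keys f" for x
  proof -
    have prod: "0 < lookup x vz" if "x \<in> keys (p * q)" "\<forall>x\<in>keys q. 0 < lookup x vz" for p q :: "'k cpoly"
      using that keys_mult[of p q] by (auto dest!: subsetD simp: lookup_add)
    have "x \<in> keys (mon i j 0 * h) \<or> x \<in> keys (mon i' j' 0 * g) \<or> x \<in> keys (g * h)"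
      using x unfolding f_def in_keys_iff by (auto simp: lookup_add lookup_minus)
    then show ?thesis using prod g(3) h(3) by blast
  qed
  ultimately show ?thesis unfolding lead_monomial_def
    by (intro exI[of _ f]) (auto simp: algebra_simps)
qed

text \<open>Replacing a monomial in \<open>N\<close> raises the exponent of \<open>z\<close> at
  constant degree, so \<open>a * i + b * j\<close> drops and the process ends. The clauses about
  \<open>l\<close> record this growth; \<open>reduced_element\<close> needs them to see that terms
  without \<open>z\<close> are not disturbed.\<close>

lemma normal_form:
  fixes K :: "'k::field_char_0 itself"
  assumes N: "\<And>i j. N i j \<Longrightarrow> \<exists>p q. lead_monomial K k p q \<and> p \<le> i \<and> q \<le> j"
  shows "\<exists>h :: 'k cpoly. mon i j l - h \<in> sym k \<and> hom (int (a * i + b * j + c * l)) h \<and>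
     (\<forall>x\<in>keys h. \<not> N (lookup x vx) (lookup x vy) \<and> l \<le> lookup x vz) \<and>
     (N i j \<longrightarrow> (\<forall>x\<in>keys h. l < lookup x vz)) \<and> (\<not> N i j \<longrightarrow> h = mon i j l)"
proof (induction "a * i + b * j" arbitrary: i j l rule: less_induct)
  case less
  note D = is_idealD[OF is_ideal_sym[of k, where 'a = 'k]]
  show ?case
  proof (cases "N i j")
    case False
    then show ?thesis using D(1) by (intro exI[of _ "mon i j l"]) (auto intro: hom_mon)
  next
    case True
    then obtain p q where pq: "lead_monomial K k p q" "p \<le> i" "q \<le> j" using N by blast
    then obtain h0 :: "'k cpoly" where h0: "mon p q 0 - h0 \<in> sym k" "hom (int (a * p + b * q)) h0" "\<forall>x\<in>keys h0. 0 < lookup x vz"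
      unfolding lead_monomial_def by blast
    obtain r s where rs: "i = r + p" "j = s + q" using pq(2,3) by (metis add.commute le_Suc_ex)
    define h1 where "h1 = mon r s l * h0"
    have h1_sym: "mon i j l - h1 \<in> sym k"
      using D(3)[OF h0(1), of "mon r s l"] by (simp add: h1_def right_diff_distrib mon_mult rs)
    have h1_hom: "hom (int (a * i + b * j + c * l)) h1"
      using homogeneous_mult[OF hom_mon[OF refl] h0(2), of r s l] by (simp add: h1_def rs algebra_simps)
    have h1_z: "l < lookup x vz" if "x \<in> keys h1" for x
      using that h0(3) keys_mult[of "mon r s l" h0] by (auto dest!: subsetD simp: h1_def lookup_add)
    have "\<exists>h :: 'k cpoly. mon (lookup x vx) (lookup x vy) (lookup x vz) - h \<in> sym k \<and> hom (int (a * i + b * j + c * l)) h \<and>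
       (\<forall>y\<in>keys h. \<not> N (lookup y vx) (lookup y vy) \<and> l < lookup y vz)" if x: "x \<in> keys h1" for x
    proof -
      have "deg x = int (a * i + b * j + c * l)" using h1_hom x by (simp add: homogeneous_def)
      then have dx: "a * lookup x vx + b * lookup x vy + c * lookup x vz = a * i + b * j + c * l"
        by (metis deg_ex ex_lookup of_nat_eq_iff)
      have "c * l < c * lookup x vz" using h1_z[OF x] pos by simp
      then have "a * lookup x vx + b * lookup x vy < a * i + b * j" using dx by linarith
      from less.hyps[OF this, of "lookup x vz"] show ?thesis
        unfolding dx using h1_z[OF x] by (meson order_less_le_trans)
    qed
    then obtain H :: "_ \<Rightarrow> 'k cpoly" where H: "\<And>x. x \<in> keys h1 \<Longrightarrow> mon (lookup x vx) (lookup x vy) (lookup x vz) - H x \<in> sym k"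
        "\<And>x. x \<in> keys h1 \<Longrightarrow> hom (int (a * i + b * j + c * l)) (H x)"
        "\<And>x y. x \<in> keys h1 \<Longrightarrow> y \<in> keys (H x) \<Longrightarrow> \<not> N (lookup y vx) (lookup y vy) \<and> l < lookup y vz"
      by metis
    define h where "h = (\<Sum>x\<in>keys h1. mconst (lookup h1 x) * H x)"
    have "h1 = (\<Sum>x\<in>keys h1. mconst (lookup h1 x) * mon (lookup x vx) (lookup x vy) (lookup x vz))"
      by (subst poly_mapping_sum_single[of h1, symmetric]) (simp add: ex_lookup flip: single_ex)
    then have "h1 - h = (\<Sum>x\<in>keys h1. mconst (lookup h1 x) * (mon (lookup x vx) (lookup x vy) (lookup x vz) - H x))"
      by (simp add: h_def right_diff_distrib sum_subtractf)
    also have "\<dots> \<in> sym k" by (intro is_ideal_sum[OF is_ideal_sym] D(3) H)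
    finally have "(mon i j l - h1) + (h1 - h) \<in> sym k" by (rule D(2)[OF h1_sym])
    then have "mon i j l - h \<in> sym k" by simp
    moreover have "hom (int (a * i + b * j + c * l)) h"
      unfolding h_def by (intro homogeneous_sum hom_mconst_mult H)
    moreover have "\<not> N (lookup y vx) (lookup y vy) \<and> l < lookup y vz" if "y \<in> keys h" for y
    proof -
      have "lookup h y \<noteq> 0" using that by (simp add: in_keys_iff)
      then obtain x where x: "x \<in> keys h1" "lookup (mconst (lookup h1 x) * H x) y \<noteq> 0"
        unfolding h_def lookup_sum by (meson sum.neutral)
      then have "y \<in> keys (mconst (lookup h1 x) * H x)" by (simp add: in_keys_iff)
      then have "y \<in> keys (H x)"
        using keys_mult[of "mconst (lookup h1 x)" "H x"] by (auto simp: mconst_def split: if_splits)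
      then show ?thesis using H(3) x by blast
    qed
    ultimately show ?thesis using True by (intro exI[of _ h]) (auto simp: less_imp_le)
  qed
qed

text \<open>Rewriting produces only monomials divisible by \<open>z\<close>, so the coefficient of
  \<open>ex i j 0\<close> survives. Support statements can then be proved by contradiction on
  elements all of whose monomials avoid \<open>N\<close>.\<close>

lemma reduced_element:
  fixes K :: "'k::field_char_0 itself" and f :: "'k cpoly"
  assumes N: "\<And>i j. N i j \<Longrightarrow> \<exists>p q. lead_monomial K k p q \<and> p \<le> i \<and> q \<le> j"
    and f: "f \<in> sym k" "hom d f" "ex i j 0 \<in> keys f" "\<not> N i j"
  shows "\<exists>g :: 'k cpoly. g \<in> sym k \<and> hom d g \<and> ex i j 0 \<in> keys g \<and> (\<forall>x\<in>keys g. \<not> N (lookup x vx) (lookup x vy))"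
proof -
  note D = is_idealD[OF is_ideal_sym[of k, where 'a = 'k]]
  have "\<exists>h :: 'k cpoly. mon (lookup x vx) (lookup x vy) (lookup x vz) - h \<in> sym k \<and> hom (deg x) h \<and>
     (\<forall>y\<in>keys h. \<not> N (lookup y vx) (lookup y vy)) \<and>
     (N (lookup x vx) (lookup x vy) \<longrightarrow> (\<forall>y\<in>keys h. lookup x vz < lookup y vz)) \<and>
     (\<not> N (lookup x vx) (lookup x vy) \<longrightarrow> h = mon (lookup x vx) (lookup x vy) (lookup x vz))" for x
    using normal_form[OF N, of "\<lambda>i j. N i j" "lookup x vx" "lookup x vy" "lookup x vz"]
    unfolding deg_ex[symmetric] ex_lookup by blast
  then obtain H :: "_ \<Rightarrow> 'k cpoly" where H: "\<And>x. mon (lookup x vx) (lookup x vy) (lookup x vz) - H x \<in> sym k"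
      "\<And>x. hom (deg x) (H x)" "\<And>x y. y \<in> keys (H x) \<Longrightarrow> \<not> N (lookup y vx) (lookup y vy)"
      "\<And>x y. N (lookup x vx) (lookup x vy) \<Longrightarrow> y \<in> keys (H x) \<Longrightarrow> lookup x vz < lookup y vz"
      "\<And>x. \<not> N (lookup x vx) (lookup x vy) \<Longrightarrow> H x = mon (lookup x vx) (lookup x vy) (lookup x vz)"
    by metis
  define g where "g = (\<Sum>x\<in>keys f. mconst (lookup f x) * H x)"
  have "f = (\<Sum>x\<in>keys f. mconst (lookup f x) * mon (lookup x vx) (lookup x vy) (lookup x vz))"
    by (subst poly_mapping_sum_single[of f, symmetric]) (simp add: ex_lookup flip: single_ex)
  then have "f - g = (\<Sum>x\<in>keys f. mconst (lookup f x) * (mon (lookup x vx) (lookup x vy) (lookup x vz) - H x))"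
    by (simp add: g_def right_diff_distrib sum_subtractf)
  also have "\<dots> \<in> sym k" by (intro is_ideal_sum[OF is_ideal_sym] D(3) H)
  finally have "f - (f - g) \<in> sym k" by (rule D(6)[OF f(1)])
  then have "g \<in> sym k" by simp
  moreover have "hom d g" unfolding g_def
  proof (intro homogeneous_sum hom_mconst_mult)
    show "hom d (H x)" if "x \<in> keys f" for x using H(2)[of x] f(2) that by (simp add: homogeneous_def)
  qed
  moreover have "\<not> N (lookup y vx) (lookup y vy)" if "y \<in> keys g" for y
  proof -
    have "lookup g y \<noteq> 0" using that by (simp add: in_keys_iff)
    then obtain x where x: "x \<in> keys f" "lookup (mconst (lookup f x) * H x) y \<noteq> 0"
      unfolding g_def lookup_sum by (meson sum.neutral)
    then have "y \<in> keys (mconst (lookup f x) * H x)" by (simp add: in_keys_iff)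
    then have "y \<in> keys (H x)"
      using keys_mult[of "mconst (lookup f x)" "H x"] by (auto simp: mconst_def split: if_splits)
    then show ?thesis by (rule H(3))
  qed
  moreover have "ex i j 0 \<in> keys g"
  proof -
    have lk: "lookup (mconst r * h) y = r * lookup h y" for r and h :: "'k cpoly" and y
      by (simp add: mconst_def flip: mult_map_scale_conv_mult) (simp add: Poly_Mapping.map.rep_eq when_def)
    have "lookup g (ex i j 0) = (\<Sum>x\<in>keys f. if x = ex i j 0 then lookup f x else 0)"
      unfolding g_def lookup_sum lk
    proof (rule sum.cong[OF refl])
      fix x assume "x \<in> keys f"
      show "lookup f x * lookup (H x) (ex i j 0) = (if x = ex i j 0 then lookup f x else 0)"
      proof (cases "N (lookup x vx) (lookup x vy)")
        case True
        then have "ex i j 0 \<notin> keys (H x)" using H(4)[of x "ex i j 0"] by auto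
        then show ?thesis using True f(4) by (auto simp: in_keys_iff)
      next
        case False
        then have "H x = single x 1" using H(5)[of x] by (simp add: mon_def ex_lookup)
        then show ?thesis by (simp add: lookup_single when_def)
      qed
    qed
    also have "\<dots> = lookup f (ex i j 0)" using f(3) by simp
    finally show ?thesis using f(3) by (simp add: in_keys_iff)
  qed
  ultimately show ?thesis by blast
qed

end

section \<open>The Cox ring outside condition (ii)\<close>

text \<open>The signs of \<open>a1 - a2\<close>, \<open>b1 - b2\<close>, \<open>c1 - c2\<close> are
  nonnegative, positive, positive, or else positive, nonnegative, negative. Up to rotation and
  reflection these are the patterns that do not lead to (ii).\<close>

locale bad_blowup = blowup +
  fixes a1 a2 b1 b2 c1 c2 :: nat and K :: "'k::field_char_0 itself"
  assumes herzog: "herzog a b c a1 a2 b1 b2 c1 c2"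
    and a12: "a2 \<le> a1" and b12: "b2 \<le> b1" and c12: "c2 < c1 \<and> b2 < b1 \<or> c1 < c2 \<and> a2 < a1"
begin

lemma mon_cong: "i = i' \<Longrightarrow> j = j' \<Longrightarrow> l = l' \<Longrightarrow> mon i j l = mon i' j' l'"
  by simp

lemma herzogD:
  "a1 > 0" "a2 > 0" "b1 > 0" "b2 > 0" "c1 > 0" "c2 > 0"
  "a * a1 + a * a2 = b * b2 + c * c1" "b * b1 + b * b2 = a * a1 + c * c2" "c * c1 + c * c2 = a * a2 + b * b1"
  using herzog by (auto simp: herzog_def distrib_left)

section \<open>Monomial ideals bounding the first two symbolic powers at z = 0\<close>

definition M1 :: "nat \<Rightarrow> nat \<Rightarrow> bool" where
  "M1 i j \<longleftrightarrow> a1 + a2 \<le> i \<or> b1 + b2 \<le> j \<or> a2 \<le> i \<and> b1 \<le> j"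

text \<open>The first six alternatives are the pairwise products of the three generators of
  \<open>M1\<close>. The last two are the monomial without \<open>z\<close> in
  \<open>\<Delta>\<close>, which depends on the sign of \<open>c1 - c2\<close>.\<close>

definition M2 :: "nat \<Rightarrow> nat \<Rightarrow> bool" where
  "M2 i j \<longleftrightarrow> 2 * (a1 + a2) \<le> i \<or> a1 + a2 \<le> i \<and> b1 + b2 \<le> j \<or> a1 + 2 * a2 \<le> i \<and> b1 \<le> j
     \<or> 2 * (b1 + b2) \<le> j \<or> a2 \<le> i \<and> 2 * b1 + b2 \<le> j \<or> 2 * a2 \<le> i \<and> 2 * b1 \<le> j
     \<or> c2 < c1 \<and> 2 * a1 + a2 \<le> i \<and> b1 - b2 \<le> j \<or> c1 < c2 \<and> 2 * b1 + b2 \<le> j"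

definition M3 :: "nat \<Rightarrow> nat \<Rightarrow> bool" where
  "M3 i j \<longleftrightarrow> (\<exists>i1 j1 i2 j2. M1 i1 j1 \<and> M2 i2 j2 \<and> i = i1 + i2 \<and> j = j1 + j2)"

definition F1 :: "'k cpoly" where "F1 = mon (a1 + a2) 0 0 - mon 0 b2 c1"
definition F2 :: "'k cpoly" where "F2 = mon 0 (b1 + b2) 0 - mon a1 0 c2"
definition F3 :: "'k cpoly" where "F3 = mon 0 0 (c1 + c2) - mon a2 b1 0"

lemma F_in_point_ideal: "F1 \<in> point_ideal w" "F2 \<in> point_ideal w" "F3 \<in> point_ideal w"
  unfolding F1_def F2_def F3_def
  by (intro binomial_in_point_ideal; use herzogD in \<open>simp add: distrib_left\<close>)+

lemma prod2: "f \<in> point_ideal w \<Longrightarrow> g \<in> point_ideal w \<Longrightarrow> f * g \<in> ideal_power (point_ideal w) 2"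
  for f g :: "'k cpoly"
  using ideal_power_mult[OF ideal_power_1[of f] ideal_power_1[of g]] by (simp only: one_add_one)

lemma power_prod: "f \<in> point_ideal w \<Longrightarrow> g \<in> point_ideal w \<Longrightarrow> 3 \<le> r + s \<Longrightarrow>
    h * (f ^ r * g ^ s) \<in> ideal_power (point_ideal w) 3" for f g h :: "'k cpoly"
  by (rule is_idealD(3)[OF is_ideal_ideal_power])
     (use ideal_power_mult[OF ideal_power_power[of f _ r] ideal_power_power[of g _ s]] ideal_power_antimono[of 3 "r + s"] in blast)

text \<open>The second symbolic power has one generator that is not in the square of the ideal; it
  arises from \<open>x\<^bsup>a1-a2\<^esup> F3\<^sup>2 - y\<^bsup>b1-b2\<^esup> F1 F2\<close> by dividing by a power of \<open>z\<close>.\<close>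

definition \<Delta> :: "(int \<times> nat \<times> nat \<times> nat) list" where
  "\<Delta> = [(1, 2 * a1 + a2, b1 - b2, c2 - c1), (- 3, a1, b1, c1 + (c2 - c1)), (1, 0, 2 * b1 + b2, c1 - c2),
     (1, a1 - a2, 0, 2 * c1 + c2 + (c2 - c1))]"

lemma \<Delta>_in_sym: "comb \<Delta> \<in> (sym 2 :: 'k cpoly set)"
proof -
  obtain s r where sr: "a1 = a2 + s" "b1 = b2 + r" using a12 b12 by (metis le_add_diff_inverse)
  \<comment> \<open>The terms without a factor \<open>z ^ c1\<close> or \<open>z ^ c2\<close> are
    equal and cancel; \<open>z ^ t\<close> divides what remains.\<close>
  define t where "t = min c1 c2"
  have c: "c1 = (c1 - c2) + t" "c2 = (c2 - c1) + t" by (auto simp: t_def)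
  have "mon 0 0 t * comb \<Delta> = mon (a1 - a2) 0 0 * (F3 * F3) - mon 0 (b1 - b2) 0 * (F1 * F2)"
  proof (cases "c1 \<le> c2")
    case True
    then obtain u where u: "c2 = c1 + u" "t = c1" by (metis le_add_diff_inverse t_def min.absorb1)
    show ?thesis unfolding \<Delta>_def F1_def F2_def F3_def unfolding sr u
      by (simp add: comb_simps algebra_simps mon_mult,
          intro arg_cong2[of _ _ _ _ "(+) :: 'k cpoly \<Rightarrow> _"] mon_cong; simp)
  next
    case False
    then obtain u where u: "c1 = c2 + u" "t = c2" by (metis le_add_diff_inverse t_def min.absorb2 nat_le_linear)
    have e: "a2 + (a2 + (a2 + (s + s))) = a2 * 3 + s * 2" "b2 + (b2 + (b2 + (r + r))) = b2 * 3 + r * 2"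
      "c2 + (c2 + (c2 + (c2 + (u + u)))) = u * 2 + c2 * 4" by simp_all
    show ?thesis unfolding \<Delta>_def F1_def F2_def F3_def unfolding sr u
      by (simp add: comb_simps algebra_simps mon_mult e)
  qed
  also have "\<dots> \<in> ideal_power (point_ideal w) 2"
    by (intro is_idealD(6)[OF is_ideal_ideal_power] is_idealD(3)[OF is_ideal_ideal_power, OF prod2] F_in_point_ideal)
  finally show ?thesis by (rule saturation_of_monomial)
qed

lemma lead_monomials_1: "lead_monomial K 1 (a1 + a2) 0" "lead_monomial K 1 0 (b1 + b2)" "lead_monomial K 1 a2 b1"
proof -
  have F: "F1 \<in> sym 1" "F2 \<in> sym 1" "- F3 \<in> sym 1"
    using F_in_point_ideal point_ideal_subset_sym is_idealD(5)[OF is_ideal_point_ideal] by blast+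
  show "lead_monomial K 1 (a1 + a2) 0"
    by (rule lead_monomialI[of _ _ "[(1, 0, b2, c1)]"])
       (use F(1) herzogD in \<open>auto simp: comb_simps F1_def distrib_left\<close>)
  show "lead_monomial K 1 0 (b1 + b2)"
    by (rule lead_monomialI[of _ _ "[(1, a1, 0, c2)]"])
       (use F(2) herzogD in \<open>auto simp: comb_simps F2_def distrib_left\<close>)
  show "lead_monomial K 1 a2 b1"
    by (rule lead_monomialI[of _ _ "[(1, 0, 0, c1 + c2)]"])
       (use F(3) herzogD in \<open>auto simp: comb_simps F3_def distrib_left\<close>)
qed

lemma lead_monomial_M1: "M1 i j \<Longrightarrow> \<exists>p q. lead_monomial K 1 p q \<and> p \<le> i \<and> q \<le> j"
  unfolding M1_def using lead_monomials_1 by fastforce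

lemma lead_monomial_\<Delta>:
  "c2 < c1 \<Longrightarrow> lead_monomial K 2 (2 * a1 + a2) (b1 - b2)" "c1 < c2 \<Longrightarrow> lead_monomial K 2 0 (2 * b1 + b2)"
proof -
  obtain s r where sr: "a1 = a2 + s" "b1 = b2 + r" using a12 b12 by (metis le_add_diff_inverse)
  note D = herzogD[unfolded sr, simplified distrib_left]
  show "lead_monomial K 2 (2 * a1 + a2) (b1 - b2)" if c: "c2 < c1"
  proof (rule lead_monomialI[of _ _ "[(3, a1, b1, c1), (- 1, 0, 2 * b1 + b2, c1 - c2), (- 1, a1 - a2, 0, 2 * c1 + c2)]"])
    obtain t where t: "c1 = c2 + t" "t > 0" using c less_imp_add_positive by blast
    show "mon (2 * a1 + a2) (b1 - b2) 0 - comb [(3, a1, b1, c1), (- 1, 0, 2 * b1 + b2, c1 - c2), (- 1, a1 - a2, 0, 2 * c1 + c2)]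
        \<in> (sym 2 :: 'k cpoly set)"
      using \<Delta>_in_sym unfolding \<Delta>_def using c by (simp add: comb_simps algebra_simps)
    show "l' > 0 \<and> a * i' + b * j' + c * l' = a * (2 * a1 + a2) + b * (b1 - b2)"
      if "(r', i', j', l') \<in> set [(3, a1, b1, c1), (- 1, 0, 2 * b1 + b2, c1 - c2), (- 1, a1 - a2, 0, 2 * c1 + c2)]" for r' i' j' l'
      using that D t unfolding sr by (auto simp: distrib_left)
  qed
  show "lead_monomial K 2 0 (2 * b1 + b2)" if c: "c1 < c2"
  proof (rule lead_monomialI[of _ _ "[(3, a1, b1, c2), (- 1, 2 * a1 + a2, b1 - b2, c2 - c1), (- 1, a1 - a2, 0, c1 + 2 * c2)]"])
    obtain t where t: "c2 = c1 + t" "t > 0" using c less_imp_add_positive by blast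
    show "mon 0 (2 * b1 + b2) 0 - comb [(3, a1, b1, c2), (- 1, 2 * a1 + a2, b1 - b2, c2 - c1), (- 1, a1 - a2, 0, c1 + 2 * c2)]
        \<in> (sym 2 :: 'k cpoly set)"
    proof -
      have "\<Delta> = [(1, 2 * a1 + a2, b1 - b2, c2 - c1), (- 3, a1, b1, c2), (1, 0, 2 * b1 + b2, 0), (1, a1 - a2, 0, c1 + 2 * c2)]"
        using c by (simp add: \<Delta>_def)
      then show ?thesis using \<Delta>_in_sym by (simp add: comb_simps algebra_simps)
    qed
    show "l' > 0 \<and> a * i' + b * j' + c * l' = a * 0 + b * (2 * b1 + b2)"
      if "(r', i', j', l') \<in> set [(3, a1, b1, c2), (- 1, 2 * a1 + a2, b1 - b2, c2 - c1), (- 1, a1 - a2, 0, c1 + 2 * c2)]" for r' i' j' l'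
      using that D t unfolding sr by (auto simp: distrib_left)
  qed
qed

lemma lead_monomial_M2: "M2 i j \<Longrightarrow> \<exists>p q. lead_monomial K 2 p q \<and> p \<le> i \<and> q \<le> j"
proof -
  note L = lead_monomials_1
  have "lead_monomial K 2 (2 * (a1 + a2)) 0" "lead_monomial K 2 (a1 + a2) (b1 + b2)" "lead_monomial K 2 (a1 + 2 * a2) b1"
     "lead_monomial K 2 0 (2 * (b1 + b2))" "lead_monomial K 2 a2 (2 * b1 + b2)" "lead_monomial K 2 (2 * a2) (2 * b1)"
    using lead_monomial_mult[OF L(1) L(1)] lead_monomial_mult[OF L(1) L(2)] lead_monomial_mult[OF L(1) L(3)]
      lead_monomial_mult[OF L(2) L(2)] lead_monomial_mult[OF L(3) L(2)] lead_monomial_mult[OF L(3) L(3)]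
    by (simp_all add: mult_2 add.assoc numeral_2_eq_2)
  then show "M2 i j \<Longrightarrow> ?thesis" unfolding M2_def using lead_monomial_\<Delta> by (elim disjE) (blast | fastforce)+
qed

text \<open>Outside \<open>M1\<close> there is at most one monomial in each degree, by
  \<open>stair_unique\<close>. A reduced element would thus be a multiple of a single monomial,
  which does not vanish at the point.\<close>

lemma sym_1_support:
  assumes f: "f \<in> (sym 1 :: 'k cpoly set)" "hom d f" "ex i j 0 \<in> keys f"
  shows "M1 i j"
proof (rule ccontr)
  assume "\<not> M1 i j"
  then obtain g :: "'k cpoly" where g: "g \<in> sym 1" "hom d g" "ex i j 0 \<in> keys g"
      "\<forall>x\<in>keys g. \<not> M1 (lookup x vx) (lookup x vy)"
    using reduced_element[OF lead_monomial_M1 f] by blast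
  have "x = ex i j 0" if x: "x \<in> keys g" for x
  proof (cases x rule: ex_cases)
    case (ex i' j' l')
    have "deg x = deg (ex i j 0)" using g(2,3) x by (simp add: homogeneous_def)
    then have e: "a * i' + b * j' + c * l' = a * i + b * j + c * 0" unfolding ex deg_ex by (simp only: of_nat_eq_iff)
    have "\<not> M1 i' j'" "\<not> M1 i j" using g(3,4) x ex by fastforce+
    then show ?thesis using stair_unique[OF herzog _ _ e] by (auto simp: ex stair_def M1_def)
  qed
  then have "keys g = {ex i j 0}" using g(3) by blast
  then have "lookup g (ex i j 0) = 0" using sym_1_coeff_sum[of g 0] g(1) by simp
  then show False using g(3) by (simp add: in_keys_iff)
qed

text \<open>The six possible positions of a monomial outside \<open>M2\<close> relative to the representative outside
  \<open>M1\<close> of its class modulo the lattice spanned by \<open>(a1 + a2, - b2, - c1)\<close> and \<open>(- a1, b1 + b2, - c2)\<close>.\<close>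

definition position :: "nat \<Rightarrow> nat \<Rightarrow> nat \<Rightarrow> nat \<Rightarrow> nat \<Rightarrow> nat \<Rightarrow> bool" where
  "position s t e i j l \<longleftrightarrow> i = s \<and> j = t \<and> l = e
     \<or> i = s + (a1 + a2) \<and> j + b2 = t \<and> l + c1 = e
     \<or> i + a1 = s \<and> j = t + (b1 + b2) \<and> l + c2 = e
     \<or> i = s + a2 \<and> j = t + b1 \<and> l + (c1 + c2) = e
     \<or> i = s + (a1 + 2 * a2) \<and> j + b2 = t + b1 \<and> l + (2 * c1 + c2) = e
     \<or> i + a1 = s + a2 \<and> j = t + (2 * b1 + b2) \<and> l + (c1 + 2 * c2) = e"

lemma position_degree: "position s t e i j l \<Longrightarrow> a * s + b * t + c * e = a * i + b * j + c * l"
  unfolding position_def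
proof (elim disjE conjE)
  assume "i = s + (a1 + a2)" "j + b2 = t" "l + c1 = e"
  then show ?thesis using herzogD by (auto simp: distrib_left)
next
  assume h: "i + a1 = s" "j = t + (b1 + b2)" "l + c2 = e"
  then show ?thesis using herzogD by (auto simp: distrib_left)
next
  assume "i = s + a2" "j = t + b1" "l + (c1 + c2) = e"
  then show ?thesis using herzogD by (auto simp: distrib_left)
next
  assume h: "i = s + (a1 + 2 * a2)" "j + b2 = t + b1" "l + (2 * c1 + c2) = e"
  have "b * j + b * b2 = b * t + b * b1" using h(2) by (metis distrib_left)
  then show ?thesis using h(1) h(3)[symmetric] herzogD by (simp add: distrib_left)
next
  assume h: "i + a1 = s + a2" "j = t + (2 * b1 + b2)" "l + (c1 + 2 * c2) = e"
  have "a * i + a * a1 = a * s + a * a2" using h(1) by (metis distrib_left)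
  then show ?thesis using h(2) h(3)[symmetric] herzogD by (simp add: distrib_left)
qed simp

lemma not_M2D:
  assumes "\<not> M2 i j"
  shows "i < 2 * (a1 + a2) \<and> \<not> (a1 + a2 \<le> i \<and> b1 + b2 \<le> j) \<and> \<not> (a1 + 2 * a2 \<le> i \<and> b1 \<le> j)
    \<and> j < 2 * (b1 + b2) \<and> \<not> (a2 \<le> i \<and> 2 * b1 + b2 \<le> j) \<and> \<not> (2 * a2 \<le> i \<and> 2 * b1 \<le> j)
    \<and> (c2 < c1 \<longrightarrow> \<not> (2 * a1 + a2 \<le> i \<and> b1 \<le> j + b2)) \<and> (c1 < c2 \<longrightarrow> j < 2 * b1 + b2)"
  using assms unfolding M2_def by auto

text \<open>A step along \<open>F1\<close>, \<open>F2\<close> or \<open>F3\<close>, or along one of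
  the first two followed by \<open>F3\<close>, brings the exponents out of \<open>M1\<close>;
  further steps would be needed only inside \<open>M2\<close>.\<close>

lemma position_exists:
  assumes "\<not> M2 i j"
  shows "\<exists>s t e. \<not> M1 s t \<and> position s t e i j l"
proof -
  note P = herzogD(1-6) a12 b12
  have N: "i < 2 * (a1 + a2)" "\<not> (a1 + a2 \<le> i \<and> b1 + b2 \<le> j)" "\<not> (a1 + 2 * a2 \<le> i \<and> b1 \<le> j)"
    "j < 2 * (b1 + b2)" "\<not> (a2 \<le> i \<and> 2 * b1 + b2 \<le> j)" "\<not> (2 * a2 \<le> i \<and> 2 * b1 \<le> j)"
    using not_M2D[OF assms] by simp_all
  have M1I: "\<not> M1 s t" if "s < a1 + a2" "t < b1 + b2" "s < a2 \<or> t < b1" for s t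
    using that by (auto simp: M1_def)
  have diag: ?thesis if ij: "a2 \<le> i" "b1 \<le> j"
  proof -
    obtain u v where u: "i = u + a2" "j = v + b1" using ij by (metis add.commute le_Suc_ex)
    have "\<not> M1 u v" by (rule M1I) (use N u in auto)
    moreover have "position u v (l + (c1 + c2)) i j l" using u by (simp add: position_def)
    ultimately show ?thesis by blast
  qed
  consider "\<not> M1 i j" | "a2 \<le> i" "b1 \<le> j" | "i \<ge> a1 + a2" "j < b1" | "j \<ge> b1 + b2" "i < a2"
    unfolding M1_def using P by linarith
  then show ?thesis
  proof cases
    case 1
    then show ?thesis by (auto simp: position_def)
  next
    case 2
    then show ?thesis by (rule diag)
  next
    case 3
    then obtain r where r: "i = r + (a1 + a2)" by (metis add.commute le_Suc_ex)
    show ?thesis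
    proof (cases "M1 r (j + b2)")
      case False
      moreover have "position r (j + b2) (l + c1) i j l" using r by (simp add: position_def)
      ultimately show ?thesis by blast
    next
      case True
      then have "a2 \<le> r" "b1 \<le> j + b2" using 3 N(1) unfolding M1_def r by auto
      then obtain u v where u: "r = u + a2" "j + b2 = v + b1" by (metis add.commute le_Suc_ex)
      have "\<not> M1 u v" by (rule M1I) (use N u 3 P r in auto)
      moreover have "position u v (l + (2 * c1 + c2)) i j l" using u r by (simp add: position_def)
      ultimately show ?thesis by blast
    qed
  next
    case 4
    then obtain r where r: "j = r + (b1 + b2)" by (metis add.commute le_Suc_ex)
    show ?thesis
    proof (cases "r < b1")
      case True
      have "\<not> M1 (i + a1) r" by (rule M1I) (use True 4 in auto)
      moreover have "position (i + a1) r (l + c2) i j l" using r by (simp add: position_def)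
      ultimately show ?thesis by blast
    next
      case False
      then obtain v where v: "r = v + b1" by (metis add.commute le_Suc_ex not_less)
      obtain u where u: "a1 = u + a2" using a12 by (metis add.commute le_Suc_ex)
      have "\<not> M1 (i + u) v" by (rule M1I) (use N v u 4 P r in auto)
      moreover have "position (i + u) v (l + (c1 + 2 * c2)) i j l"
        using u v r unfolding position_def by simp
      ultimately show ?thesis by blast
    qed
  qed
qed

text \<open>All monomials of a reduced element are placed relative to the same representative, and
  in each case at most three of the six positions remain; they form a nondegenerate triangle, so
  \<open>sym_2_triangle\<close> applies.\<close>

lemma sym_2_support:
  assumes f: "f \<in> (sym 2 :: 'k cpoly set)" "hom d f" "ex i j 0 \<in> keys f"
  shows "M2 i j"
proof (rule ccontr)
  assume "\<not> M2 i j"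
  then obtain g :: "'k cpoly" where g: "g \<in> sym 2" "hom d g" "ex i j 0 \<in> keys g"
      "\<forall>x\<in>keys g. \<not> M2 (lookup x vx) (lookup x vy)"
    using reduced_element[OF lead_monomial_M2 f] by blast
  obtain s t e where st: "\<not> M1 s t" "position s t e i j 0" using position_exists[OF \<open>\<not> M2 i j\<close>] by blast
  have pos: "position s t e i' j' l' \<and> \<not> M2 i' j'" if x: "ex i' j' l' \<in> keys g" for i' j' l'
  proof -
    have "\<not> M2 i' j'" using g(4) x by fastforce
    then obtain s' t' e' where st': "\<not> M1 s' t'" "position s' t' e' i' j' l'" using position_exists by blast
    have "deg (ex i' j' l') = deg (ex i j 0)" using g(2,3) x by (simp add: homogeneous_def)
    then have "a * i' + b * j' + c * l' = a * i + b * j + c * 0" unfolding deg_ex by (simp only: of_nat_eq_iff)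
    then have e: "a * s' + b * t' + c * e' = a * s + b * t + c * e"
      using position_degree[OF st'(2)] position_degree[OF st(2)] by simp
    have "stair a1 a2 b1 b2 s' t'" "stair a1 a2 b1 b2 s t" using st(1) st'(1) by (auto simp: stair_def M1_def)
    from stair_unique[OF herzog this e] have "s' = s \<and> t' = t \<and> e' = e" .
    then show ?thesis using st' \<open>\<not> M2 i' j'\<close> by simp
  qed
  note P = herzogD(1-6) a12 b12
  have st': "s < a1 + a2" "t < b1 + b2" "s < a2 \<or> t < b1" using st(1) by (auto simp: M1_def)
  have "g = 0"
  proof -
    have tri: "g = 0" if "\<And>i' j' l'. position s t e i' j' l' \<Longrightarrow> \<not> M2 i' j' \<Longrightarrow>
        (i', j', l') = (i0, j0, l0) \<or> (i', j', l') = (i1, j1, l1) \<or> (i', j', l') = (i2, j2, l2)"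
      "(int i1 - int i0) * (int j2 - int j0) \<noteq> (int i2 - int i0) * (int j1 - int j0)" for i0 j0 l0 i1 j1 l1 i2 j2 l2
    proof (rule sym_2_triangle[OF g(1) _ that(2)])
      show "keys g \<subseteq> {ex i0 j0 l0, ex i1 j1 l1, ex i2 j2 l2}"
      proof
        fix x assume "x \<in> keys g"
        then show "x \<in> {ex i0 j0 l0, ex i1 j1 l1, ex i2 j2 l2}"
          using pos that(1) by (cases x rule: ex_cases) auto
      qed
    qed
    \<comment> \<open>This is the determinant of the lattice vectors \<open>(a1 + a2, - b2)\<close>
      and \<open>(- a1, b1 + b2)\<close>; every triangle below has it as determinant up to
      sign.\<close>
    have D: "int a1 * int b1 + int a2 * int b1 + int a2 * int b2 > 0" using P by (simp add: add_pos_pos)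
    show ?thesis
    proof (cases "b2 \<le> t"; cases "a1 \<le> s")
      assume c: "b2 \<le> t" "a1 \<le> s"
      show ?thesis
        by (rule tri[of s t e "s + (a1 + a2)" "t - b2" "e - c1" "s - a1" "t + (b1 + b2)" "e - c2"],
            unfold position_def, drule not_M2D, use P c in \<open>elim disjE conjE; auto\<close>,
            use P D c in \<open>simp add: of_nat_diff algebra_simps\<close>)
    next
      assume c: "b2 \<le> t" "\<not> a1 \<le> s"
      show ?thesis
        by (rule tri[of s t e "s + (a1 + a2)" "t - b2" "e - c1" "s + a2" "t + b1" "e - (c1 + c2)"],
            unfold position_def, drule not_M2D, use P c in \<open>elim disjE conjE; auto\<close>,
            use P D c in \<open>simp add: of_nat_diff algebra_simps\<close>)
    next
      assume c: "\<not> b2 \<le> t" "a1 \<le> s"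
      show ?thesis
        by (rule tri[of s t e "s - a1" "t + (b1 + b2)" "e - c2" "s + a2" "t + b1" "e - (c1 + c2)"],
            unfold position_def, drule not_M2D, use P c in \<open>elim disjE conjE; auto\<close>,
            use P D c in \<open>simp add: of_nat_diff algebra_simps\<close>)
    next
      assume c: "\<not> b2 \<le> t" "\<not> a1 \<le> s"
      show ?thesis
      \<comment> \<open>Here \<open>\<Delta>\<close> decides. If \<open>c1 < c2\<close>, the sixth
        position lies in \<open>M2\<close>; if \<open>s + a2 < a1\<close>, its exponent of
        \<open>x\<close> would be negative. Otherwise the fifth position lies in
        \<open>M2\<close>.\<close>
      proof (cases "c1 < c2 \<or> s + a2 < a1")
        case True
        show ?thesis
          by (rule tri[of s t e "s + a2" "t + b1" "e - (c1 + c2)" "s + (a1 + 2 * a2)" "t + b1 - b2" "e - (2 * c1 + c2)"],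
              unfold position_def, drule not_M2D, use P c True c12 in \<open>elim disjE conjE; auto\<close>,
              use P D c True c12 in \<open>simp add: of_nat_diff algebra_simps\<close>)
      next
        case False
        show ?thesis
          by (rule tri[of s t e "s + a2" "t + b1" "e - (c1 + c2)" "s + a2 - a1" "t + (2 * b1 + b2)" "e - (c1 + 2 * c2)"],
              unfold position_def, drule not_M2D, use P c False c12 in \<open>elim disjE conjE; auto\<close>,
              use P D c False c12 in \<open>simp add: of_nat_diff algebra_simps\<close>)
      qed
    qed
  qed
  then show False using g(3) by simp
qed

section \<open>A subalgebra defined by supports at z = 0\<close>

definition Mk :: "int \<Rightarrow> nat \<Rightarrow> nat \<Rightarrow> bool" where
  "Mk k i j \<longleftrightarrow> (if k \<le> 0 then True else if k = 1 then M1 i j else if k = 2 then M2 i j else M3 i j)"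

lemma M1_mono: "M1 i j \<Longrightarrow> M1 (i + i') (j + j')"
  by (auto simp: M1_def)

lemma M2_mono: "M2 i j \<Longrightarrow> M2 (i + i') (j + j')"
  unfolding M2_def by (elim disjE conjE) (simp_all add: trans_le_add1)

lemma M3_mono: "M3 i j \<Longrightarrow> M3 (i + i') (j + j')"
  unfolding M3_def by (metis M2_mono add.assoc)

lemma M2_M1: "M2 i j \<Longrightarrow> M1 i j"
  unfolding M2_def M1_def using a12 b12 by (elim disjE conjE) simp_all

lemma M1_M1: "M1 i j \<Longrightarrow> M1 i' j' \<Longrightarrow> M2 (i + i') (j + j')"
  unfolding M1_def M2_def by (elim disjE conjE) simp_all

lemma M3_M2: "M3 i j \<Longrightarrow> M2 i j"
  unfolding M3_def by (metis M2_mono add.commute)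

text \<open>\<open>M3\<close> is kept for all multiplicities from three on, so products of any
  factors of positive multiplicity stay under control. Factors of nonpositive multiplicity may lower
  the level, which the inclusions of \<open>M3\<close> in \<open>M2\<close> in \<open>M1\<close>
  allow.\<close>

lemma Mk_mult:
  assumes "Mk k i j" "Mk l i' j'"
  shows "Mk (k + l) (i + i') (j + j')"
proof -
  have up: "Mk k' i j" if "Mk k i j" "k' \<le> k" for k k' i j
    using that M2_M1 M3_M2 by (auto simp: Mk_def split: if_splits)
  have mono: "Mk k (i + i') (j + j')" if "Mk k i j" for k i j i' j'
    using that by (auto simp: Mk_def M1_mono M2_mono M3_mono)
  consider "k \<le> 0" | "l \<le> 0" | "k \<ge> 3" | "l \<ge> 3" | "k = 1" "l = 1" | "k = 1" "l = 2" | "k = 2" "l = 1" | "k = 2" "l = 2"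
    by linarith
  then show ?thesis
  proof cases
    case 1
    then show ?thesis using up[of l i' j' "k + l"] mono[of "k + l" i' j' i j] assms by (simp add: add.commute)
  next
    case 2
    then show ?thesis using up[of k i j "k + l"] mono[of "k + l" i j i' j'] assms by simp
  next
    case 3
    then have "M3 (i + i') (j + j')" using assms M3_mono by (simp add: Mk_def)
    then have "Mk (max 3 (k + l)) (i + i') (j + j')" by (auto simp: Mk_def max_def)
    then show ?thesis by (rule up) simp
  next
    case 4
    then have "M3 (i' + i) (j' + j)" using assms M3_mono by (simp add: Mk_def)
    then have "Mk (max 3 (k + l)) (i + i') (j + j')" by (auto simp: Mk_def max_def add.commute)
    then show ?thesis by (rule up) simp
  next
    case 5
    then show ?thesis using assms M1_M1 by (simp add: Mk_def)
  next
    case 6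
    then show ?thesis using assms unfolding Mk_def M3_def by auto
  next
    case 7
    then have "M1 i' j'" "M2 i j" using assms by (simp_all add: Mk_def)
    then have "M3 (i' + i) (j' + j)" unfolding M3_def by blast
    then show ?thesis using 7 by (simp add: Mk_def add.commute)
  next
    case 8
    then have "M1 i' j'" "M2 i j" using assms M2_M1 by (simp_all add: Mk_def)
    then have "M3 (i' + i) (j' + j)" unfolding M3_def by blast
    then show ?thesis using 8 by (simp add: Mk_def add.commute)
  qed
qed

definition supported :: "'k laurent set" where
  "supported = {F. \<forall>k i j. ex i j 0 \<in> keys (lookup F k) \<longrightarrow> Mk (- k) i j}"

lemma keys_lookup_mult:
  fixes F G :: "'k laurent"
  assumes "x \<in> keys (lookup (F * G) k)"
  shows "\<exists>r s y z. k = r + s \<and> x = y + z \<and> y \<in> keys (lookup F r) \<and> z \<in> keys (lookup G s)"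
proof -
  have sum: "\<exists>i\<in>A. x \<in> keys (f i)" if "x \<in> keys (sum f A)" for A and f :: "int \<Rightarrow> 'k cpoly"
    using that by (auto simp: in_keys_iff lookup_sum intro: ccontr sum.neutral)
  have "F * G = (\<Sum>r\<in>keys F. single r (lookup F r)) * (\<Sum>s\<in>keys G. single s (lookup G s))"
    by (simp add: poly_mapping_sum_single)
  also have "\<dots> = (\<Sum>r\<in>keys F. \<Sum>s\<in>keys G. single (r + s) (lookup F r * lookup G s))"
    by (simp add: sum_product mult_single)
  finally have "lookup (F * G) k = (\<Sum>r\<in>keys F. \<Sum>s\<in>keys G. lookup (single (r + s) (lookup F r * lookup G s)) k)"
    by (simp add: lookup_sum)
  then obtain r where "x \<in> keys (\<Sum>s\<in>keys G. lookup (single (r + s) (lookup F r * lookup G s)) k)"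
    using assms sum by (metis (no_types, lifting))
  then obtain s where "x \<in> keys (lookup (single (r + s) (lookup F r * lookup G s)) k)"
    using sum by (metis (no_types, lifting))
  then have "k = r + s" "x \<in> keys (lookup F r * lookup G s)" by (auto simp: lookup_single when_def split: if_splits)
  then show ?thesis using keys_mult[of "lookup F r" "lookup G s"] by blast
qed

lemma subalgebra_supported: "subalgebra supported"
proof -
  have "lconst r \<in> supported" for r
    by (auto simp: supported_def lconst_def lookup_single when_def Mk_def)
  moreover have "F + G \<in> supported" if "F \<in> supported" "G \<in> supported" for F G
    using that by (auto simp: supported_def lookup_add dest!: subsetD[OF keys_add])
  moreover have "F * G \<in> supported" if FG: "F \<in> supported" "G \<in> supported" for F G
    unfolding supported_def
  proof (intro CollectI allI impI)
    fix k i j assume "ex i j 0 \<in> keys (lookup (F * G) k)"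
    then obtain r s y z where h: "k = r + s" "ex i j 0 = y + z" "y \<in> keys (lookup F r)" "z \<in> keys (lookup G s)"
      using keys_lookup_mult by blast
    obtain i1 j1 l1 i2 j2 l2 where yz: "y = ex i1 j1 l1" "z = ex i2 j2 l2" by (metis ex_cases)
    then have e: "i = i1 + i2" "j = j1 + j2" "l1 = 0" "l2 = 0" using h(2) by (auto simp: ex_add)
    then have "Mk (- r) i1 j1" "Mk (- s) i2 j2" using FG h yz by (auto simp: supported_def)
    then have "Mk (- r + - s) (i1 + i2) (j1 + j2)" by (rule Mk_mult)
    then show "Mk (- k) i j" using h(1) e by simp
  qed
  ultimately show ?thesis by (auto simp: subalgebra_def)
qed

lemma small_multiplicity_supported:
  assumes "\<mu> \<le> 2" "rees_multiplicity w \<mu> F"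
  shows "F \<in> supported"
proof -
  obtain d f where f: "F = single (- \<mu>) f" "f \<in> sym (nat \<mu>)" "hom d f"
    using assms(2) by (auto simp: rees_multiplicity_def cox_component_iff)
  have "Mk \<mu> i j" if k: "ex i j 0 \<in> keys f" for i j
  proof -
    consider "\<mu> \<le> 0" | "\<mu> = 1" | "\<mu> = 2" using assms(1) by linarith
    then show ?thesis
      using f(2,3) k sym_1_support[of f d i j] sym_2_support[of f d i j] by cases (simp_all add: Mk_def)
  qed
  then show ?thesis by (auto simp: supported_def f(1) lookup_single when_def)
qed

section \<open>Elements of multiplicity three outside the subalgebra\<close>

lemma lattice_monomial:
  assumes "i + q * a1 = i0 + p * (a1 + a2)" "j + p * b2 = j0 + q * (b1 + b2)" "l + p * c1 + q * c2 = l0"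
    and "p + p' = P" "q + q' = Q"
  shows "(mon (Q * a1) (P * b2) (P * c1 + Q * c2) * mon i j l :: 'k cpoly) =
    mon i0 j0 l0 * (mon (a1 + a2) 0 0 ^ p * mon 0 b2 c1 ^ p' * (mon 0 (b1 + b2) 0 ^ q * mon a1 0 c2 ^ q'))"
proof -
  have "Q * a1 = q * a1 + q' * a1" "P * b2 = p * b2 + p' * b2" "P * c1 = p * c1 + p' * c1" "Q * c2 = q * c2 + q' * c2"
    using assms(4,5) by (metis distrib_right)+
  then have "Q * a1 + i = i0 + (p * (a1 + a2) + q' * a1)" "P * b2 + j = j0 + (p' * b2 + q * (b1 + b2))"
    "P * c1 + Q * c2 + l = l0 + (p' * c1 + q' * c2)"
    using assms(1-3) by linarith+
  then show ?thesis by (simp add: mon_power mon_mult)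
qed

lemma lattice_degree:
  assumes "i + q * a1 = i0 + p * (a1 + a2)" "j + p * b2 = j0 + q * (b1 + b2)" "l + p * c1 + q * c2 = l0"
  shows "a * i + b * j + c * l = a * i0 + b * j0 + c * l0"
proof -
  have "a * (i + q * a1) + b * (j + p * b2) + c * (l + p * c1 + q * c2)
      = a * (i0 + p * (a1 + a2)) + b * (j0 + q * (b1 + b2)) + c * l0"
    by (simp only: assms)
  moreover have "p * (a * (a1 + a2)) = p * (b * b2 + c * c1)" "q * (b * (b1 + b2)) = q * (a * a1 + c * c2)"
    using herzogD(7,8) by (simp_all add: distrib_left)
  ultimately show ?thesis by (simp add: algebra_simps)
qed

text \<open>Combinations of seven lattice points that vanish to order three at the point: expanding them
  in powers of \<open>F1\<close> and \<open>F2\<close> leaves only terms of total degree at least three.\<close>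

definition lattice_sum :: "nat \<Rightarrow> (int \<times> nat \<times> nat) list \<Rightarrow> 'a \<Rightarrow> 'a \<Rightarrow> 'a \<Rightarrow> 'a \<Rightarrow> 'a::comm_ring_1" where
  "lattice_sum P S x y z t = (\<Sum>(r, p, q)\<leftarrow>S. of_int r * (x ^ p * y ^ (P - p) * (z ^ q * t ^ (3 - q))))"

text \<open>In each of the three identities the seven coefficients annihilate every polynomial of
  degree at most two in \<open>(p, q)\<close>; equivalently, the sum of the terms
  \<open>r * X^p * Y^q\<close> vanishes to order three at \<open>X = Y = 1\<close>. The right side
  is this sum, homogenised by \<open>y\<close> and \<open>t\<close> and expanded in powers of
  \<open>f\<close> and \<open>g\<close>.\<close>

lemma cubic_1:
  fixes x y z t :: "'a::comm_ring_1"
  defines "f \<equiv> x - y" and "g \<equiv> z - t"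
  shows "lattice_sum 3 [(- 1, 0, 0), (5, 1, 1), (- 2, 1, 2), (- 3, 2, 1), (- 1, 2, 2), (1, 2, 3), (1, 3, 1)] x y z t
    = y^3 * (f^0 * g^3) + 2 * y^2 * t * (f^1 * g^2) + 2 * y^2 * (f^1 * g^3) + y * t^2 * (f^2 * g^1)
      + 2 * y * t * (f^2 * g^2) + y * (f^2 * g^3) + t^3 * (f^3 * g^0) + t^2 * (f^3 * g^1) + 0 * (f^3 * g^2)"
  unfolding f_def g_def lattice_sum_def by (simp add: algebra_simps power2_eq_square power3_eq_cube)

lemma cubic_2:
  fixes x y z t :: "'a::comm_ring_1"
  defines "f \<equiv> x - y" and "g \<equiv> z - t"
  shows "lattice_sum 3 [(- 1, 0, 0), (3, 1, 1), (1, 2, 1), (- 5, 2, 2), (1, 2, 3), (- 1, 3, 1), (2, 3, 2)] x y z t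
    = y^3 * (f^0 * g^3) + 2 * y^2 * t * (f^1 * g^2) + 2 * y^2 * (f^1 * g^3) + 3 * y * t^2 * (f^2 * g^1)
      + 4 * y * t * (f^2 * g^2) + y * (f^2 * g^3) + t^3 * (f^3 * g^0) + 3 * t^2 * (f^3 * g^1) + 2 * t * (f^3 * g^2)"
  unfolding f_def g_def lattice_sum_def by (simp add: algebra_simps power2_eq_square power3_eq_cube)

lemma cubic_3:
  fixes x y z t :: "'a::comm_ring_1"
  defines "f \<equiv> x - y" and "g \<equiv> z - t"
  shows "lattice_sum 4 [(1, 0, 0), (- 4, 1, 1), (1, 2, 1), (6, 2, 2), (- 1, 2, 3), (- 4, 3, 2), (1, 4, 2)] x y z t
    = (- (y^4)) * (f^0 * g^3) + (- 2 * y^3 * t) * (f^1 * g^2) + (- 2 * y^3) * (f^1 * g^3) + (- 2 * y^2 * t^2) * (f^2 * g^1)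
      + (- 3 * y^2 * t) * (f^2 * g^2) + (- (y^2)) * (f^2 * g^3) + t^3 * f * (f^3 * g^0) + 2 * t^2 * f * (f^3 * g^1) + t * f * (f^3 * g^2)"
  unfolding f_def g_def lattice_sum_def
  by (simp add: algebra_simps power2_eq_square power3_eq_cube power4_eq_xxxx)

lemma cubic_in_power:
  "h1 * (F1^0 * F2^3) + h2 * (F1^1 * F2^2) + h3 * (F1^1 * F2^3) + h4 * (F1^2 * F2^1)
      + h5 * (F1^2 * F2^2) + h6 * (F1^2 * F2^3) + h7 * (F1^3 * F2^0) + h8 * (F1^3 * F2^1) + h9 * (F1^3 * F2^2)
    \<in> ideal_power (point_ideal w) 3"
  by (intro is_idealD(2)[OF is_ideal_ideal_power] power_prod F_in_point_ideal) simp_all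

text \<open>\<open>(p, q)\<close> are coordinates along the relations of \<open>F1\<close> and
  \<open>F2\<close>, counted from the base exponent \<open>(i0, j0, l0)\<close>: a step in
  \<open>p\<close> trades \<open>mon 0 b2 c1\<close> for \<open>mon (a1 + a2) 0 0\<close>, a step in
  \<open>q\<close> trades \<open>mon a1 0 c2\<close> for \<open>mon 0 (b1 + b2) 0\<close>. The
  bounds \<open>P\<close> and 3 ensure that one common monomial factor clears all
  denominators.\<close>

definition lattice_points :: "nat \<Rightarrow> nat \<Rightarrow> nat \<Rightarrow> nat \<Rightarrow> (int \<times> nat \<times> nat \<times> nat \<times> nat \<times> nat) list \<Rightarrow> bool" where
  "lattice_points P i0 j0 l0 S \<longleftrightarrow> (\<forall>(r, p, q, i, j, l)\<in>set S. p \<le> P \<and> q \<le> 3 \<and>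
     i + q * a1 = i0 + p * (a1 + a2) \<and> j + p * b2 = j0 + q * (b1 + b2) \<and> l + p * c1 + q * c2 = l0)"

abbreviation "lattice_comb S \<equiv> comb (map (\<lambda>(r, p, q, x). (r, x)) S)"

lemma hom_lattice_comb:
  assumes "lattice_points P i0 j0 l0 S"
  shows "hom (int (a * i0 + b * j0 + c * l0)) (lattice_comb S)"
  by (rule hom_comb) (use assms in \<open>auto simp: lattice_points_def intro!: lattice_degree\<close>)

lemma lattice_comb_in_sym:
  assumes S: "lattice_points P i0 j0 l0 S"
    and mem: "lattice_sum P (map (\<lambda>(r, p, q, x). (r, p, q)) S) (mon (a1 + a2) 0 0) (mon 0 b2 c1) (mon 0 (b1 + b2) 0) (mon a1 0 c2)
      \<in> (ideal_power (point_ideal w) 3 :: 'k cpoly set)"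
  shows "lattice_comb S \<in> (sym 3 :: 'k cpoly set)"
proof (rule saturation_of_monomial)
  let ?M = "mon (3 * a1) (P * b2) (P * c1 + 3 * c2) :: 'k cpoly"
  have "?M * lattice_comb S = mon i0 j0 l0 * lattice_sum P (map (\<lambda>(r, p, q, x). (r, p, q)) S)
      (mon (a1 + a2) 0 0) (mon 0 b2 c1) (mon 0 (b1 + b2) 0) (mon a1 0 c2)"
    using S
  proof (induction S)
    case (Cons s S)
    obtain r p q i j l where s: "s = (r, p, q, i, j, l)" by (cases s)
    have "?M * mon i j l = mon i0 j0 l0 * (mon (a1 + a2) 0 0 ^ p * mon 0 b2 c1 ^ (P - p) * (mon 0 (b1 + b2) 0 ^ q * mon a1 0 c2 ^ (3 - q)))"
      using Cons.prems by (intro lattice_monomial) (auto simp: s lattice_points_def)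
    then show ?case using Cons
      by (simp add: s comb_simps lattice_sum_def lattice_points_def distrib_left mult.left_commute)
  qed (simp add: comb_simps lattice_sum_def)
  then show "?M * lattice_comb S \<in> ideal_power (point_ideal w) 3"
    using is_idealD(3)[OF is_ideal_ideal_power mem] by simp
qed

text \<open>\<open>L\<close> is the least exponent of \<open>z\<close> at the base point for which
  all seven monomials exist, so the point (3, 1) or (2, 3) loses its power of \<open>z\<close>. With
  base exponents \<open>a1 - 1\<close> and \<open>b2 - 1\<close> these two monomials are
  \<open>x^(3(a1+a2)-1) y^(b1-b2-1)\<close> and \<open>x^(2a2-1) y^(3b1+2b2-1)\<close>, each just
  short of the products of \<open>M1\<close> and \<open>M2\<close>.\<close>

lemma witness_1:
  assumes c: "c2 < c1" and b: "b2 < b1"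
  shows "\<exists>(f :: 'k cpoly) d i j. f \<in> sym 3 \<and> hom d f \<and> ex i j 0 \<in> keys f \<and> \<not> M3 i j"
proof -
  obtain \<alpha> \<beta> \<gamma> r where s: "a1 = Suc \<alpha>" "b2 = Suc \<beta>" "a2 = Suc \<gamma>" "b1 = Suc (b2 + r)"
    using herzogD(1-6) b by (metis Suc_pred less_iff_Suc_add)
  define L where "L = max (3 * c1 + c2) (2 * c1 + 3 * c2)"
  have L: "3 * c1 + c2 \<le> L" "2 * c1 + 3 * c2 \<le> L" by (simp_all add: L_def)
  define S where "S = [(- 1, 0, 0, \<alpha>, \<beta>, L), (5, 1, 1, \<alpha> + a2, \<beta> + b1, L - (c1 + c2)),
    (- 2, 1, 2, \<gamma>, \<beta> + (2 * b1 + b2), L - (c1 + 2 * c2)),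
    (- 3, 2, 1, \<alpha> + (a1 + 2 * a2), \<beta> + Suc r, L - (2 * c1 + c2)),
    (- 1, 2, 2, \<alpha> + 2 * a2, \<beta> + 2 * b1, L - (2 * c1 + 2 * c2)),
    (1, 2, 3, a2 + \<gamma>, \<beta> + (3 * b1 + b2), L - (2 * c1 + 3 * c2)),
    (1, 3, 1, \<alpha> + (2 * a1 + 3 * a2), r, L - (3 * c1 + c2)) :: int \<times> nat \<times> nat \<times> _]"
  have S: "lattice_points 3 \<alpha> \<beta> L S" unfolding lattice_points_def S_def using s L by simp
  have sym: "lattice_comb S \<in> (sym 3 :: 'k cpoly set)"
    by (rule lattice_comb_in_sym[OF S])
       (simp only: S_def list.map prod.case cubic_1 F1_def[symmetric] F2_def[symmetric] cubic_in_power)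
  show ?thesis
  proof (cases "2 * c1 + 3 * c2 \<le> 3 * c1 + c2")
    case True
    then have "L = 3 * c1 + c2" by (simp add: L_def)
    then have "ex (\<alpha> + (2 * a1 + 3 * a2)) r 0 \<in> keys (lattice_comb S :: 'k cpoly)"
      using s c True herzogD by (simp add: in_keys_iff lookup_comb S_def)
    moreover have "\<not> M3 (\<alpha> + (2 * a1 + 3 * a2)) r"
      unfolding M3_def M1_def M2_def using s c by (intro notI; elim exE conjE disjE; simp)
    ultimately show ?thesis using sym hom_lattice_comb[OF S] by blast
  next
    case False
    then have "L = 2 * c1 + 3 * c2" by (simp add: L_def)
    then have "ex (a2 + \<gamma>) (\<beta> + (3 * b1 + b2)) 0 \<in> keys (lattice_comb S :: 'k cpoly)"
      using s c False herzogD by (simp add: in_keys_iff lookup_comb S_def)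
    moreover have "\<not> M3 (a2 + \<gamma>) (\<beta> + (3 * b1 + b2))"
      unfolding M3_def M1_def M2_def using s c a12 by (intro notI; elim exE conjE disjE; simp)
    ultimately show ?thesis using sym hom_lattice_comb[OF S] by blast
  qed
qed

text \<open>The base exponent of \<open>x\<close> is lowered to \<open>a1 - a2 - 1\<close>, so that
  (2, 3) gives \<open>x^(a2-1) y^(3b1+2b2-1)\<close>, just short of the product of
  \<open>y^(b1+b2)\<close> and \<open>y^(2b1+b2)\<close>, the latter now being in \<open>M2\<close>.
  At (1, 2) the exponent of \<open>x\<close> would be -1, so \<open>cubic_2\<close> replaces that
  point by (3, 2).\<close>

lemma witness_2:
  assumes c: "c1 < c2" and b: "b2 < b1"
  shows "\<exists>(f :: 'k cpoly) d i j. f \<in> sym 3 \<and> hom d f \<and> ex i j 0 \<in> keys f \<and> \<not> M3 i j"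
proof -
  have "a2 < a1" using c c12 by simp
  then obtain \<alpha> \<beta> \<gamma> r where s: "a1 = Suc (a2 + \<alpha>)" "b2 = Suc \<beta>" "a2 = Suc \<gamma>" "b1 = Suc (b2 + r)"
    using herzogD(1-6) b by (metis Suc_pred less_iff_Suc_add)
  define L where "L = 2 * c1 + 3 * c2"
  define S where "S = [(- 1, 0, 0, \<alpha>, \<beta>, L), (3, 1, 1, \<alpha> + a2, \<beta> + b1, L - (c1 + c2)),
    (1, 2, 1, \<alpha> + (a1 + 2 * a2), \<beta> + Suc r, L - (2 * c1 + c2)),
    (- 5, 2, 2, \<alpha> + 2 * a2, \<beta> + 2 * b1, L - (2 * c1 + 2 * c2)),
    (1, 2, 3, \<gamma>, \<beta> + (3 * b1 + b2), 0), (- 1, 3, 1, \<alpha> + (2 * a1 + 3 * a2), r, L - (3 * c1 + c2)),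
    (2, 3, 2, \<alpha> + (a1 + 3 * a2), \<beta> + (b1 + Suc r), L - (3 * c1 + 2 * c2)) :: int \<times> nat \<times> nat \<times> _]"
  have S: "lattice_points 3 \<alpha> \<beta> L S" unfolding lattice_points_def S_def L_def using s c by simp
  have sym: "lattice_comb S \<in> (sym 3 :: 'k cpoly set)"
    by (rule lattice_comb_in_sym[OF S])
       (simp only: S_def list.map prod.case cubic_2 F1_def[symmetric] F2_def[symmetric] cubic_in_power)
  have "ex \<gamma> (\<beta> + (3 * b1 + b2)) 0 \<in> keys (lattice_comb S :: 'k cpoly)"
    using s c herzogD by (simp add: in_keys_iff lookup_comb S_def L_def)
  moreover have "\<not> M3 \<gamma> (\<beta> + (3 * b1 + b2))"
    unfolding M3_def M1_def M2_def using s c by (intro notI; elim exE conjE disjE; simp)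
  ultimately show ?thesis using sym hom_lattice_comb[OF S] by blast
qed

text \<open>For \<open>b1 = b2\<close> the exponent of \<open>y\<close> at (3, 1) would be -1;
  \<open>cubic_3\<close> uses (4, 2) in its place. The monomial without \<open>z\<close> is the one
  at (2, 3), as in \<open>witness_2\<close>, or \<open>x^(3(a1+a2)-1) y^(b2-1)\<close> at (4,
  2).\<close>

lemma witness_3:
  assumes c: "c1 < c2" and b: "b1 = b2"
  shows "\<exists>(f :: 'k cpoly) d i j. f \<in> sym 3 \<and> hom d f \<and> ex i j 0 \<in> keys f \<and> \<not> M3 i j"
proof -
  have "a2 < a1" using c c12 by simp
  then obtain \<alpha> \<beta> \<gamma> where s: "a1 = Suc (a2 + \<alpha>)" "b2 = Suc \<beta>" "a2 = Suc \<gamma>" "b1 = b2"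
    using herzogD(1-6) b by (metis Suc_pred less_iff_Suc_add)
  define L where "L = max (2 * c1 + 3 * c2) (4 * c1 + 2 * c2)"
  have L: "2 * c1 + 3 * c2 \<le> L" "4 * c1 + 2 * c2 \<le> L" by (simp_all add: L_def)
  define S where "S = [(1, 0, 0, \<alpha>, \<beta>, L), (- 4, 1, 1, \<alpha> + a2, \<beta> + b1, L - (c1 + c2)),
    (1, 2, 1, \<alpha> + (a1 + 2 * a2), \<beta>, L - (2 * c1 + c2)), (6, 2, 2, \<alpha> + 2 * a2, \<beta> + 2 * b1, L - (2 * c1 + 2 * c2)),
    (- 1, 2, 3, \<gamma>, \<beta> + 4 * b1, L - (2 * c1 + 3 * c2)),
    (- 4, 3, 2, \<alpha> + (a1 + 3 * a2), \<beta> + b1, L - (3 * c1 + 2 * c2)),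
    (1, 4, 2, \<alpha> + (2 * a1 + 4 * a2), \<beta>, L - (4 * c1 + 2 * c2)) :: int \<times> nat \<times> nat \<times> _]"
  have S: "lattice_points 4 \<alpha> \<beta> L S" unfolding lattice_points_def S_def using s c L by simp
  have sym: "lattice_comb S \<in> (sym 3 :: 'k cpoly set)"
    by (rule lattice_comb_in_sym[OF S])
       (simp only: S_def list.map prod.case cubic_3 F1_def[symmetric] F2_def[symmetric] cubic_in_power)
  show ?thesis
  proof (cases "4 * c1 + 2 * c2 \<le> 2 * c1 + 3 * c2")
    case True
    then have "L = 2 * c1 + 3 * c2" by (simp add: L_def)
    then have "ex \<gamma> (\<beta> + 4 * b1) 0 \<in> keys (lattice_comb S :: 'k cpoly)"
      using s c True herzogD by (simp add: in_keys_iff lookup_comb S_def)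
    moreover have "\<not> M3 \<gamma> (\<beta> + 4 * b1)"
      unfolding M3_def M1_def M2_def using s c by (intro notI; elim exE conjE disjE; simp)
    ultimately show ?thesis using sym hom_lattice_comb[OF S] by blast
  next
    case False
    then have "L = 4 * c1 + 2 * c2" by (simp add: L_def)
    then have "ex (\<alpha> + (2 * a1 + 4 * a2)) \<beta> 0 \<in> keys (lattice_comb S :: 'k cpoly)"
      using s c False herzogD by (simp add: in_keys_iff lookup_comb S_def)
    moreover have "\<not> M3 (\<alpha> + (2 * a1 + 4 * a2)) \<beta>"
      unfolding M3_def M1_def M2_def using s c by (intro notI; elim exE conjE disjE; simp)
    ultimately show ?thesis using sym hom_lattice_comb[OF S] by blast
  qed
qed

lemma sym_3_witness:
  "\<exists>(f :: 'k cpoly) d i j. f \<in> sym 3 \<and> hom d f \<and> ex i j 0 \<in> keys f \<and> \<not> M3 i j"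
proof -
  consider "c2 < c1" "b2 < b1" | "c1 < c2" "b2 < b1" | "c1 < c2" "b1 = b2" using b12 c12 by linarith
  then show ?thesis by cases (fact witness_1 witness_2 witness_3)+
qed

theorem not_generated: "\<not> cox_ring_generated_up_to K w 2"
proof
  assume "cox_ring_generated_up_to K w 2"
  then obtain G :: "'k laurent set" where G: "\<forall>F\<in>G. \<exists>\<mu>\<le>2. rees_multiplicity w \<mu> F" "subalgebra hull G = cox_ring w"
    unfolding cox_ring_generated_up_to_def by blast
  have "cox_ring w \<subseteq> supported"
    unfolding G(2)[symmetric] by (rule hull_minimal[of _ _ subalgebra, OF _ subalgebra_supported]) (use G(1) small_multiplicity_supported in blast)
  moreover obtain f :: "'k cpoly" and d i j where f: "f \<in> sym 3" "hom d f" "ex i j 0 \<in> keys f" "\<not> M3 i j"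
    using sym_3_witness by blast
  then have "single (- 3) f \<in> cox_component w (d, - 3)" by (auto simp: cox_component_iff)
  then have "single (- 3) f \<in> cox_ring w" by (rule cox_component_subset)
  ultimately have "single (- 3) f \<in> supported" by blast
  moreover have "ex i j 0 \<in> keys (lookup (single (- 3) f) (- 3))" using f(3) by simp
  ultimately have "Mk (- (- 3)) i j" unfolding supported_def by blast
  then show False using f(4) by (simp add: Mk_def)
qed

end

section \<open>The equivalence\<close>

locale triangle_weights =
  fixes a b c :: nat
  assumes positive: "a > 0" "b > 0" "c > 0"
    and pairwise_coprime: "coprime a b" "coprime a c" "coprime b c"
    and not_in_monoid: "a \<notin> monoid2 b c" "b \<notin> monoid2 a c" "c \<notin> monoid2 a b"
begin

abbreviation "w \<equiv> weights a b c"

lemma weights_positive: "w v > 0"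
  using positive by (cases v) auto

lemma weights_coprime: "u \<noteq> v \<Longrightarrow> coprime (w u) (w v)"
  using pairwise_coprime by (cases u; cases v) (auto simp: coprime_commute)

lemma weights_not_in_monoid: "u \<noteq> v \<Longrightarrow> u \<noteq> t \<Longrightarrow> v \<noteq> t \<Longrightarrow> w u \<notin> monoid2 (w v) (w t)"
  using not_in_monoid by (cases u; cases v; cases t) (simp_all add: monoid2_commute)

lemma blowup_weights:
  "vx \<noteq> vy \<Longrightarrow> vx \<noteq> vz \<Longrightarrow> vy \<noteq> vz \<Longrightarrow> blowup w vx vy vz (w vx) (w vy) (w vz)"
  by unfold_locales (auto intro: weights_positive)

lemma ordered_conclusions:
  fixes K :: "'k::field_char_0 itself"
  assumes "bij \<sigma>" and cond: "ordered_condition (w (\<sigma> CX)) (w (\<sigma> CY)) (w (\<sigma> CZ)) n m"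
  shows "cox_ring_generated_up_to K w 2 \<and> mori_dream_surface K w \<and> cox_ring_presented K w \<sigma> n m"
proof -
  define a' b' c' where abc: "a' = w (\<sigma> CX)" "b' = w (\<sigma> CY)" "c' = w (\<sigma> CZ)"
  have d: "\<sigma> CX \<noteq> \<sigma> CY" "\<sigma> CX \<noteq> \<sigma> CZ" "\<sigma> CY \<noteq> \<sigma> CZ"
    using \<open>bij \<sigma>\<close> by (auto simp: bij_def inj_eq)
  have cond': "ordered_condition a' b' c' n m" using cond by (simp add: abc)
  have cop: "coprime b' c'" unfolding abc by (rule weights_coprime[OF d(3)])
  have ni: "a' \<notin> monoid2 b' c'" unfolding abc by (rule weights_not_in_monoid[OF d])
  note par = ordered_condition_parity[OF cond' cop ni]
  have o: "n > 0" "m > 0" "2 * a' = n * b' + m * c'" "3 * m \<le> b'" "3 * n \<le> c'"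
    using cond' by (simp_all add: ordered_condition_def)
  obtain p q where "c' - 3 * n = 2 * p" "b' - 3 * m = 2 * q" using par(3,6) unfolding dvd_def by blast
  then have "c' = 3 * n + 2 * p" "b' = 3 * m + 2 * q" using o by linarith+
  then interpret ordered_blowup w "\<sigma> CX" "\<sigma> CY" "\<sigma> CZ" a' b' c' n m p q
    using blowup_weights[OF d] o cop by (simp add: ordered_blowup_def ordered_blowup_axioms_def abc)
  show ?thesis
    using presented_conclusions(1,2)[of K] presented_conclusions(3)[where 'k = 'k]
    unfolding cox_ring_presented_def abc by blast
qed

lemma herzog_conclusion:
  fixes K :: "'k::field_char_0 itself"
  assumes d: "vx \<noteq> vy" "vx \<noteq> vz" "vy \<noteq> vz"
    and h: "herzog (w vx) (w vy) (w vz) a1 a2 b1 b2 c1 c2"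
    and gen: "cox_ring_generated_up_to K w 2"
    and cases: "a1 = a2 \<and> b2 \<le> b1 \<and> c1 \<le> c2 \<or> a2 \<le> a1 \<and> b2 \<le> b1 \<and> (c2 < c1 \<and> b2 < b1 \<or> c1 < c2 \<and> a2 < a1)"
  shows "\<exists>\<sigma> n m. bij \<sigma> \<and> ordered_condition (w (\<sigma> CX)) (w (\<sigma> CY)) (w (\<sigma> CZ)) n m"
  using cases
proof
  assume *: "a1 = a2 \<and> b2 \<le> b1 \<and> c1 \<le> c2"
  define \<sigma> where "\<sigma> v = (case v of CX \<Rightarrow> vx | CY \<Rightarrow> vy | CZ \<Rightarrow> vz)" for v
  have "inj \<sigma>" by (rule injI) (use d in \<open>auto simp: \<sigma>_def split: coord.splits\<close>)
  moreover have "v \<in> range \<sigma>" for v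
    using blowup.coord_cases[OF blowup_weights[OF d], of v] by (auto simp: \<sigma>_def intro: range_eqI[of _ _ CX] range_eqI[of _ _ CY] range_eqI[of _ _ CZ])
  ultimately have "bij \<sigma>" by (auto simp: bij_def)
  moreover have "ordered_condition (w vx) (w vy) (w vz) b2 c1"
    using herzog_ordered[OF h] * d by (simp add: weights_coprime)
  ultimately show ?thesis by (intro exI[of _ \<sigma>] exI[of _ b2] exI[of _ c1]) (simp add: \<sigma>_def)
next
  assume "a2 \<le> a1 \<and> b2 \<le> b1 \<and> (c2 < c1 \<and> b2 < b1 \<or> c1 < c2 \<and> a2 < a1)"
  then interpret bad_blowup w vx vy vz "w vx" "w vy" "w vz" a1 a2 b1 b2 c1 c2 K
    using blowup_weights[OF d] h by (simp add: bad_blowup_def bad_blowup_axioms_def)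
  show ?thesis using not_generated gen by blast
qed

text \<open>Rotation permutes the signs of the three differences cyclically; reflection reverses
  their cyclic order and negates them. Every sign pattern is brought by one of the six resulting
  orderings into a form where \<open>herzog_conclusion\<close> applies.\<close>

lemma generated_imp_ordered:
  fixes K :: "'k::field_char_0 itself"
  assumes gen: "cox_ring_generated_up_to K w 2"
  shows "\<exists>\<sigma> n m. bij \<sigma> \<and> ordered_condition (w (\<sigma> CX)) (w (\<sigma> CY)) (w (\<sigma> CZ)) n m"
proof -
  obtain a1 a2 b1 b2 c1 c2 where "herzog a b c a1 a2 b1 b2 c1 c2"
    using herzog_exists[OF positive pairwise_coprime not_in_monoid] by blast
  then have h: "herzog (w CX) (w CY) (w CZ) a1 a2 b1 b2 c1 c2" by simp
  let ?good = "\<lambda>a1 a2 b1 b2 c1 c2. a1 = a2 \<and> b2 \<le> b1 \<and> c1 \<le> c2 \<or> a2 \<le> a1 \<and> b2 \<le> b1 \<and> (c2 < c1 \<and> b2 < b1 \<or> c1 < c2 \<and> a2 < a1)"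
  note h2 = herzog_rotate[OF h] and h4 = herzog_reflect[OF h]
  note h3 = herzog_rotate[OF h2] and h5 = herzog_rotate[OF h4]
  note h6 = herzog_rotate[OF h5]
  consider "?good a1 a2 b1 b2 c1 c2" | "?good b1 b2 c1 c2 a1 a2" | "?good c1 c2 a1 a2 b1 b2"
    | "?good a2 a1 c2 c1 b2 b1" | "?good c2 c1 b2 b1 a2 a1" | "?good b2 b1 a2 a1 c2 c1"
    by (cases a1 a2 rule: linorder_cases; cases b1 b2 rule: linorder_cases; cases c1 c2 rule: linorder_cases) auto
  then show ?thesis
  proof cases
    case 1
    show ?thesis by (rule herzog_conclusion[OF _ _ _ h gen 1]) simp_all
  next
    case 2
    show ?thesis by (rule herzog_conclusion[OF _ _ _ h2 gen 2]) simp_all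
  next
    case 3
    show ?thesis by (rule herzog_conclusion[OF _ _ _ h3 gen 3]) simp_all
  next
    case 4
    show ?thesis by (rule herzog_conclusion[OF _ _ _ h4 gen 4]) simp_all
  next
    case 5
    show ?thesis by (rule herzog_conclusion[OF _ _ _ h5 gen 5]) simp_all
  next
    case 6
    show ?thesis by (rule herzog_conclusion[OF _ _ _ h6 gen 6]) simp_all
  qed
qed

end

theorem theorem1p2:
  fixes a b c :: nat
    and K :: "'k::{alg_closed_field, field_char_0} itself"
  assumes "a > 0" "b > 0" "c > 0"
    and "coprime a b" "coprime a c" "coprime b c"
    and "a \<notin> monoid2 b c" "b \<notin> monoid2 a c" "c \<notin> monoid2 a b"
  shows "(cox_ring_generated_up_to K (weights a b c) 2 \<longleftrightarrow>
            (\<exists>\<sigma> n m. bij \<sigma> \<and>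
               ordered_condition (weights a b c (\<sigma> CX)) (weights a b c (\<sigma> CY))
                 (weights a b c (\<sigma> CZ)) n m)) \<and>
         (cox_ring_generated_up_to K (weights a b c) 2 \<or>
            (\<exists>\<sigma> n m. bij \<sigma> \<and>
               ordered_condition (weights a b c (\<sigma> CX)) (weights a b c (\<sigma> CY))
                 (weights a b c (\<sigma> CZ)) n m) \<longrightarrow>
            mori_dream_surface K (weights a b c) \<and>
            (\<forall>\<sigma> n m. bij \<sigma> \<and>
               ordered_condition (weights a b c (\<sigma> CX)) (weights a b c (\<sigma> CY))
                 (weights a b c (\<sigma> CZ)) n m \<longrightarrow>
               cox_ring_presented K (weights a b c) \<sigma> n m))"
proof -
  interpret triangle_weights a b c by unfold_locales (fact assms)+
  show ?thesis using generated_imp_ordered[of K] ordered_conclusions[of _ _ _ K] by blast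
qed

end
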